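(* Let $(\mathcal A,m_{\mathcal A})$, $(\mathcal B,m_{\mathcal B})$, $(\mathcal C,m_{\mathcal C})$ be $A_\infty$-categories and $\Phi_0:\mathcal O_{\mathcal A}\to\mathcal O_{\mathcal B}$, $\Psi_0:\mathcal O_{\mathcal B}\to\mathcal O_{\mathcal C}$ maps. If $(\Phi_0,f),(\Phi_0,g):(\mathcal A,m_{\mathcal A})\to(\mathcal B,m_{\mathcal B})$ are homotopic $A_\infty$-morphisms and $(\Psi_0,h):(\mathcal B,m_{\mathcal B})\to(\mathcal C,m_{\mathcal C})$ is an $A_\infty$-morphism, then $(\Psi_0\circ\Phi_0,h\circ f)$ and $(\Psi_0\circ\Phi_0,h\circ g)$ are homotopic.
   Context: Conventions. $\Bbbk$ is a field of characteristic different from $2$ and $3$. Graded spaces are $\mathbb Z$-graded, $V[n]^i=V^{n+i}$. $\mathcal Hom$ is the graded space of maps of all degrees, products are graded products, and the Koszul sign rule is used. For a graded space $V$, $V[t]$ is the space of polynomials in $t$ with coefficients in $V$. A graded quiver $\mathcal A$ with object set $\mathcal O_{\mathcal A}$ is a family of graded spaces ${}_x\mathcal A_y$; for $\bar x=(x_1,\dots,x_p)$, $\mathcal A[1]^{\otimes\bar x}={}_{x_1}\mathcal A_{x_2}[1]\otimes\cdots\otimes{}_{x_{p-1}}\mathcal A_{x_p}[1]$. For $\Phi_0:\mathcal O_{\mathcal A}\to\mathcal O_{\mathcal B}$ let $C_{\Phi_0}(\mathcal A,\mathcal B)[1]=\prod_{p\ge2}\prod_{\bar x\in\mathcal O_{\mathcal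 A}^p}\mathcal Hom(\mathcal A[1]^{\otimes\bar x},{}_{\Phi_0(x_1)}\mathcal B_{\Phi_0(x_p)}[1])$ and $C(\mathcal A)[1]=C_{\mathrm{id}}(\mathcal A,\mathcal A)[1]$. For $f\in C_{\Phi_0}(\mathcal A,\mathcal B)[1]$, $m\in C(\mathcal A)[1]$, $(f\circ_Gm)^{\bar x}=\sum f(\mathrm{id}^{\otimes}\otimes m\otimes\mathrm{id}^{\otimes})$ (all insertions). For $h\in C_{\Psi_0}(\mathcal B,\mathcal C)[1]$ and $f_j\in C_{\Phi_0}(\mathcal A,\mathcal B)[1]$, $h(f_1,\dots,f_r)^{\bar x}=\sum h\circ(f_1\otimes\cdots\otimes f_r)$ over all decompositions of $\bar x$ into $r$ consecutive pieces, using the component of $h$ with $r$ inputs; $h\circ f=\sum_{r\ge1}h(f,\dots,f)$. The same notation is used for elements of $C(\mathcal B)[1]$ applied to elements of $C_{\Phi_0}(\mathcal A,\mathcal B)[1]$. An $A_\infty$-structure on $\mathcal A$ is $m_{\mathcal A}\in C(\mathcal A)[1]$ of degree $1$ with $m_{\mathcal A}\circ_Gm_{\mathcal A}=0$; an $A_\infty$-category is a graded quiver with such a structure. An $A_\infty$-morphism $(\Phi_0,f):(\mathcal A,m_{\mathcal A})\to(\mathcal B,m_{\mathcal B})$ is $f\in C_{\Phi_0}(\mathcal A,\mathcal B)[1]$ of degree $0$ with $f\circ_Gm_{\mathcal A}=\sum_{r\ge1}m_{\mathcal B}(f,\dots,f)$. Homotopy. Two $A_\infty$-morphisms $(\Phi_0,f),(\Phi_0,g):(\mathcal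 A,m_{\mathcal A})\to(\mathcal B,m_{\mathcal B})$ are homotopic if there are $a(t)$ (degree $0$) and $b(t)$ (degree $-1$) in $C_{\Phi_0}(\mathcal A,\mathcal B)[1][t]$ with $a(0)=f$, $a(1)=g$, $(\Phi_0,a(t))$ an $A_\infty$-morphism $(\mathcal A,m_{\mathcal A})\to(\mathcal B,m_{\mathcal B})$ for all $t\in\Bbbk$ and, for all $t\in\Bbbk$, $\frac{\partial a}{\partial t}=\sum_{r\ge1}\sum_{j=1}^rm_{\mathcal B}(a,\dots,\underset{j}{b},\dots,a)+b\circ_Gm_{\mathcal A}$.
   Formalization: In homotopies, a(t) and b(t) are polynomial in t separately for each tuple of objects, with no degree bound uniform over tuples; with polynomials over the whole product C(A,B)[1] the claim fails, since h∘a(t) can have unbounded degree in t. *)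

theory Defs
  imports Complex_Main "HOL-Computational_Algebra.Computational_Algebra"
begin

text \<open>
  The spaces of morphisms \<open>hom Q x y i\<close> (the degree \<open>i\<close> part of the graded space
  from \<open>x\<close> to \<open>y\<close>) are subspaces of one ambient vector space; this is
  no restriction, since any family of vector spaces embeds into its direct sum. A graded space
  is the family of its homogeneous parts: no relation between the subspaces for
  different \<open>x\<close>, \<open>y\<close>, \<open>i\<close> is assumed.
\<close>

record ('k, 'o, 'v) gquiver =
  obj :: "'o set"
  hom :: "'o \<Rightarrow> 'o \<Rightarrow> int \<Rightarrow> 'v set"
  scl :: "'k \<Rightarrow> 'v \<Rightarrow> 'v"

definition graded_quiver :: "('k::field, 'o, 'v::ab_group_add) gquiver \<Rightarrow> bool" where
  "graded_quiver Q \<longleftrightarrow>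
     vector_space (scl Q) \<and>
     (\<forall>x\<in>obj Q. \<forall>y\<in>obj Q. \<forall>i. module.subspace (scl Q) (hom Q x y i))"

definition obj_tuples :: "('k, 'o, 'v) gquiver \<Rightarrow> 'o list set" where
  "obj_tuples Q = {xs. length xs \<ge> 2 \<and> set xs \<subseteq> obj Q}"

text \<open>
  \<open>inputs Q xs\<close> are the families of homogeneous elements of the tensor factors of
  \<open>Q[1]\<^sup>\<otimes>\<close> along \<open>xs\<close>. Each element is tagged with its degree in the shifted space
  \<open>Q[1]\<close>, so that an element tagged \<open>i\<close> lies in \<open>hom Q x y (i + 1)\<close>.
\<close>

definition inputs :: "('k, 'o, 'v) gquiver \<Rightarrow> 'o list \<Rightarrow> (int \<times> 'v) list set" where
  "inputs Q xs =
     {vs. length xs = Suc (length vs) \<and>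
          (\<forall>j<length vs. snd (vs ! j) \<in> hom Q (xs ! j) (xs ! Suc j) (fst (vs ! j) + 1))}"

definition total_deg :: "(int \<times> 'v) list \<Rightarrow> int" where
  "total_deg vs = sum_list (map fst vs)"

text \<open>
  Homogeneous maps out of \<open>A[1]\<^sup>\<otimes>\<close> are given as multilinear maps on homogeneous elements.
  \<open>cochains A B \<Phi> d\<close> is the degree \<open>d\<close> part of \<open>C\<^sub>\<Phi>(A,B)[1]\<close>; since its elements
  map between the shifted spaces, the value lies in (unshifted) degree
  \<open>total_deg vs + d + 1\<close>. Cochains are only meaningful on \<open>obj_tuples\<close> and \<open>inputs\<close>, and are
  compared there by \<open>cochain_eq\<close>.
\<close>

type_synonym ('o, 'v, 'w) cochain = "'o list \<Rightarrow> (int \<times> 'v) list \<Rightarrow> 'w"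

definition cochains ::
  "('k::field, 'o, 'v::ab_group_add) gquiver \<Rightarrow> ('k, 'p, 'w::ab_group_add) gquiver \<Rightarrow>
   ('o \<Rightarrow> 'p) \<Rightarrow> int \<Rightarrow> ('o, 'v, 'w) cochain set" where
  "cochains A B \<Phi> d =
     {f. \<forall>xs\<in>obj_tuples A. \<forall>vs\<in>inputs A xs.
           f xs vs \<in> hom B (\<Phi> (hd xs)) (\<Phi> (last xs)) (total_deg vs + d + 1) \<and>
           (\<forall>j<length vs. let i = fst (vs ! j); V = hom A (xs ! j) (xs ! Suc j) (i + 1) in
              (\<forall>u\<in>V. \<forall>w\<in>V.
                 f xs (vs[j := (i, u + w)]) = f xs (vs[j := (i, u)]) + f xs (vs[j := (i, w)])) \<and>
              (\<forall>c. \<forall>u\<in>V.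
                 f xs (vs[j := (i, scl A c u)]) = scl B c (f xs (vs[j := (i, u)]))))}"

definition cochain_eq ::
  "('k, 'o, 'v) gquiver \<Rightarrow> ('o, 'v, 'w) cochain \<Rightarrow> ('o, 'v, 'w) cochain \<Rightarrow> bool" where
  "cochain_eq A f g \<longleftrightarrow> (\<forall>xs\<in>obj_tuples A. \<forall>vs\<in>inputs A xs. f xs vs = g xs vs)"

definition ksign :: "int \<Rightarrow> 'v::ab_group_add \<Rightarrow> 'v" where
  "ksign k v = (if even k then v else - v)"

text \<open>
  \<open>gcomp f e m\<close> is \<open>f \<circ>\<^sub>G m\<close> for \<open>m\<close> of degree \<open>e\<close>: the sum over all ways of applying \<open>m\<close> to the
  \<open>l \<ge> 1\<close> consecutive inputs following the first \<open>i\<close> ones. The Koszul sign comes from moving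
  \<open>m\<close> past these \<open>i\<close> inputs.
\<close>

definition gcomp ::
  "('o, 'v, 'w::ab_group_add) cochain \<Rightarrow> int \<Rightarrow> ('o, 'v, 'v) cochain \<Rightarrow> ('o, 'v, 'w) cochain" where
  "gcomp f e m xs vs =
     (\<Sum>(i, l) \<in> {(i, l). 1 \<le> l \<and> i + l \<le> length vs}.
        ksign (e * total_deg (take i vs))
          (f (take (Suc i) xs @ drop (i + l) xs)
             (take i vs @
              [(total_deg (take l (drop i vs)) + e,
                m (take (Suc l) (drop i xs)) (take l (drop i vs)))] @
              drop (i + l) vs)))"

text \<open>
  A decomposition of a tuple with \<open>n\<close> inputs into \<open>r\<close> consecutive pieces (two neighbouring pieces
  share one object, and each piece has at least one input) is encoded by the list of the numbers
  of inputs of the pieces.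
\<close>

definition pieces :: "nat \<Rightarrow> nat \<Rightarrow> nat list set" where
  "pieces n r = {ns. length ns = r \<and> 0 \<notin> set ns \<and> sum_list ns = n}"

definition piece_start :: "nat list \<Rightarrow> nat \<Rightarrow> nat" where
  "piece_start ns j = sum_list (take j ns)"

definition piece_obj :: "nat list \<Rightarrow> 'o list \<Rightarrow> nat \<Rightarrow> 'o list" where
  "piece_obj ns xs j = take (Suc (ns ! j)) (drop (piece_start ns j) xs)"

definition piece_in :: "nat list \<Rightarrow> (int \<times> 'v) list \<Rightarrow> nat \<Rightarrow> (int \<times> 'v) list" where
  "piece_in ns vs j = take (ns ! j) (drop (piece_start ns j) vs)"

text \<open>
  \<open>brace \<Phi> h [(d\<^sub>1, f\<^sub>1), \<dots>, (d\<^sub>r, f\<^sub>r)]\<close> is \<open>h(f\<^sub>1, \<dots>, f\<^sub>r)\<close> for \<open>f\<^sub>j\<close> of degree \<open>d\<^sub>j\<close>. The Koszul sign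
  comes from evaluating \<open>f\<^sub>1 \<otimes> \<dots> \<otimes> f\<^sub>r\<close>: each \<open>f\<^sub>j\<close> moves past the inputs of the pieces before it.
\<close>

definition brace ::
  "('o \<Rightarrow> 'p) \<Rightarrow> ('p, 'w, 'u::ab_group_add) cochain \<Rightarrow> (int \<times> ('o, 'v, 'w) cochain) list \<Rightarrow>
   ('o, 'v, 'u) cochain" where
  "brace \<Phi> h fs xs vs =
     (\<Sum>ns \<in> pieces (length vs) (length fs).
        ksign (\<Sum>j<length fs. fst (fs ! j) * total_deg (take (piece_start ns j) vs))
          (h (map (\<lambda>j. \<Phi> (xs ! piece_start ns j)) [0..<Suc (length fs)])
             (map (\<lambda>j. (total_deg (piece_in ns vs j) + fst (fs ! j),
                        snd (fs ! j) (piece_obj ns xs j) (piece_in ns vs j)))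
               [0..<length fs])))"

text \<open>
  \<open>h \<circ> f\<close> for \<open>f\<close> of degree 0. The sum over all \<open>r \<ge> 1\<close> stops at the number of inputs, as
  there are no decompositions into more pieces.
\<close>

definition ccomp ::
  "('o \<Rightarrow> 'p) \<Rightarrow> ('p, 'w, 'u::ab_group_add) cochain \<Rightarrow> ('o, 'v, 'w) cochain \<Rightarrow>
   ('o, 'v, 'u) cochain" where
  "ccomp \<Phi> h f xs vs = (\<Sum>r = 1..length vs. brace \<Phi> h (replicate r (0, f)) xs vs)"

definition ainf_category ::
  "('k::field, 'o, 'v::ab_group_add) gquiver \<Rightarrow> ('o, 'v, 'v) cochain \<Rightarrow> bool" where
  "ainf_category A m \<longleftrightarrow>
     graded_quiver A \<and> m \<in> cochains A A id 1 \<and> cochain_eq A (gcomp m 1 m) (\<lambda>_ _. 0)"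

definition ainf_morphism ::
  "('k::field, 'o, 'v::ab_group_add) gquiver \<Rightarrow> ('o, 'v, 'v) cochain \<Rightarrow>
   ('k, 'p, 'w::ab_group_add) gquiver \<Rightarrow> ('p, 'w, 'w) cochain \<Rightarrow>
   ('o \<Rightarrow> 'p) \<Rightarrow> ('o, 'v, 'w) cochain \<Rightarrow> bool" where
  "ainf_morphism A mA B mB \<Phi> f \<longleftrightarrow>
     \<Phi> \<in> obj A \<rightarrow> obj B \<and> f \<in> cochains A B \<Phi> 0 \<and>
     cochain_eq A (gcomp f 1 mA) (ccomp \<Phi> mB f)"

text \<open>
  An element of \<open>C\<^sub>\<Phi>(A,B)[1][t]\<close> is given by the sequence \<open>a\<close> of its coefficients. Polynomials in
  a product are understood factorwise: for every tuple \<open>xs\<close> the component at \<open>xs\<close> is a polynomial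
  with coefficients in the graded space of maps at \<open>xs\<close>, with no bound on the degrees that is
  uniform in \<open>xs\<close>. (A uniform bound would not be preserved by \<open>a \<mapsto> h \<circ> a\<close>: the number of
  factors \<open>a\<close> in \<open>h(a, \<dots>, a)\<close> grows with the length of \<open>xs\<close>.)
\<close>

definition poly_cochains ::
  "('k::field, 'o, 'v::ab_group_add) gquiver \<Rightarrow> ('k, 'p, 'w::ab_group_add) gquiver \<Rightarrow>
   ('o \<Rightarrow> 'p) \<Rightarrow> int \<Rightarrow> (nat \<Rightarrow> ('o, 'v, 'w) cochain) set" where
  "poly_cochains A B \<Phi> d =
     {a. (\<forall>k. a k \<in> cochains A B \<Phi> d) \<and>
         (\<forall>xs\<in>obj_tuples A. \<exists>N. \<forall>k>N. \<forall>vs\<in>inputs A xs. a k xs vs = 0)}"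

definition peval ::
  "('k::field, 'p, 'w::ab_group_add) gquiver \<Rightarrow> (nat \<Rightarrow> ('o, 'v, 'w) cochain) \<Rightarrow> 'k \<Rightarrow>
   ('o, 'v, 'w) cochain" where
  "peval B a t xs vs = (\<Sum>k | a k xs vs \<noteq> 0. scl B (t ^ k) (a k xs vs))"

definition pderivative ::
  "('k::field, 'p, 'w::ab_group_add) gquiver \<Rightarrow> (nat \<Rightarrow> ('o, 'v, 'w) cochain) \<Rightarrow>
   (nat \<Rightarrow> ('o, 'v, 'w) cochain)" where
  "pderivative B a k xs vs = scl B (of_nat (Suc k)) (a (Suc k) xs vs)"

text \<open>The sum over all \<open>r \<ge> 1\<close> and all \<open>j\<close> of \<open>m(a, \<dots>, b, \<dots>, a)\<close> with \<open>b\<close>, of degree -1, in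
  position \<open>j\<close> (counted from 0), and \<open>a\<close> of degree 0 elsewhere.\<close>

definition insert_sum ::
  "('o \<Rightarrow> 'p) \<Rightarrow> ('p, 'w, 'u::ab_group_add) cochain \<Rightarrow> ('o, 'v, 'w) cochain \<Rightarrow>
   ('o, 'v, 'w) cochain \<Rightarrow> ('o, 'v, 'u) cochain" where
  "insert_sum \<Phi> m a b xs vs =
     (\<Sum>r = 1..length vs. \<Sum>j<r. brace \<Phi> m ((replicate r (0, a))[j := (-1, b)]) xs vs)"

definition ainf_homotopic ::
  "('k::field, 'o, 'v::ab_group_add) gquiver \<Rightarrow> ('o, 'v, 'v) cochain \<Rightarrow>
   ('k, 'p, 'w::ab_group_add) gquiver \<Rightarrow> ('p, 'w, 'w) cochain \<Rightarrow>
   ('o \<Rightarrow> 'p) \<Rightarrow> ('o, 'v, 'w) cochain \<Rightarrow> ('o, 'v, 'w) cochain \<Rightarrow> bool" where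
  "ainf_homotopic A mA B mB \<Phi> f g \<longleftrightarrow>
     ainf_morphism A mA B mB \<Phi> f \<and> ainf_morphism A mA B mB \<Phi> g \<and>
     (\<exists>a\<in>poly_cochains A B \<Phi> 0. \<exists>b\<in>poly_cochains A B \<Phi> (-1).
        cochain_eq A (peval B a 0) f \<and> cochain_eq A (peval B a 1) g \<and>
        (\<forall>t. ainf_morphism A mA B mB \<Phi> (peval B a t)) \<and>
        (\<forall>t. cochain_eq A (peval B (pderivative B a) t)
               (\<lambda>xs vs. insert_sum \<Phi> mB (peval B a t) (peval B b t) xs vs
                        + gcomp (peval B b t) 1 mA xs vs)))"

end

(*
  The composite h o a(t) is a polynomial path from h o f to h o g, and b'(t) is the sum of all
  h(a, ..., b, ..., a). Its boundary is computed in two ways from h o_G mB = mC(h, ..., h): in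
  (h o_G mB)(a, ..., b, ..., a) the operation mB either meets b or meets only copies of a, in which
  case it can be moved through the morphism a onto the inputs. The terms of the second kind occur
  with opposite signs in b' o_G mA, so that what remains is the sum of all h(a, ..., a', ..., a),
  the derivative of h o a(t).

  To have recursive definitions instead of index sums, a cochain is regarded as a function of words
  (lists of composable arrows), and h(f1, ..., fr) is evaluated by cutting pieces off the front of a word.
*)
theory Submission
  imports Defs
begin

section \<open>Words\<close>

text \<open>Two obstacles shape the proof. A cochain is multilinear only on composable inputs from
  the right morphism spaces, whereas the identities below move sums through the slots of an outer
  function. Only h and \<open>mC\<close> play that outer role; they are replaced by extensions that
  are multilinear on all words, while f, a, b, \<open>mA\<close> and \<open>mB\<close> stay as they
  are. The second obstacle is t: the coefficients of h o a, its values, its derivative and b' are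
  all sums over decompositions, differing only in how a total index is distributed over the factors.
  One operator \<open>pullback\<close> with index (k, e) covers them: e counts occurrences of b, and
  k is a power of t for coefficients and an order of derivation for values. The two readings of k
  are linked by the coefficient of \<epsilon>^s in (t + \<epsilon>)^k, whose multiplicativity
  contains the Leibniz rule. As a homotopy is a condition at each t separately, the signs are
  computed at fixed t, with a(t), b(t), a'(t) at the indices (0, 0), (0, 1), (1, 0).\<close>

datatype ('o, 'v) arrow = Arrow (src: 'o) (deg: int) (vec: 'v) (tgt: 'o)

definition wdeg :: "('o, 'v) arrow list \<Rightarrow> int" where
  "wdeg w = sum_list (map deg w)"

lemma wdeg_simps [simp]:
  "wdeg [] = 0" "wdeg (c # w) = deg c + wdeg w" "wdeg (p @ q) = wdeg p + wdeg q"
  by (auto simp: wdeg_def)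

definition splits0 :: "'x list \<Rightarrow> ('x list \<times> 'x list) set" where
  "splits0 w = {(p, q). p @ q = w}"

text \<open>Pieces are nonempty because a cochain takes at least one input. The variant
  \<open>splits0\<close> arises when an arrow already stands in front of the first piece.\<close>

definition splits :: "'x list \<Rightarrow> ('x list \<times> 'x list) set" where
  "splits w = {(p, q). p @ q = w \<and> p \<noteq> []}"

definition splits3 :: "'x list \<Rightarrow> ('x list \<times> 'x list \<times> 'x list) set" where
  "splits3 w = {(p, q, r). p @ q @ r = w \<and> q \<noteq> []}"

lemma splits0_image: "splits0 w = (\<lambda>n. (take n w, drop n w)) ` {..length w}"
proof -
  have "(p, q) \<in> (\<lambda>n. (take n w, drop n w)) ` {..length w}" if "p @ q = w" for p q
    using that by (intro image_eqI[of _ _ "length p"]) auto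
  then show ?thesis by (auto simp: splits0_def)
qed

lemma finite_splits0 [simp]: "finite (splits0 w)"
  by (simp add: splits0_image)

lemma splits_subset: "splits w \<subseteq> splits0 w"
  by (auto simp: splits_def splits0_def)

lemma finite_splits [simp]: "finite (splits w)"
  using finite_subset[OF splits_subset finite_splits0] .

lemma finite_splits3 [simp]: "finite (splits3 w)"
proof -
  have "splits3 w \<subseteq> (\<Union>(p, s)\<in>splits0 w. (\<lambda>(q, r). (p, q, r)) ` splits0 s)"
    by (force simp: splits3_def splits0_def)
  then show ?thesis by (rule finite_subset) auto
qed

lemma splits0_eq: "splits0 w = insert ([], w) (splits w)"
  by (auto simp: splits0_def splits_def)

lemma splits_Nil [simp]: "splits [] = {}" and splits0_Nil [simp]: "splits0 [] = {([], [])}"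
  by (auto simp: splits_def splits0_def)

lemma splits3_Nil [simp]: "splits3 [] = {}"
  by (auto simp: splits3_def)

lemma sum_splits0: "sum f (splits0 w) = f ([], w) + sum f (splits w)"
proof -
  have "([], w) \<notin> splits w" by (simp add: splits_def)
  then show ?thesis by (simp add: splits0_eq)
qed

lemma sum_splits_Cons:
  "(\<Sum>(p, q)\<in>splits (c # w). F p q) = (\<Sum>(p, q)\<in>splits0 w. F (c # p) q)"
  by (rule sum.reindex_bij_witness[of _ "\<lambda>(p, q). (c # p, q)" "\<lambda>(p, q). (tl p, q)"])
     (auto simp: splits_def splits0_def append_eq_Cons_conv)

lemma sum_splits3_Cons:
  "(\<Sum>(p, q, r)\<in>splits3 (c # w). F p q r) =
   (\<Sum>(q, r)\<in>splits (c # w). F [] q r) + (\<Sum>(p, q, r)\<in>splits3 w. F (c # p) q r)"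
proof -
  have *: "splits3 (c # w) = (\<lambda>(q, r). ([], q, r)) ` splits (c # w) \<union>
      (\<lambda>(p, q, r). (c # p, q, r)) ` splits3 w" (is "_ = ?A \<union> ?B")
  proof (intro equalityI subsetI)
    fix z assume "z \<in> splits3 (c # w)"
    then obtain p q r where z: "z = (p, q, r)" "p @ q @ r = c # w" "q \<noteq> []"
      by (auto simp: splits3_def)
    show "z \<in> ?A \<union> ?B"
    proof (cases p)
      case Nil then show ?thesis using z by (force simp: splits_def)
    next
      case (Cons d p') then show ?thesis using z by (force simp: splits3_def)
    qed
  qed (auto simp: splits3_def splits_def)
  have "(\<Sum>(p, q, r)\<in>splits3 (c # w). F p q r) =
    (\<Sum>(p, q, r)\<in>?A. F p q r) + (\<Sum>(p, q, r)\<in>?B. F p q r)"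
    unfolding * by (rule sum.union_disjoint) auto
  moreover have "(\<Sum>(p, q, r)\<in>?A. F p q r) = (\<Sum>(q, r)\<in>splits (c # w). F [] q r)"
    by (subst sum.reindex) (auto simp: inj_on_def case_prod_unfold)
  moreover have "(\<Sum>(p, q, r)\<in>?B. F p q r) = (\<Sum>(p, q, r)\<in>splits3 w. F (c # p) q r)"
    by (subst sum.reindex) (auto simp: inj_on_def case_prod_unfold)
  ultimately show ?thesis by simp
qed

text \<open>The distinguished arrow ends up either in the second piece or in the first. For an
  inserted value of m this separates the two ways in which an insertion and a cut interact.\<close>

lemma sum_splits_insert:
  "(\<Sum>(p, q)\<in>splits (w1 @ c # w2). F p q) =
   (\<Sum>(p, q)\<in>splits w1. F p (q @ c # w2)) + (\<Sum>(p, q)\<in>splits0 w2. F (w1 @ c # p) q)"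
proof (induction w1 arbitrary: F)
  case Nil
  then show ?case by (simp add: sum_splits_Cons)
next
  case (Cons d w1)
  show ?case
    by (simp add: sum_splits_Cons sum_splits0 Cons.IH add.assoc)
qed

text \<open>Both sides run over the cuts of \<open>w\<close> into three consecutive pieces of which
  only the first has to be nonempty.\<close>

lemma sum_splits_assoc:
  "(\<Sum>(p, q)\<in>splits w. \<Sum>(q1, q2)\<in>splits0 q. F p q1 q2) =
   (\<Sum>(s, q2)\<in>splits w. \<Sum>(p, q1)\<in>splits s. F p q1 q2)"
proof -
  have "(\<Sum>(p, q)\<in>splits w. \<Sum>(q1, q2)\<in>splits0 q. F p q1 q2) =
    (\<Sum>((p, q), q1, q2)\<in>(SIGMA z:splits w. splits0 (snd z)). F p q1 q2)"
    by (subst sum.Sigma [symmetric]) (auto simp: case_prod_unfold)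
  also have "\<dots> = (\<Sum>((s, q2), p, q1)\<in>(SIGMA z:splits w. splits (fst z)). F p q1 q2)"
    by (rule sum.reindex_bij_witness[of _
          "\<lambda>((s, q2), p, q1). ((p, q1 @ q2), q1, q2)" "\<lambda>((p, q), q1, q2). ((p @ q1, q2), p, q1)"])
       (auto simp: splits_def splits0_def)
  also have "\<dots> = (\<Sum>(s, q2)\<in>splits w. \<Sum>(p, q1)\<in>splits s. F p q1 q2)"
    by (subst sum.Sigma [symmetric]) (auto simp: case_prod_unfold)
  finally show ?thesis .
qed

section \<open>Koszul signs and additive functions\<close>

lemma ksign_0 [simp]: "ksign k (0::'v::ab_group_add) = 0"
  by (simp add: ksign_def)

lemma ksign_zero [simp]: "ksign 0 v = v"
  by (simp add: ksign_def)

lemma ksign_add: "ksign k (u + v) = ksign k u + ksign k (v::'v::ab_group_add)"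
  by (simp add: ksign_def)

lemma ksign_sum: "ksign k (sum f I) = (\<Sum>i\<in>I. ksign k (f i :: 'v::ab_group_add))"
  by (simp add: ksign_def sum_negf)

lemma ksign_ksign: "ksign k (ksign l v) = ksign (k + l) (v::'v::ab_group_add)"
  by (simp add: ksign_def)

lemma additive_sum:
  assumes "additive f" shows "f (sum g I) = (\<Sum>i\<in>I. f (g i))"
  using additive.sum[OF assms] by simp

lemma additive_ksign:
  assumes "additive f" shows "f (ksign k v) = ksign k (f v)"
  using assms by (simp add: ksign_def additive.minus)

lemma additive_ksign_self: "additive (ksign k :: 'v::ab_group_add \<Rightarrow> 'v)"
  by standard (rule ksign_add)

text \<open>Demanded on all words, composable or not, so that it survives recursion without side
  conditions; \<open>cochain_extension\<close> supplies such functions.\<close>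

definition wadditive :: "(('o, 'v::ab_group_add) arrow list \<Rightarrow> 'u::ab_group_add) \<Rightarrow> bool" where
  "wadditive \<phi> \<longleftrightarrow> (\<forall>p x i y r. additive (\<lambda>v. \<phi> (p @ Arrow x i v y # r)))"

lemma wadditive_head: "wadditive \<phi> \<Longrightarrow> additive (\<lambda>v. \<phi> (Arrow x i v y # r))"
  unfolding wadditive_def by (drule spec[of _ "[]"]) simp

lemma wadditive_Cons: "wadditive \<phi> \<Longrightarrow> wadditive (\<lambda>r. \<phi> (c # r))"
  unfolding wadditive_def
proof (intro allI)
  fix p x i y r
  assume "\<forall>p x i y r. additive (\<lambda>v. \<phi> (p @ Arrow x i v y # r))"
  from this[rule_format, of "c # p" x i y r]
  show "additive (\<lambda>v. \<phi> (c # p @ Arrow x i v y # r))" by simp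
qed

section \<open>Insertion and pullback\<close>

text \<open>Turns a value back into an arrow, so that the outputs on consecutive pieces form a word
  again. Degrees are those of the shifted spaces.\<close>

definition out :: "('o \<Rightarrow> 'p) \<Rightarrow> int \<Rightarrow> (('o, 'v) arrow list \<Rightarrow> 'w) \<Rightarrow> ('o, 'v) arrow list \<Rightarrow> ('p, 'w) arrow" where
  "out \<Phi> d f p = Arrow (\<Phi> (src (hd p))) (wdeg p + d) (f p) (\<Phi> (tgt (last p)))"

lemma out_sel [simp]:
  "src (out \<Phi> d f p) = \<Phi> (src (hd p))" "deg (out \<Phi> d f p) = wdeg p + d"
  "vec (out \<Phi> d f p) = f p" "tgt (out \<Phi> d f p) = \<Phi> (tgt (last p))"
  by (auto simp: out_def)

text \<open>For a cochain \<phi> this is composition by insertion of m, of degree 1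
  (\<open>wcochain_gcomp\<close>). It is an operator on arbitrary functions because it also has to
  act on \<phi> with some arguments already filled in.\<close>

definition ins :: "(('o, 'v) arrow list \<Rightarrow> 'v) \<Rightarrow> (('o, 'v) arrow list \<Rightarrow> 'u::ab_group_add) \<Rightarrow>
    ('o, 'v) arrow list \<Rightarrow> 'u" where
  "ins m \<phi> w = (\<Sum>(p, q, r)\<in>splits3 w. ksign (wdeg p) (\<phi> (p @ out id 1 m q # r)))"

lemma ins_Nil [simp]: "ins m \<phi> [] = 0"
  by (simp add: ins_def)

text \<open>Either m consumes the first arrow or it moves past that arrow, which costs the sign of
  \<open>deg c\<close>.\<close>

lemma ins_Cons:
  "ins m \<phi> (c # w) = (\<Sum>(p, q)\<in>splits (c # w). \<phi> (out id 1 m p # q)) +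
     ksign (deg c) (ins m (\<lambda>r. \<phi> (c # r)) w)"
  unfolding ins_def sum_splits3_Cons ksign_sum
  by (simp add: case_prod_unfold ksign_ksign)

text \<open>\<open>ins m\<close> is a coderivation with respect to cutting words.\<close>

lemma ins_splits:
  "ins m (\<lambda>w. \<Sum>(p, q)\<in>splits w. H p q) w =
   (\<Sum>(p, q)\<in>splits w. ins m (\<lambda>p. H p q) p + ksign (wdeg p) (ins m (H p) q))"
proof -
  have "ins m (\<lambda>w. \<Sum>(p, q)\<in>splits w. H p q) w =
     (\<Sum>(p, q, r)\<in>splits3 w. (\<Sum>(p1, p2)\<in>splits p. ksign (wdeg p) (H p1 (p2 @ out id 1 m q # r)))) +
     (\<Sum>(p, q, r)\<in>splits3 w. (\<Sum>(r1, r2)\<in>splits0 r. ksign (wdeg p) (H (p @ out id 1 m q # r1) r2)))"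
    unfolding ins_def sum_splits_insert
    by (simp add: ksign_add ksign_sum case_prod_unfold sum.distrib)
  \<comment> \<open>Here the cut lies in front of the inserted value: m acts within the second
    piece, after moving past the whole first piece.\<close>
  also have "(\<Sum>(p, q, r)\<in>splits3 w. (\<Sum>(p1, p2)\<in>splits p. ksign (wdeg p) (H p1 (p2 @ out id 1 m q # r)))) =
    (\<Sum>((p, q, r), p1, p2)\<in>(SIGMA z:splits3 w. splits (fst z)). ksign (wdeg p) (H p1 (p2 @ out id 1 m q # r)))"
    by (subst sum.Sigma [symmetric]) (auto simp: case_prod_unfold)
  also have "\<dots> = (\<Sum>((p1, s), p2, q, r)\<in>(SIGMA z:splits w. splits3 (snd z)).
      ksign (wdeg p1 + wdeg p2) (H p1 (p2 @ out id 1 m q # r)))"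
    by (rule sum.reindex_bij_witness[of _
          "\<lambda>((p1, s), p2, q, r). ((p1 @ p2, q, r), p1, p2)"
          "\<lambda>((p, q, r), p1, p2). ((p1, p2 @ q @ r), p2, q, r)"])
       (auto simp: splits_def splits3_def)
  also have "\<dots> = (\<Sum>(p, q)\<in>splits w. ksign (wdeg p) (ins m (H p) q))"
    unfolding ins_def
    by (subst sum.Sigma [symmetric]) (auto simp: case_prod_unfold ksign_sum ksign_ksign)
  also have "(\<Sum>(p, q, r)\<in>splits3 w. (\<Sum>(r1, r2)\<in>splits0 r. ksign (wdeg p) (H (p @ out id 1 m q # r1) r2))) =
    (\<Sum>((p, q, r), r1, r2)\<in>(SIGMA z:splits3 w. splits0 (snd (snd z))). ksign (wdeg p) (H (p @ out id 1 m q # r1) r2))"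
    by (subst sum.Sigma [symmetric]) (auto simp: case_prod_unfold)
  also have "\<dots> = (\<Sum>((s, r2), p, q, r1)\<in>(SIGMA z:splits w. splits3 (fst z)).
      ksign (wdeg p) (H (p @ out id 1 m q # r1) r2))"
    by (rule sum.reindex_bij_witness[of _
          "\<lambda>((s, r2), p, q, r1). ((p, q, r1 @ r2), r1, r2)"
          "\<lambda>((p, q, r), r1, r2). ((p @ q @ r1, r2), p, q, r1)"])
       (auto simp: splits_def splits0_def splits3_def)
  also have "\<dots> = (\<Sum>(p, q)\<in>splits w. ins m (\<lambda>p. H p q) p)"
    unfolding ins_def
    by (subst sum.Sigma [symmetric]) (auto simp: case_prod_unfold)
  finally show ?thesis by (simp add: case_prod_unfold sum.distrib add.commute)
qed

lemma ins_cong: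
  assumes "\<And>p q r. w = p @ q @ r \<Longrightarrow> q \<noteq> [] \<Longrightarrow> \<phi> (p @ out id 1 m q # r) = \<psi> (p @ out id 1 m' q # r)"
  shows "ins m \<phi> w = ins m' \<psi> w"
  unfolding ins_def by (rule sum.cong) (auto simp: splits3_def assms)

lemma ins_sum: "ins m (\<lambda>w. \<Sum>i\<in>I. \<phi> i w) w = (\<Sum>i\<in>I. ins m (\<phi> i) w)"
  unfolding ins_def by (simp add: ksign_sum case_prod_unfold) (rule sum.swap)

lemma ins_ksign: "ins m (\<lambda>w. ksign k (\<phi> w)) w = ksign k (ins m \<phi> w)"
  unfolding ins_def by (simp add: ksign_sum case_prod_unfold ksign_ksign add.commute)

text \<open>\<open>pullback \<Phi> c k e \<phi> w\<close> sums \<open>\<phi> (c\<^sub>1 \<otimes> \<dots> \<otimes> c\<^sub>r)\<close> over all decompositions of \<open>w\<close> and all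
  choices of members \<open>c i j\<close> of the family with total index \<open>(k, e)\<close>, where \<open>c i j\<close> has degree
  \<open>-j\<close>. The first index is the power of \<open>t\<close> or the order of derivation, the second one
  counts the occurrences of the homotopy.\<close>

function pullback :: "('o \<Rightarrow> 'p) \<Rightarrow> (nat \<Rightarrow> nat \<Rightarrow> ('o, 'v) arrow list \<Rightarrow> 'w) \<Rightarrow> nat \<Rightarrow> nat \<Rightarrow>
    (('p, 'w) arrow list \<Rightarrow> 'u::ab_group_add) \<Rightarrow> ('o, 'v) arrow list \<Rightarrow> 'u" where
  "pullback \<Phi> c k e \<phi> w =
    (if w = [] then (if k = 0 \<and> e = 0 then \<phi> [] else 0)
     else \<Sum>n\<in>{0<..length w}. \<Sum>i\<le>k. \<Sum>j\<le>e.
       ksign (int (e - j) * wdeg (take n w))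
         (pullback \<Phi> c (k - i) (e - j) (\<lambda>r. \<phi> (out \<Phi> (- int j) (c i j) (take n w) # r)) (drop n w)))"
  by auto
termination
  by (relation "measure (\<lambda>(\<Phi>, c, k, e, \<phi>, w). length w)") auto

declare pullback.simps [simp del]

lemma pullback_Nil: "pullback \<Phi> c k e \<phi> [] = (if k = 0 \<and> e = 0 then \<phi> [] else 0)"
  by (simp add: pullback.simps)

text \<open>The form in which the recursion is used; the definition counts the letters of the first
  piece to make termination visible. The sign records that the \<open>e - j\<close> homotopies in
  the later pieces, of degree -1 each, move past \<open>p\<close>.\<close>

lemma pullback_splits:
  assumes "w \<noteq> []"
  shows "pullback \<Phi> c k e \<phi> w = (\<Sum>(p, q)\<in>splits w. \<Sum>i\<le>k. \<Sum>j\<le>e.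
       ksign (int (e - j) * wdeg p)
         (pullback \<Phi> c (k - i) (e - j) (\<lambda>r. \<phi> (out \<Phi> (- int j) (c i j) p # r)) q))"
proof -
  have "(p, q) \<in> (\<lambda>n. (take n w, drop n w)) ` {0<..length w}" if "p @ q = w" "p \<noteq> []" for p q
    using that by (intro image_eqI[of _ _ "length p"]) auto
  then have "splits w = (\<lambda>n. (take n w, drop n w)) ` {0<..length w}"
    by (auto simp: splits_def)
  moreover have "inj_on (\<lambda>n. (take n w, drop n w)) {0<..length w}"
    by (rule inj_onI) (metis (no_types, lifting) Pair_inject greaterThanAtMost_iff length_take min.absorb2)
  ultimately show ?thesis
    using assms by (subst pullback.simps) (simp add: sum.reindex)
qed

text \<open>The words on which \<phi> is evaluated in \<open>pullback\<close>. Outputs of genuine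
  cochains on genuine words are genuine words, which allows passing from h to a multilinear
  extension and back.\<close>

inductive outputs :: "('o \<Rightarrow> 'p) \<Rightarrow> (nat \<Rightarrow> nat \<Rightarrow> ('o, 'v) arrow list \<Rightarrow> 'w) \<Rightarrow> nat \<Rightarrow> nat \<Rightarrow>
    ('o, 'v) arrow list \<Rightarrow> ('p, 'w) arrow list \<Rightarrow> bool"
  for \<Phi> c where
  outputs_Nil: "outputs \<Phi> c 0 0 [] []"
| outputs_Cons: "p \<noteq> [] \<Longrightarrow> i \<le> k \<Longrightarrow> j \<le> e \<Longrightarrow> outputs \<Phi> c (k - i) (e - j) q r \<Longrightarrow>
     outputs \<Phi> c k e (p @ q) (out \<Phi> (- int j) (c i j) p # r)"

lemma pullback_cong:
  assumes "\<And>r. outputs \<Phi> c k e w r \<Longrightarrow> \<phi> r = \<psi> r"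
  shows "pullback \<Phi> c k e \<phi> w = pullback \<Phi> c k e \<psi> w"
  using assms
proof (induction w arbitrary: k e \<phi> \<psi> rule: length_induct)
  case (1 w)
  show ?case
  proof (cases "w = []")
    case True
    then show ?thesis using 1(2)[of "[]"] by (auto simp: pullback_Nil outputs_Nil)
  next
    case False
    have "pullback \<Phi> c (k - i) (e - j) (\<lambda>r. \<phi> (out \<Phi> (- int j) (c i j) p # r)) q =
          pullback \<Phi> c (k - i) (e - j) (\<lambda>r. \<psi> (out \<Phi> (- int j) (c i j) p # r)) q"
      if "w = p @ q" "p \<noteq> []" "i \<le> k" "j \<le> e" for p q i j
      using that by (intro 1(1)[rule_format] 1(2)) (auto intro: outputs_Cons)
    then show ?thesis using False
      by (auto simp: pullback_splits splits_def intro!: sum.cong)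
  qed
qed

lemma pullback_family_cong:
  fixes \<phi> :: "('p, 'w) arrow list \<Rightarrow> 'u::ab_group_add"
  assumes "\<And>p q r i j. w = p @ q @ r \<Longrightarrow> q \<noteq> [] \<Longrightarrow> i \<le> k \<Longrightarrow> j \<le> e \<Longrightarrow> c i j q = c' i j q"
  shows "pullback \<Phi> c k e \<phi> w = pullback \<Phi> c' k e \<phi> w"
  using assms
proof (induction w arbitrary: k e \<phi> rule: length_induct)
  case (1 w)
  show ?case
  proof (cases "w = []")
    case False
    have "pullback \<Phi> c (k - i) (e - j) (\<lambda>r. \<phi> (out \<Phi> (- int j) (c i j) p # r)) q =
          pullback \<Phi> c' (k - i) (e - j) (\<lambda>r. \<phi> (out \<Phi> (- int j) (c' i j) p # r)) q"
      if "w = p @ q" "p \<noteq> []" "i \<le> k" "j \<le> e" for p q i j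
    proof -
      have "c i j p = c' i j p" using 1(2)[of "[]" p q] that by simp
      then have "out \<Phi> (- int j) (c i j) p = out \<Phi> (- int j) (c' i j) p" by (simp add: out_def)
      moreover have "pullback \<Phi> c (k - i) (e - j) \<psi> q = pullback \<Phi> c' (k - i) (e - j) \<psi> q"
        for \<psi> :: "('p, 'w) arrow list \<Rightarrow> 'u"
        using that 1(2) by (intro 1(1)[rule_format]) (auto simp flip: append_assoc)
      ultimately show ?thesis by simp
    qed
    then show ?thesis using False
      by (auto simp: pullback_splits splits_def intro!: sum.cong)
  qed (simp add: pullback_Nil)
qed

section \<open>Additivity of the pullback in its outer function\<close>

lemma pullback_add:
  "pullback \<Phi> c k e (\<lambda>r. \<phi> r + \<psi> r) w = pullback \<Phi> c k e \<phi> w + pullback \<Phi> c k e \<psi> w"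
proof (induction w arbitrary: k e \<phi> \<psi> rule: length_induct)
  case (1 w)
  show ?case
  proof (cases "w = []")
    case False
    have "pullback \<Phi> c (k - i) (e - j) (\<lambda>r. \<phi> (out \<Phi> (- int j) (c i j) p # r) + \<psi> (out \<Phi> (- int j) (c i j) p # r)) q =
          pullback \<Phi> c (k - i) (e - j) (\<lambda>r. \<phi> (out \<Phi> (- int j) (c i j) p # r)) q +
          pullback \<Phi> c (k - i) (e - j) (\<lambda>r. \<psi> (out \<Phi> (- int j) (c i j) p # r)) q"
      if "(p, q) \<in> splits w" for p q i j
      using that by (intro 1(1)[rule_format]) (auto simp: splits_def)
    then show ?thesis using False
      by (simp add: pullback_splits ksign_add sum.distrib case_prod_unfold)
  qed (simp add: pullback_Nil)
qed

lemma pullback_additive: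
  assumes "additive g"
  shows "pullback \<Phi> c k e (\<lambda>r. g (\<phi> r)) w = g (pullback \<Phi> c k e \<phi> w)"
proof (induction w arbitrary: k e \<phi> rule: length_induct)
  case (1 w)
  show ?case
  proof (cases "w = []")
    case False
    have "pullback \<Phi> c (k - i) (e - j) (\<lambda>r. g (\<phi> (out \<Phi> (- int j) (c i j) p # r))) q =
          g (pullback \<Phi> c (k - i) (e - j) (\<lambda>r. \<phi> (out \<Phi> (- int j) (c i j) p # r)) q)"
      if "(p, q) \<in> splits w" for p q i j
      using that by (intro 1(1)[rule_format]) (auto simp: splits_def)
    then show ?thesis using False
      by (simp add: pullback_splits additive_ksign[OF assms] additive_sum[OF assms] case_prod_unfold)
  qed (simp add: pullback_Nil additive.zero[OF assms])
qed

lemma pullback_ksign: "pullback \<Phi> c k e (\<lambda>r. ksign l (\<phi> r)) w = ksign l (pullback \<Phi> c k e \<phi> w)"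
  by (rule pullback_additive[OF additive_ksign_self])

lemma pullback_zero: "pullback \<Phi> c k e (\<lambda>r. 0) w = 0"
  using pullback_add[of \<Phi> c k e "\<lambda>r. 0" "\<lambda>r. 0" w] by simp

lemma pullback_sum:
  "finite I \<Longrightarrow> pullback \<Phi> c k e (\<lambda>r. \<Sum>i\<in>I. \<phi> i r) w = (\<Sum>i\<in>I. pullback \<Phi> c k e (\<phi> i) w)"
  by (induction I rule: finite_induct) (simp_all add: pullback_zero pullback_add)

lemma additive_pullback:
  assumes "\<And>r. additive (\<lambda>v. \<phi> v r)"
  shows "additive (\<lambda>v. pullback \<Phi> c k e (\<phi> v) w)"
proof
  fix x y
  have "\<phi> (x + y) = (\<lambda>r. \<phi> x r + \<phi> y r)" by (simp add: fun_eq_iff additive.add[OF assms])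
  then show "pullback \<Phi> c k e (\<phi> (x + y)) w = pullback \<Phi> c k e (\<phi> x) w + pullback \<Phi> c k e (\<phi> y) w"
    by (simp add: pullback_add)
qed

lemma outputs_ends:
  assumes "outputs \<Phi> c k e w r"
  shows "(r = [] \<longleftrightarrow> w = []) \<and> wdeg r = wdeg w - int e \<and>
    (w \<noteq> [] \<longrightarrow> src (hd r) = \<Phi> (src (hd w)) \<and> tgt (last r) = \<Phi> (tgt (last w)))"
  using assms by induction (auto simp: of_nat_diff)

text \<open>All output words of \<open>w\<close> have the same end objects and the degree
  \<open>wdeg w - int e\<close>. The arrows \<open>out \<Psi> d m r\<close> therefore differ only in
  their vector, and the sum moves into the slot by additivity.\<close>

lemma pullback_out:
  assumes "\<And>x i y. additive (\<lambda>v. \<psi> (Arrow x i v y))" and "w \<noteq> []"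
  shows "pullback \<Phi> c k e (\<lambda>r. \<psi> (out \<Psi> d m r)) w = \<psi> (out (\<Psi> \<circ> \<Phi>) (d - int e) (pullback \<Phi> c k e m) w)"
proof -
  have "pullback \<Phi> c k e (\<lambda>r. \<psi> (out \<Psi> d m r)) w = pullback \<Phi> c k e (\<lambda>r.
      \<psi> (Arrow (\<Psi> (\<Phi> (src (hd w)))) (wdeg w + (d - int e)) (m r) (\<Psi> (\<Phi> (tgt (last w)))))) w"
  proof (rule pullback_cong)
    fix r assume "outputs \<Phi> c k e w r"
    from outputs_ends[OF this] assms(2)
    have "out \<Psi> d m r = Arrow (\<Psi> (\<Phi> (src (hd w)))) (wdeg w + (d - int e)) (m r) (\<Psi> (\<Phi> (tgt (last w))))"
      by (simp add: out_def)
    then show "\<psi> (out \<Psi> d m r) = \<psi> (Arrow (\<Psi> (\<Phi> (src (hd w)))) (wdeg w + (d - int e)) (m r) (\<Psi> (\<Phi> (tgt (last w)))))"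
      by simp
  qed
  also have "\<dots> = \<psi> (out (\<Psi> \<circ> \<Phi>) (d - int e) (pullback \<Phi> c k e m) w)"
    by (subst pullback_additive[OF assms(1)]) (simp add: out_def)
  finally show ?thesis .
qed

section \<open>The pullback as a morphism of coalgebras: cutting and insertion\<close>

lemma sum_antidiagonal:
  fixes f :: "nat \<Rightarrow> nat \<Rightarrow> 'u::comm_monoid_add"
  shows "(\<Sum>n\<le>e. \<Sum>j\<le>n. f j (n - j)) = (\<Sum>j\<le>e. \<Sum>i\<le>e - j. f j i)"
  by (simp add: sum.Sigma)
     (rule sum.reindex_bij_witness[of _ "\<lambda>(j, i). (i + j, j)" "\<lambda>(n, j). (j, n - j)"], auto)

lemma sum_splits0_Cons:
  "(\<Sum>(p, q)\<in>splits0 (c # w). F p q) = F [] (c # w) + (\<Sum>(p, q)\<in>splits0 w. F (c # p) q)"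
  by (simp add: sum_splits0 sum_splits_Cons)

lemma pullback_splits_0:
  assumes "w \<noteq> []"
  shows "pullback \<Phi> c 0 e \<phi> w = (\<Sum>(p, q)\<in>splits w. \<Sum>j\<le>e.
       ksign (int (e - j) * wdeg p)
         (pullback \<Phi> c 0 (e - j) (\<lambda>r. \<phi> (out \<Phi> (- int j) (c 0 j) p # r)) q))"
  using assms by (simp add: pullback_splits)

text \<open>A cut between two outputs comes from a cut of the input word. The e homotopies split
  into j on the left and \<open>e - j\<close> on the right, and the latter move past
  \<open>p\<close>.\<close>

lemma pullback_sum_splits0:
  "pullback \<Phi> c 0 e (\<lambda>r. \<Sum>(r1, r2)\<in>splits0 r. G r1 r2) w =
   (\<Sum>(p, q)\<in>splits0 w. \<Sum>j\<le>e. ksign (int (e - j) * wdeg p)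
      (pullback \<Phi> c 0 j (\<lambda>r1. pullback \<Phi> c 0 (e - j) (G r1) q) p))"
proof (induction w arbitrary: e G rule: length_induct)
  case (1 w)
  \<comment> \<open>The cut with an empty left part: only \<open>j = 0\<close> contributes, because
    the empty word leaves no room for a homotopy.\<close>
  have head: "(\<Sum>j\<le>e. ksign (int (e - j) * 0)
      (pullback \<Phi> c 0 j (\<lambda>r1. pullback \<Phi> c 0 (e - j) (G r1) q) [])) = pullback \<Phi> c 0 e (G []) q" for q
    by (simp add: pullback_Nil if_distrib[of "ksign _"] cong: if_cong)
  show ?case
  proof (cases "w = []")
    case True
    then show ?thesis using head[of "[]"] by (simp add: pullback_Nil)
  next
    case False
    define o' where "o' = (\<lambda>j p. out \<Phi> (- int j) (c 0 j) p)"
    define X where "X = (\<lambda>p q1 q2 j i. pullback \<Phi> c 0 i (\<lambda>r1. pullback \<Phi> c 0 (e - j - i) (G (o' j p # r1)) q2) q1)"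
    have IH: "pullback \<Phi> c 0 (e - j) (\<lambda>r. \<Sum>(r1, r2)\<in>splits0 r. G (o' j p # r1) r2) q =
      (\<Sum>(q1, q2)\<in>splits0 q. \<Sum>i\<le>e - j. ksign (int (e - j - i) * wdeg q1) (X p q1 q2 j i))"
      if "(p, q) \<in> splits w" for p q j
    proof -
      have "length q < length w" using that by (auto simp: splits_def)
      from 1[rule_format, OF this, of "e - j" "\<lambda>r1. G (o' j p # r1)"]
      show ?thesis unfolding X_def .
    qed
    \<comment> \<open>The cut lies in front of all outputs, or behind the first output
      \<open>o' j p\<close>; in the second case it is a cut of the remaining outputs.\<close>
    have "pullback \<Phi> c 0 e (\<lambda>r. \<Sum>(r1, r2)\<in>splits0 r. G r1 r2) w =
       pullback \<Phi> c 0 e (\<lambda>r. G [] r) w +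
       (\<Sum>(p, q)\<in>splits w. \<Sum>j\<le>e. ksign (int (e - j) * wdeg p)
         (pullback \<Phi> c 0 (e - j) (\<lambda>r. \<Sum>(r1, r2)\<in>splits0 r. G (o' j p # r1) r2) q))"
      unfolding o'_def pullback_splits_0[OF False] sum_splits0_Cons pullback_add ksign_add
      by (simp add: sum.distrib case_prod_unfold)
    also have "(\<Sum>(p, q)\<in>splits w. \<Sum>j\<le>e. ksign (int (e - j) * wdeg p)
         (pullback \<Phi> c 0 (e - j) (\<lambda>r. \<Sum>(r1, r2)\<in>splits0 r. G (o' j p # r1) r2) q)) =
       (\<Sum>(p, q)\<in>splits w. \<Sum>j\<le>e. \<Sum>(q1, q2)\<in>splits0 q. \<Sum>i\<le>e - j.
          ksign (int (e - j) * wdeg p + int (e - j - i) * wdeg q1) (X p q1 q2 j i))"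
    proof (intro sum.cong refl, clarify, intro sum.cong refl)
      fix p q j assume "(p, q) \<in> splits w"
      from IH[OF this] show "ksign (int (e - j) * wdeg p)
         (pullback \<Phi> c 0 (e - j) (\<lambda>r. \<Sum>(r1, r2)\<in>splits0 r. G (o' j p # r1) r2) q) =
        (\<Sum>(q1, q2)\<in>splits0 q. \<Sum>i\<le>e - j.
          ksign (int (e - j) * wdeg p + int (e - j - i) * wdeg q1) (X p q1 q2 j i))"
        by (simp only: ksign_sum ksign_ksign case_prod_unfold)
    qed
    also have "\<dots> = (\<Sum>(p, q)\<in>splits w. \<Sum>(q1, q2)\<in>splits0 q. \<Sum>j\<le>e. \<Sum>i\<le>e - j.
          ksign (int (e - j) * wdeg p + int (e - j - i) * wdeg q1) (X p q1 q2 j i))"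
      by (intro sum.cong refl) (auto simp: case_prod_unfold intro: sum.swap)
    also have "\<dots> = (\<Sum>(s, q2)\<in>splits w. \<Sum>(p, q1)\<in>splits s. \<Sum>j\<le>e. \<Sum>i\<le>e - j.
          ksign (int (e - j) * wdeg p + int (e - j - i) * wdeg q1) (X p q1 q2 j i))"
      by (rule sum_splits_assoc)
    also have "\<dots> = (\<Sum>(s, q2)\<in>splits w. \<Sum>(p, q1)\<in>splits s. \<Sum>n\<le>e. \<Sum>j\<le>n.
          ksign (int (e - j) * wdeg p + int (e - j - (n - j)) * wdeg q1) (X p q1 q2 j (n - j)))"
    proof (rule sum.cong[OF refl], clarify, rule sum.cong[OF refl], clarify)
      fix s q2 p q1
      show "(\<Sum>j\<le>e. \<Sum>i\<le>e - j. ksign (int (e - j) * wdeg p + int (e - j - i) * wdeg q1) (X p q1 q2 j i)) =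
        (\<Sum>n\<le>e. \<Sum>j\<le>n. ksign (int (e - j) * wdeg p + int (e - j - (n - j)) * wdeg q1) (X p q1 q2 j (n - j)))"
        by (rule sum_antidiagonal[symmetric])
    qed
    also have "\<dots> = (\<Sum>(s, q2)\<in>splits w. \<Sum>n\<le>e. \<Sum>(p, q1)\<in>splits s. \<Sum>j\<le>n.
          ksign (int (e - j) * wdeg p + int (e - j - (n - j)) * wdeg q1) (X p q1 q2 j (n - j)))"
      by (intro sum.cong refl) (auto simp: case_prod_unfold intro: sum.swap)
    also have "\<dots> = (\<Sum>(s, q2)\<in>splits w. \<Sum>n\<le>e. ksign (int (e - n) * wdeg s)
        (pullback \<Phi> c 0 n (\<lambda>r1. pullback \<Phi> c 0 (e - n) (G r1) q2) s))"
    proof (intro sum.cong refl, clarify, intro sum.cong refl)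
      fix s q2 n assume s: "(s, q2) \<in> splits w" and n: "n \<in> {..e}"
      then have "s \<noteq> []" by (simp add: splits_def)
      show "(\<Sum>(p, q1)\<in>splits s. \<Sum>j\<le>n.
          ksign (int (e - j) * wdeg p + int (e - j - (n - j)) * wdeg q1) (X p q1 q2 j (n - j))) =
        ksign (int (e - n) * wdeg s) (pullback \<Phi> c 0 n (\<lambda>r1. pullback \<Phi> c 0 (e - n) (G r1) q2) s)"
        unfolding pullback_splits_0[OF \<open>s \<noteq> []\<close>] ksign_sum X_def o'_def
      proof (intro sum.cong refl, clarify, unfold ksign_sum, intro sum.cong refl)
        fix p q1 j assume "(p, q1) \<in> splits s" and j: "j \<in> {..n}"
        then have "wdeg s = wdeg p + wdeg q1" by (auto simp: splits_def)
        moreover have "e - j - (n - j) = e - n" using j n by auto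
        \<comment> \<open>Of the \<open>e - j\<close> homotopies behind \<open>p\<close>,
          \<open>n - j\<close> lie in \<open>q1\<close> and move past \<open>p\<close> only, while
          the other \<open>e - n\<close> move past all of \<open>s\<close>.\<close>
        moreover have "int (e - j) * wdeg p + int (e - n) * wdeg q1 =
            int (e - n) * (wdeg p + wdeg q1) + int (n - j) * wdeg p"
          using j n by (simp add: of_nat_diff algebra_simps)
        ultimately show "ksign (int (e - j) * wdeg p + int (e - j - (n - j)) * wdeg q1)
            (pullback \<Phi> c 0 (n - j) (\<lambda>r1. pullback \<Phi> c 0 (e - j - (n - j)) (G (out \<Phi> (- int j) (c 0 j) p # r1)) q2) q1) =
          ksign (int (e - n) * wdeg s) (ksign (int (n - j) * wdeg p)
            (pullback \<Phi> c 0 (n - j) (\<lambda>r. pullback \<Phi> c 0 (e - n) (G (out \<Phi> (- int j) (c 0 j) p # r)) q2) q1))"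
          by (simp add: ksign_ksign)
      qed
    qed
    finally show ?thesis by (simp only: sum_splits0 prod.case head wdeg_simps(1))
  qed
qed

lemma pullback_sum_splits:
  "pullback \<Phi> c 0 e (\<lambda>r. \<Sum>(r1, r2)\<in>splits r. G r1 r2) w =
   (\<Sum>(p, q)\<in>splits w. \<Sum>j\<le>e. ksign (int (e - j) * wdeg p)
      (pullback \<Phi> c 0 j (\<lambda>r1. pullback \<Phi> c 0 (e - j) (G r1) q) p))"
proof -
  have "pullback \<Phi> c 0 e (G []) w + pullback \<Phi> c 0 e (\<lambda>r. \<Sum>(r1, r2)\<in>splits r. G r1 r2) w =
    pullback \<Phi> c 0 e (\<lambda>r. \<Sum>(r1, r2)\<in>splits0 r. G r1 r2) w"
    by (simp add: sum_splits0 pullback_add)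
  also have "\<dots> = pullback \<Phi> c 0 e (G []) w + (\<Sum>(p, q)\<in>splits w. \<Sum>j\<le>e. ksign (int (e - j) * wdeg p)
      (pullback \<Phi> c 0 j (\<lambda>r1. pullback \<Phi> c 0 (e - j) (G r1) q) p))"
    by (subst pullback_sum_splits0)
       (simp add: sum_splits0 pullback_Nil if_distrib[of "ksign _"] del: of_nat_diff cong: if_cong)
  finally show ?thesis by simp
qed

text \<open>Either m consumes a nonempty block of initial outputs, which collapses by
  \<open>pullback_out\<close> into one output of degree \<open>1 - int j\<close> on the
  corresponding part of \<open>w\<close>, or it moves past the first output, whose degree is
  \<open>wdeg p - int j\<close>.\<close>

lemma pullback_ins:
  assumes "w \<noteq> []" and \<phi>: "wadditive \<phi>"
  shows "pullback \<Phi> c 0 e (ins m \<phi>) w =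
    (\<Sum>(p, q)\<in>splits w. \<Sum>j\<le>e. ksign (int (e - j) * wdeg p)
       (pullback \<Phi> c 0 (e - j) (\<lambda>r. \<phi> (out \<Phi> (1 - int j) (pullback \<Phi> c 0 j m) p # r)) q +
        ksign (wdeg p - int j)
          (pullback \<Phi> c 0 (e - j) (ins m (\<lambda>r. \<phi> (out \<Phi> (- int j) (c 0 j) p # r))) q)))"
proof -
  \<comment> \<open>The part of \<open>ins m \<phi>\<close> in which m skips the first arrow; on the
    empty word there is nothing to insert into, hence the value 0.\<close>
  define tl' where "tl' = (\<lambda>r. case r of [] \<Rightarrow> 0 | a # r' \<Rightarrow> ksign (deg a) (ins m (\<lambda>s. \<phi> (a # s)) r'))"
  have "ins m \<phi> = (\<lambda>r. (\<Sum>(r1, r2)\<in>splits r. \<phi> (out id 1 m r1 # r2)) + tl' r)"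
  proof
    fix r show "ins m \<phi> r = (\<Sum>(r1, r2)\<in>splits r. \<phi> (out id 1 m r1 # r2)) + tl' r"
      by (cases r) (auto simp: ins_Cons tl'_def)
  qed
  then have "pullback \<Phi> c 0 e (ins m \<phi>) w =
      pullback \<Phi> c 0 e (\<lambda>r. \<Sum>(r1, r2)\<in>splits r. \<phi> (out id 1 m r1 # r2)) w + pullback \<Phi> c 0 e tl' w"
    by (simp add: pullback_add)
  also have "pullback \<Phi> c 0 e (\<lambda>r. \<Sum>(r1, r2)\<in>splits r. \<phi> (out id 1 m r1 # r2)) w =
     (\<Sum>(p, q)\<in>splits w. \<Sum>j\<le>e. ksign (int (e - j) * wdeg p)
       (pullback \<Phi> c 0 (e - j) (\<lambda>r. \<phi> (out \<Phi> (1 - int j) (pullback \<Phi> c 0 j m) p # r)) q))"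
    unfolding pullback_sum_splits
  proof (intro sum.cong refl, clarify, intro sum.cong refl)
    fix p q j assume "(p, q) \<in> splits w"
    then have "p \<noteq> []" by (simp add: splits_def)
    have "additive (\<lambda>v. pullback \<Phi> c 0 (e - j) (\<lambda>r. \<phi> (Arrow x i v y # r)) q)" for x i y
      by (intro additive_pullback wadditive_head \<phi>)
    from pullback_out[OF this \<open>p \<noteq> []\<close>, where \<Psi> = id and d = 1 and m = m and c = c and k = 0 and e = j and \<Phi> = \<Phi>]
    show "ksign (int (e - j) * wdeg p) (pullback \<Phi> c 0 j (\<lambda>r1. pullback \<Phi> c 0 (e - j)
          (\<lambda>r. \<phi> (out id 1 m r1 # r)) q) p) = ksign (int (e - j) * wdeg p)
       (pullback \<Phi> c 0 (e - j) (\<lambda>r. \<phi> (out \<Phi> (1 - int j) (pullback \<Phi> c 0 j m) p # r)) q)"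
      by simp
  qed
  also have "pullback \<Phi> c 0 e tl' w = (\<Sum>(p, q)\<in>splits w. \<Sum>j\<le>e. ksign (int (e - j) * wdeg p)
      (ksign (wdeg p - int j)
          (pullback \<Phi> c 0 (e - j) (ins m (\<lambda>r. \<phi> (out \<Phi> (- int j) (c 0 j) p # r))) q)))"
    using assms(1) by (simp add: pullback_splits_0 tl'_def pullback_ksign)
  finally show ?thesis by (simp add: ksign_add sum.distrib case_prod_unfold)
qed

text \<open>An insertion keeps the end objects and raises the degree by one. Sign and labels are
  thus the same for all insertions, and the sum moves into the slot.\<close>

lemma ins_out:
  assumes "\<And>x i y. additive (\<lambda>v. \<psi> (Arrow x i v y))" and "w \<noteq> []"
  shows "ins m (\<lambda>p. ksign (l * wdeg p) (\<psi> (out \<Phi> d f p))) w =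
    ksign (l * (wdeg w + 1)) (\<psi> (out \<Phi> (d + 1) (ins m f) w))"
proof -
  define A where "A = (\<lambda>v. ksign (l * (wdeg w + 1))
    (\<psi> (Arrow (\<Phi> (src (hd w))) (wdeg w + (d + 1)) v (\<Phi> (tgt (last w))))))"
  have A: "additive A"
    unfolding A_def by standard (simp add: additive.add[OF assms(1)] ksign_add)
  have "ksign (l * wdeg s) (\<psi> (out \<Phi> d f s)) = A (f s)"
    if "w = p @ q @ r" "q \<noteq> []" "s = p @ out id 1 m q # r" for p q r s
  proof -
    have "wdeg s = wdeg w + 1" using that by simp
    moreover have "src (hd s) = src (hd w)" using that by (cases p) auto
    moreover have "tgt (last s) = tgt (last w)" using that by (cases r) auto
    ultimately show ?thesis by (simp add: A_def out_def algebra_simps)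
  qed
  then have "ins m (\<lambda>p. ksign (l * wdeg p) (\<psi> (out \<Phi> d f p))) w = ins m (\<lambda>p. A (f p)) w"
    by (intro ins_cong) auto
  also have "\<dots> = A (ins m f w)"
    unfolding ins_def additive_sum[OF A] by (simp add: additive_ksign[OF A] case_prod_unfold)
  finally show ?thesis by (simp add: A_def out_def)
qed

text \<open>Companion of \<open>pullback_ins\<close> with m acting on the inputs: by the
  coderivation property it acts within the first piece or behind it. In the first case the later
  homotopies move past a piece of degree \<open>wdeg p + 1\<close>; this shift produces the
  cancellations for \<open>e = 1\<close>.\<close>

lemma ins_pullback:
  assumes \<phi>: "wadditive \<phi>"
  shows "ins m (pullback \<Phi> c 0 e \<phi>) w =
    (\<Sum>(p, q)\<in>splits w. \<Sum>j\<le>e.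
       ksign (int (e - j) * (wdeg p + 1))
         (pullback \<Phi> c 0 (e - j) (\<lambda>r. \<phi> (out \<Phi> (1 - int j) (ins m (c 0 j)) p # r)) q) +
       ksign (int (e - j) * wdeg p + wdeg p)
          (ins m (pullback \<Phi> c 0 (e - j) (\<lambda>r. \<phi> (out \<Phi> (- int j) (c 0 j) p # r))) q))"
proof -
  define \<psi> where "\<psi> = (\<lambda>j q a. pullback \<Phi> c 0 (e - j) (\<lambda>r. \<phi> (a # r)) q)"
  define H where "H = (\<lambda>p q. \<Sum>j\<le>e. ksign (int (e - j) * wdeg p) (\<psi> j q (out \<Phi> (- int j) (c 0 j) p)))"
  have \<psi>: "additive (\<lambda>v. \<psi> j q (Arrow x i v y))" for j q x i y
    unfolding \<psi>_def by (intro additive_pullback wadditive_head \<phi>)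
  have "ins m (pullback \<Phi> c 0 e \<phi>) w = ins m (\<lambda>w. \<Sum>(p, q)\<in>splits w. H p q) w"
    by (rule ins_cong) (simp add: H_def \<psi>_def pullback_splits_0)
  also have "\<dots> = (\<Sum>(p, q)\<in>splits w. ins m (\<lambda>p. H p q) p + ksign (wdeg p) (ins m (H p) q))"
    by (rule ins_splits)
  also have "\<dots> = (\<Sum>(p, q)\<in>splits w. \<Sum>j\<le>e.
       ksign (int (e - j) * (wdeg p + 1)) (\<psi> j q (out \<Phi> (1 - int j) (ins m (c 0 j)) p)) +
       ksign (int (e - j) * wdeg p + wdeg p) (ins m (\<lambda>q. \<psi> j q (out \<Phi> (- int j) (c 0 j) p)) q))"
  proof (intro sum.cong refl, clarify)
    fix p q assume "(p, q) \<in> splits w"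
    then have "p \<noteq> []" by (simp add: splits_def)
    then have "ins m (\<lambda>p. H p q) p =
      (\<Sum>j\<le>e. ksign (int (e - j) * (wdeg p + 1)) (\<psi> j q (out \<Phi> (1 - int j) (ins m (c 0 j)) p)))"
      unfolding H_def ins_sum by (simp add: ins_out[OF \<psi>] add.commute)
    moreover have "ksign (wdeg p) (ins m (H p) q) =
       (\<Sum>j\<le>e. ksign (int (e - j) * wdeg p + wdeg p) (ins m (\<lambda>q. \<psi> j q (out \<Phi> (- int j) (c 0 j) p)) q))"
      unfolding H_def ins_sum by (simp add: ins_ksign ksign_sum ksign_ksign add.commute)
    ultimately show "ins m (\<lambda>p. H p q) p + ksign (wdeg p) (ins m (H p) q) = (\<Sum>j\<le>e.
       ksign (int (e - j) * (wdeg p + 1)) (\<psi> j q (out \<Phi> (1 - int j) (ins m (c 0 j)) p)) +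
       ksign (int (e - j) * wdeg p + wdeg p) (ins m (\<lambda>q. \<psi> j q (out \<Phi> (- int j) (c 0 j) p)) q))"
      by (simp add: sum.distrib)
  qed
  finally show ?thesis by (simp add: \<psi>_def)
qed

text \<open>A coalgebra morphism intertwines two coderivations as soon as it does so after
  projection to single arrows. The second hypothesis is this projection, the morphism equation on
  subwords.\<close>

lemma pullback_ins_commute:
  assumes "wadditive \<phi>"
    and "\<And>p q r. w = p @ q @ r \<Longrightarrow> q \<noteq> [] \<Longrightarrow> pullback \<Phi> c 0 0 m' q = ins m (c 0 0) q"
  shows "pullback \<Phi> c 0 0 (ins m' \<phi>) w = ins m (pullback \<Phi> c 0 0 \<phi>) w"
  using assms
proof (induction w arbitrary: \<phi> rule: length_induct)
  case (1 w)
  show ?case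
  proof (cases "w = []")
    case False
    have "pullback \<Phi> c 0 0 (ins m' (\<lambda>r. \<phi> (a # r))) q = ins m (pullback \<Phi> c 0 0 (\<lambda>r. \<phi> (a # r))) q"
      if "w = p @ q" "p \<noteq> []" for p q a
      using that 1(3) by (intro 1(1)[rule_format] wadditive_Cons 1(2)) (auto simp flip: append_assoc)
    moreover have "out \<Phi> 1 (pullback \<Phi> c 0 0 m') p = out \<Phi> 1 (ins m (c 0 0)) p"
      if "w = p @ q" "p \<noteq> []" for p q
      using 1(3)[of "[]" p q] that by (simp add: out_def)
    ultimately show ?thesis
      unfolding pullback_ins[OF False 1(2)] ins_pullback[OF 1(2)]
      by (intro sum.cong refl) (auto simp: splits_def)
  qed (simp add: pullback_Nil)
qed

text \<open>Inserting \<open>m\<close> before or after pulling back along \<open>f\<close> and one factor \<open>c 0 1\<close> differs by the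
  terms in which \<open>c 0 1\<close> is replaced by its boundary \<open>c 1 0\<close>: the remaining terms, in which \<open>m\<close>
  meets only factors \<open>f\<close>, cancel because of their signs.\<close>

lemma pullback_ins_homotopy:
  assumes "wadditive \<phi>"
    and "\<And>p q r. w = p @ q @ r \<Longrightarrow> q \<noteq> [] \<Longrightarrow> pullback \<Phi> c 0 0 m' q = ins m (c 0 0) q"
    and "\<And>p q r. w = p @ q @ r \<Longrightarrow> q \<noteq> [] \<Longrightarrow> c 1 0 q = pullback \<Phi> c 0 1 m' q + ins m (c 0 1) q"
  shows "pullback \<Phi> c 1 0 \<phi> w = pullback \<Phi> c 0 1 (ins m' \<phi>) w + ins m (pullback \<Phi> c 0 1 \<phi>) w"
  using assms
proof (induction w arbitrary: \<phi> rule: length_induct)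
  case (1 w)
  show ?case
  proof (cases "w = []")
    case False
    have *: "pullback \<Phi> c 1 0 (\<lambda>r. \<phi> (a # r)) q =
         pullback \<Phi> c 0 1 (ins m' (\<lambda>r. \<phi> (a # r))) q + ins m (pullback \<Phi> c 0 1 (\<lambda>r. \<phi> (a # r))) q"
      and **: "pullback \<Phi> c 0 0 (ins m' (\<lambda>r. \<phi> (a # r))) q = ins m (pullback \<Phi> c 0 0 (\<lambda>r. \<phi> (a # r))) q"
      if "w = p @ q" "p \<noteq> []" for p q a
    proof -
      have sub: "w = (p @ p') @ q' @ r'" if "q = p' @ q' @ r'" for p' q' r'
        using that \<open>w = p @ q\<close> by simp
      note sub3 = 1(3)[OF sub] and sub4 = 1(4)[OF sub]
      show "pullback \<Phi> c 1 0 (\<lambda>r. \<phi> (a # r)) q =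
         pullback \<Phi> c 0 1 (ins m' (\<lambda>r. \<phi> (a # r))) q + ins m (pullback \<Phi> c 0 1 (\<lambda>r. \<phi> (a # r))) q"
        using that by (intro 1(1)[rule_format] wadditive_Cons 1(2) sub3 sub4) simp_all
      show "pullback \<Phi> c 0 0 (ins m' (\<lambda>r. \<phi> (a # r))) q = ins m (pullback \<Phi> c 0 0 (\<lambda>r. \<phi> (a # r))) q"
        by (intro pullback_ins_commute wadditive_Cons 1(2) sub3) simp_all
    qed
    have o1: "out \<Phi> 1 (pullback \<Phi> c 0 0 m') p = out \<Phi> 1 (ins m (c 0 0)) p"
      if "w = p @ q" "p \<noteq> []" for p q
      using 1(3)[of "[]" p q] that by (simp add: out_def)
    have o2: "pullback \<Phi> c 0 0 (\<lambda>r. \<phi> (out \<Phi> 0 (c 1 0) p # r)) q =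
        pullback \<Phi> c 0 0 (\<lambda>r. \<phi> (out \<Phi> 0 (pullback \<Phi> c 0 1 m') p # r)) q +
        pullback \<Phi> c 0 0 (\<lambda>r. \<phi> (out \<Phi> 0 (ins m (c 0 1)) p # r)) q"
      if "w = p @ q" "p \<noteq> []" for p q
      using 1(4)[of "[]" p q] that
      by (simp add: out_def additive.add[OF wadditive_head[OF 1(2)]] pullback_add)
    show ?thesis
      unfolding pullback_ins[OF False 1(2)] ins_pullback[OF 1(2)]
        pullback_splits[OF False, where k = 1 and e = 0] sum.distrib[symmetric]
    proof (intro sum.cong refl, clarify)
      fix p q assume "(p, q) \<in> splits w"
      then have pq: "w = p @ q" "p \<noteq> []" by (auto simp: splits_def)
      have s1: "ksign (- 1 + wdeg p) x = - ksign (wdeg p) x" "ksign (wdeg p - 1) x = - ksign (wdeg p) x"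
        "ksign (wdeg p + 1) x = - ksign (wdeg p) x" "ksign (wdeg p + wdeg p) x = x" "ksign (2 * wdeg p) x = x" for x :: 'c
        by (auto simp: ksign_def)
      \<comment> \<open>Two pairs cancel. If m acts on the first piece and the homotopy comes later,
        the signs are \<open>wdeg p\<close> and \<open>wdeg p + 1\<close>, and the terms agree by
        \<open>o1\<close>. If the homotopy is in the first piece and m acts behind it, the signs are
        \<open>wdeg p - 1\<close> and \<open>wdeg p\<close>, and the terms agree by the commutation
        rule. What remains is the boundary of the homotopy in the first piece (\<open>o2\<close>)
        and the induction hypothesis.\<close>
      show "(\<Sum>i\<le>1. \<Sum>j\<le>0. ksign (int (0 - j) * wdeg p)
          (pullback \<Phi> c (1 - i) (0 - j) (\<lambda>r. \<phi> (out \<Phi> (- int j) (c i j) p # r)) q)) =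
        (\<Sum>j\<le>1. ksign (int (1 - j) * wdeg p)
           (pullback \<Phi> c 0 (1 - j) (\<lambda>r. \<phi> (out \<Phi> (1 - int j) (pullback \<Phi> c 0 j m') p # r)) q +
            ksign (wdeg p - int j) (pullback \<Phi> c 0 (1 - j) (ins m' (\<lambda>r. \<phi> (out \<Phi> (- int j) (c 0 j) p # r))) q))) +
        (\<Sum>j\<le>1. ksign (int (1 - j) * (wdeg p + 1))
             (pullback \<Phi> c 0 (1 - j) (\<lambda>r. \<phi> (out \<Phi> (1 - int j) (ins m (c 0 j)) p # r)) q) +
            ksign (int (1 - j) * wdeg p + wdeg p)
             (ins m (pullback \<Phi> c 0 (1 - j) (\<lambda>r. \<phi> (out \<Phi> (- int j) (c 0 j) p # r))) q))"
        by (simp add: atMost_Suc o1[OF pq] o2[OF pq, unfolded One_nat_def]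
            *[OF pq, unfolded One_nat_def] **[OF pq] ksign_add ksign_ksign s1)
    qed
  qed (simp add: pullback_Nil)
qed

text \<open>Functoriality: grouping the outputs of c that enter the same h turns a decomposition of
  a decomposition into one decomposition, whose factors are the pullbacks of h. As h carries no
  homotopy, all e occurrences are distributed among these factors.\<close>

lemma pullback_pullback:
  assumes "wadditive \<phi>"
  shows "pullback \<Phi> c 0 e (pullback \<Psi> h 0 0 \<phi>) w =
    pullback (\<Psi> \<circ> \<Phi>) (\<lambda>i j. pullback \<Phi> c i j (h 0 0)) 0 e \<phi> w"
  using assms
proof (induction w arbitrary: e \<phi> rule: length_induct)
  case (1 w)
  define c' where "c' = (\<lambda>i j. pullback \<Phi> c i j (h 0 0))"
  show ?case
  proof (cases "w = []")
    case False
    have "pullback \<Phi> c 0 e (pullback \<Psi> h 0 0 \<phi>) w =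
      pullback \<Phi> c 0 e (\<lambda>r. \<Sum>(r1, r2)\<in>splits r. pullback \<Psi> h 0 0 (\<lambda>s. \<phi> (out \<Psi> 0 (h 0 0) r1 # s)) r2) w"
      using False by (intro pullback_cong) (auto dest!: outputs_ends simp: pullback_splits_0)
    also have "\<dots> = (\<Sum>(p, q)\<in>splits w. \<Sum>j\<le>e. ksign (int (e - j) * wdeg p)
      (pullback \<Phi> c 0 j (\<lambda>r1. pullback \<Phi> c 0 (e - j)
          (pullback \<Psi> h 0 0 (\<lambda>s. \<phi> (out \<Psi> 0 (h 0 0) r1 # s))) q) p))"
      by (rule pullback_sum_splits)
    also have "\<dots> = (\<Sum>(p, q)\<in>splits w. \<Sum>j\<le>e. ksign (int (e - j) * wdeg p)
      (pullback (\<Psi> \<circ> \<Phi>) c' 0 (e - j) (\<lambda>s. \<phi> (out (\<Psi> \<circ> \<Phi>) (- int j) (c' 0 j) p # s)) q))"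
    proof (intro sum.cong refl, clarify, intro sum.cong refl)
      fix p q j assume "(p, q) \<in> splits w"
      then have pq: "w = p @ q" "p \<noteq> []" by (auto simp: splits_def)
      have "pullback \<Phi> c 0 (e - j) (pullback \<Psi> h 0 0 (\<lambda>s. \<phi> (a # s))) q =
          pullback (\<Psi> \<circ> \<Phi>) c' 0 (e - j) (\<lambda>s. \<phi> (a # s)) q" for a
        unfolding c'_def using pq by (intro 1(1)[rule_format] wadditive_Cons 1(2)) simp
      moreover have "additive (\<lambda>v. pullback (\<Psi> \<circ> \<Phi>) c' 0 (e - j) (\<lambda>s. \<phi> (Arrow x i v y # s)) q)" for x i y
        by (intro additive_pullback wadditive_head 1(2))
      note pullback_out[OF this pq(2), where \<Psi> = \<Psi> and d = 0 and m = "h 0 0" and c = c and k = 0 and e = j and \<Phi> = \<Phi>]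
      ultimately show "ksign (int (e - j) * wdeg p)
        (pullback \<Phi> c 0 j (\<lambda>r1. pullback \<Phi> c 0 (e - j)
          (pullback \<Psi> h 0 0 (\<lambda>s. \<phi> (out \<Psi> 0 (h 0 0) r1 # s))) q) p) =
        ksign (int (e - j) * wdeg p)
          (pullback (\<Psi> \<circ> \<Phi>) c' 0 (e - j) (\<lambda>s. \<phi> (out (\<Psi> \<circ> \<Phi>) (- int j) (c' 0 j) p # s)) q)"
        by (simp add: c'_def comp_def)
    qed
    also have "\<dots> = pullback (\<Psi> \<circ> \<Phi>) c' 0 e \<phi> w"
      by (rule pullback_splits_0[OF False, symmetric])
    finally show ?thesis unfolding c'_def .
  qed (simp add: pullback_Nil)
qed

section \<open>Polynomial families\<close>

definition wlinear :: "('k \<Rightarrow> 'v \<Rightarrow> 'v) \<Rightarrow> ('k \<Rightarrow> 'u \<Rightarrow> 'u) \<Rightarrow>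
    (('o, 'v::ab_group_add) arrow list \<Rightarrow> 'u::ab_group_add) \<Rightarrow> bool" where
  "wlinear sV sU \<phi> \<longleftrightarrow> wadditive \<phi> \<and>
     (\<forall>p x i y r k v. \<phi> (p @ Arrow x i (sV k v) y # r) = sU k (\<phi> (p @ Arrow x i v y # r)))"

lemma wlinear_Cons: "wlinear sV sU \<phi> \<Longrightarrow> wlinear sV sU (\<lambda>r. \<phi> (c # r))"
  unfolding wlinear_def by (metis append_Cons wadditive_Cons)

lemma wlinear_additive: "wlinear sV sU \<phi> \<Longrightarrow> wadditive \<phi>"
  by (simp add: wlinear_def)

lemma wlinear_head: "wlinear sV sU \<phi> \<Longrightarrow> \<phi> (Arrow x i (sV k v) y # r) = sU k (\<phi> (Arrow x i v y # r))"
  unfolding wlinear_def by (metis append_Nil)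

lemma additive_scale: "vector_space s \<Longrightarrow> additive (s k)"
proof -
  assume "vector_space s"
  then interpret vector_space s .
  show "additive (s k)" by standard (rule scale_right_distrib)
qed

lemma scale_scale: "vector_space s \<Longrightarrow> s k (s l v) = s (k * l) v"
  and scale_sum_left: "vector_space s \<Longrightarrow> s (sum f I) v = (\<Sum>i\<in>I. s (f i) v)"
  and scale_one: "vector_space s \<Longrightarrow> s 1 v = v"
  and scale_zero: "vector_space s \<Longrightarrow> s 0 v = 0"
proof -
  assume "vector_space s"
  then interpret vector_space s .
  show "s k (s l v) = s (k * l) v" "s (sum f I) v = (\<Sum>i\<in>I. s (f i) v)" "s 1 v = v" "s 0 v = 0"
    by (simp_all add: scale_sum_left)
qed

text \<open>The coefficient of \<open>\<epsilon>\<^sup>s\<close> in \<open>(t + \<epsilon>)\<^sup>k\<close>: it turns the coefficients of a polynomial into its value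
  (\<open>s = 0\<close>) and its derivative (\<open>s = 1\<close>) at \<open>t\<close>. Where the exponent \<open>k - s\<close> is truncated, the binomial
  coefficient vanishes.\<close>

definition taylor :: "'k::field \<Rightarrow> nat \<Rightarrow> nat \<Rightarrow> 'k" where
  "taylor t s k = of_nat (k choose s) * t ^ (k - s)"

text \<open>Compares the coefficients of \<epsilon>^s in (t + \<epsilon>)^(i + j) = (t +
  \<epsilon>)^i (t + \<epsilon>)^j; the integer coefficients are Vandermonde's identity.\<close>

lemma taylor_add: "taylor t s (i + j) = (\<Sum>s1\<le>s. taylor t s1 i * taylor t (s - s1) j)"
proof -
  have "of_nat (i choose s1) * of_nat (j choose (s - s1)) * t ^ (i + j - s) =
      taylor t s1 i * taylor t (s - s1) j" if "s1 \<le> s" for s1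
  proof (cases "s1 \<le> i \<and> s - s1 \<le> j")
    case True
    then have "i + j - s = (i - s1) + (j - (s - s1))" using that by arith
    then show ?thesis by (simp add: taylor_def power_add)
  qed (auto simp: taylor_def not_le binomial_eq_0)
  moreover have "taylor t s (i + j) =
      (\<Sum>s1\<le>s. of_nat (i choose s1) * of_nat (j choose (s - s1)) * t ^ (i + j - s))"
    unfolding taylor_def vandermonde[symmetric] by (simp add: sum_distrib_right)
  ultimately show ?thesis by simp
qed

lemma taylor_zero: "taylor t s 0 = (if s = 0 then 1 else 0)"
  by (cases s) (simp_all add: taylor_def)

text \<open>There are at most \<open>length w\<close> factors. If their indices add up to more than
  \<open>N * length w\<close>, one of them exceeds N, so that factor vanishes, and \<phi> vanishes
  with it.\<close>

lemma pullback_eq_0: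
  assumes "wadditive \<phi>"
    and "\<And>p q r k j. w = p @ q @ r \<Longrightarrow> q \<noteq> [] \<Longrightarrow> N < k \<Longrightarrow> j \<le> e \<Longrightarrow> fam k j q = 0"
    and "N * length w < k"
  shows "pullback \<Phi> fam k e \<phi> w = 0"
  using assms
proof (induction w arbitrary: k e \<phi> rule: length_induct)
  case (1 w)
  show ?case
  proof (cases "w = []")
    case False
    have "pullback \<Phi> fam (k - i) (e - j) (\<lambda>r. \<phi> (out \<Phi> (- int j) (fam i j) p # r)) q = 0"
      if "w = p @ q" "p \<noteq> []" "i \<le> k" "j \<le> e" for p q i j
    proof (cases "N < i")
      case True
      then have "fam i j p = 0" using 1(3)[of "[]" p q] that by simp
      then show ?thesis
        by (simp add: out_def additive.zero[OF wadditive_head[OF 1(2)]] pullback_zero)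
    next
      case False
      have "N + N * length q \<le> N * length w"
        using that by (cases p) auto
      then have "N * length q < k - i" using False 1(4) by linarith
      moreover have "w = (p @ p') @ q' @ r'" if "q = p' @ q' @ r'" for p' q' r'
        using that \<open>w = p @ q\<close> by simp
      note 1(3)[OF this]
      ultimately show ?thesis
        using that by (intro 1(1)[rule_format] wadditive_Cons 1(2)) auto
    qed
    then show ?thesis using False
      by (auto simp: pullback_splits splits_def intro!: sum.neutral)
  qed (use 1(4) in \<open>simp add: pullback_Nil\<close>)
qed

text \<open>Evaluation commutes with the pullback because Taylor coefficients are multiplicative
  (\<open>taylor_add\<close>). For \<open>s = 0\<close> this evaluates h o a at t; for
  \<open>s = 1\<close> it is the Leibniz rule. K may be any sufficiently large bound: after a first
  factor of index l the recursion continues with \<open>K - l\<close>.\<close>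

lemma pullback_taylor:
  fixes sU :: "'k::field \<Rightarrow> 'u::ab_group_add \<Rightarrow> 'u"
  assumes vs: "vector_space sU" and "wlinear sV sU \<phi>"
    and "\<And>p q r k j. w = p @ q @ r \<Longrightarrow> q \<noteq> [] \<Longrightarrow> N < k \<Longrightarrow> j \<le> e \<Longrightarrow> fam k j q = 0"
    and "\<And>p q r i j. w = p @ q @ r \<Longrightarrow> q \<noteq> [] \<Longrightarrow> i \<le> s \<Longrightarrow> j \<le> e \<Longrightarrow>
      c i j q = (\<Sum>k\<le>N. sV (taylor t i k) (fam k j q))"
    and "N * length w \<le> K"
  shows "pullback \<Phi> c s e \<phi> w = (\<Sum>k\<le>K. sU (taylor t s k) (pullback \<Phi> fam k e \<phi> w))"
  using assms(2-)
proof (induction w arbitrary: s e \<phi> K rule: length_induct)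
  case (1 w)
  note sc = additive_scale[OF vs]
  show ?case
  proof (cases "w = []")
    case True
    have "(\<Sum>k\<le>K. sU (taylor t s k) (pullback \<Phi> fam k e \<phi> [])) =
      (\<Sum>k\<in>{0}. sU (taylor t s k) (pullback \<Phi> fam k e \<phi> []))"
      by (rule sum.mono_neutral_right) (auto simp: pullback_Nil additive.zero[OF sc])
    then show ?thesis using True
      by (simp add: pullback_Nil taylor_zero scale_one[OF vs] scale_zero[OF vs] additive.zero[OF sc])
  next
    case False
    define X where "X = (\<lambda>p q j i k. pullback \<Phi> fam k (e - j) (\<lambda>r. \<phi> (out \<Phi> (- int j) (fam i j) p # r)) q)"
    have main: "(\<Sum>i\<le>s. pullback \<Phi> c (s - i) (e - j) (\<lambda>r. \<phi> (out \<Phi> (- int j) (c i j) p # r)) q) =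
        (\<Sum>k\<le>K. sU (taylor t s k) (\<Sum>i\<le>k. X p q j i (k - i)))"
      if pq: "w = p @ q" "p \<noteq> []" and j: "j \<le> e" for p q j
    proof -
      have sub: "w = (p @ p') @ q' @ r'" if "q = p' @ q' @ r'" for p' q' r'
        using that \<open>w = p @ q\<close> by simp
      have "N + N * length q \<le> N * length w"
        using pq by (cases p) auto
      then have K: "N + N * length q \<le> K" using 1(5) by linarith
      have step: "pullback \<Phi> c (s - i) (e - j) (\<lambda>r. \<phi> (out \<Phi> (- int j) (c i j) p # r)) q =
        (\<Sum>l\<le>N. \<Sum>k\<le>K - l. sU (taylor t i l * taylor t (s - i) k) (X p q j l k))"
        if i: "i \<le> s" for i
      proof -
        have "\<phi> (out \<Phi> (- int j) (c i j) p # r) =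
          (\<Sum>l\<le>N. sU (taylor t i l) (\<phi> (out \<Phi> (- int j) (fam l j) p # r)))" for r
          using 1(4)[of "[]" p q i j] pq i j
          by (simp add: out_def additive_sum[OF wadditive_head[OF wlinear_additive[OF 1(2)]]]
              wlinear_head[OF 1(2)])
        moreover have "pullback \<Phi> c (s - i) (e - j) (\<lambda>r. \<phi> (a # r)) q =
            (\<Sum>k\<le>K - l. sU (taylor t (s - i) k) (pullback \<Phi> fam k (e - j) (\<lambda>r. \<phi> (a # r)) q))"
          if "l \<le> N" for a l
        proof (rule 1(1)[rule_format])
          show "length q < length w" using pq by simp
          show "N * length q \<le> K - l" using K that by simp
          show "wlinear sV sU (\<lambda>r. \<phi> (a # r))" by (rule wlinear_Cons) (rule 1(2))
        qed (use 1(3)[OF sub] 1(4)[OF sub] in auto)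
        ultimately show ?thesis
          by (simp add: pullback_sum pullback_additive[OF sc] additive_sum[OF sc] scale_scale[OF vs] X_def)
      qed
      have X0: "X p q j l k = 0" if "N < l" for l k
      proof -
        have "fam l j p = 0" using 1(3)[of "[]" p q l j] that pq j by simp
        then show ?thesis
          by (simp add: X_def out_def pullback_zero
              additive.zero[OF wadditive_head[OF wlinear_additive[OF 1(2)]]])
      qed
      have "(\<Sum>i\<le>s. pullback \<Phi> c (s - i) (e - j) (\<lambda>r. \<phi> (out \<Phi> (- int j) (c i j) p # r)) q) =
        (\<Sum>i\<le>s. \<Sum>l\<le>N. \<Sum>k\<le>K - l. sU (taylor t i l * taylor t (s - i) k) (X p q j l k))"
        using step by simp
      also have "\<dots> = (\<Sum>l\<le>N. \<Sum>k\<le>K - l. \<Sum>i\<le>s. sU (taylor t i l * taylor t (s - i) k) (X p q j l k))"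
        by (subst sum.swap, rule sum.cong[OF refl], rule sum.swap)
      also have "\<dots> = (\<Sum>l\<le>N. \<Sum>k\<le>K - l. sU (taylor t s (l + k)) (X p q j l k))"
        by (simp add: taylor_add scale_sum_left[OF vs])
      \<comment> \<open>Adding the vanishing terms with \<open>l > N\<close> makes the index set a
        full triangle, which can be summed along antidiagonals.\<close>
      also have "\<dots> = (\<Sum>l\<le>K. \<Sum>k\<le>K - l. sU (taylor t s (l + k)) (X p q j l k))"
        using K by (intro sum.mono_neutral_left) (auto simp: X0 additive.zero[OF sc])
      also have "\<dots> = (\<Sum>k\<le>K. \<Sum>i\<le>k. sU (taylor t s (i + (k - i))) (X p q j i (k - i)))"
        by (rule sum_antidiagonal[symmetric])
      also have "\<dots> = (\<Sum>k\<le>K. sU (taylor t s k) (\<Sum>i\<le>k. X p q j i (k - i)))"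
        by (simp add: additive_sum[OF sc])
      finally show ?thesis .
    qed
    have "pullback \<Phi> c s e \<phi> w = (\<Sum>(p, q)\<in>splits w. \<Sum>j\<le>e. ksign (int (e - j) * wdeg p)
       (\<Sum>i\<le>s. pullback \<Phi> c (s - i) (e - j) (\<lambda>r. \<phi> (out \<Phi> (- int j) (c i j) p # r)) q))"
      unfolding pullback_splits[OF False]
      by (rule sum.cong[OF refl], clarify, subst sum.swap) (simp only: ksign_sum)
    also have "\<dots> = (\<Sum>(p, q)\<in>splits w. \<Sum>j\<le>e. ksign (int (e - j) * wdeg p)
       (\<Sum>k\<le>K. sU (taylor t s k) (\<Sum>i\<le>k. X p q j i (k - i))))"
      by (intro sum.cong refl) (auto simp: main splits_def)
    also have "\<dots> = (\<Sum>(p, q)\<in>splits w. \<Sum>j\<le>e. \<Sum>k\<le>K. sU (taylor t s k)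
       (ksign (int (e - j) * wdeg p) (\<Sum>i\<le>k. X p q j i (k - i))))"
      by (simp only: ksign_sum[of _ _ "{..K}"] additive_ksign[OF sc])
    also have "\<dots> = (\<Sum>(p, q)\<in>splits w. \<Sum>k\<le>K. \<Sum>j\<le>e. sU (taylor t s k)
       (ksign (int (e - j) * wdeg p) (\<Sum>i\<le>k. X p q j i (k - i))))"
      by (rule sum.cong[OF refl], clarify, rule sum.swap)
    also have "\<dots> = (\<Sum>k\<le>K. \<Sum>(p, q)\<in>splits w. \<Sum>j\<le>e. sU (taylor t s k)
       (ksign (int (e - j) * wdeg p) (\<Sum>i\<le>k. X p q j i (k - i))))"
      unfolding case_prod_unfold by (rule sum.swap)
    also have "\<dots> = (\<Sum>k\<le>K. sU (taylor t s k) (\<Sum>(p, q)\<in>splits w. \<Sum>j\<le>e.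
       (ksign (int (e - j) * wdeg p) (\<Sum>i\<le>k. X p q j i (k - i)))))"
      by (simp only: additive_sum[OF sc] case_prod_unfold)
    also have "\<dots> = (\<Sum>k\<le>K. sU (taylor t s k) (pullback \<Phi> fam k e \<phi> w))"
      unfolding pullback_splits[OF False] X_def
      by (rule sum.cong[OF refl], rule arg_cong[of _ _ "sU _"], rule sum.cong[OF refl], clarify,
          subst sum.swap) (simp only: ksign_sum)
    finally show ?thesis .
  qed
qed

text \<open>The distinguished arrow lies in exactly one piece, and linearity of the factor there
  passes through the slot of \<phi>. Linearity of the factors is assumed only on subwords around
  that arrow, since cochains are linear only on genuine inputs. Additivity and homogeneity are
  handled by one identity.\<close>

lemma pullback_linear:
  assumes vs: "vector_space sU" and "wlinear sV sU \<phi>"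
    and "\<And>p p' r r' i j. w1 = p' @ p \<Longrightarrow> w2 = r @ r' \<Longrightarrow> i \<le> k \<Longrightarrow> j \<le> e \<Longrightarrow>
      c i j (p @ Arrow x d v y # r) = c i j (p @ Arrow x d v1 y # r) + sV \<kappa> (c i j (p @ Arrow x d v2 y # r))"
  shows "pullback \<Phi> c k e \<phi> (w1 @ Arrow x d v y # w2) =
    pullback \<Phi> c k e \<phi> (w1 @ Arrow x d v1 y # w2) + sU \<kappa> (pullback \<Phi> c k e \<phi> (w1 @ Arrow x d v2 y # w2))"
  using assms(2-)
proof (induction w1 arbitrary: k e \<phi> rule: length_induct)
  case (1 w1)
  note sc = additive_scale[OF vs, of \<kappa>]
  let ?T = "\<lambda>p q i j. ksign (int (e - j) * wdeg p)
    (pullback \<Phi> c (k - i) (e - j) (\<lambda>r. \<phi> (out \<Phi> (- int j) (c i j) p # r)) q)"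
  \<comment> \<open>The first piece ends before the distinguished arrow: induction applies to the
    remainder.\<close>
  have A: "?T p (q @ Arrow x d v y # w2) i j =
      ?T p (q @ Arrow x d v1 y # w2) i j + sU \<kappa> (?T p (q @ Arrow x d v2 y # w2) i j)"
    if "(p, q) \<in> splits w1" "i \<le> k" "j \<le> e" for p q i j
  proof -
    have w1: "w1 = p @ q" "p \<noteq> []" using that by (auto simp: splits_def)
    have "w1 = (p @ p'') @ p'" if "q = p'' @ p'" for p' p'' using w1 that by simp
    note 1(3)[OF this]
    then have "pullback \<Phi> c (k - i) (e - j) (\<lambda>r. \<phi> (a # r)) (q @ Arrow x d v y # w2) =
      pullback \<Phi> c (k - i) (e - j) (\<lambda>r. \<phi> (a # r)) (q @ Arrow x d v1 y # w2) +
      sU \<kappa> (pullback \<Phi> c (k - i) (e - j) (\<lambda>r. \<phi> (a # r)) (q @ Arrow x d v2 y # w2))" for a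
      using w1 by (intro 1(1)[rule_format] wlinear_Cons 1(2)) auto
    then show ?thesis by (simp add: ksign_add additive_ksign[OF sc])
  qed
  \<comment> \<open>The first piece contains the distinguished arrow: the linearity of the first
    factor is used.\<close>
  have B: "?T (w1 @ Arrow x d v y # p) q i j =
      ?T (w1 @ Arrow x d v1 y # p) q i j + sU \<kappa> (?T (w1 @ Arrow x d v2 y # p) q i j)"
    if "(p, q) \<in> splits0 w2" "i \<le> k" "j \<le> e" for p q i j
  proof -
    have hd: "src (hd (w1 @ Arrow x d v y # p)) = src (hd (w1 @ Arrow x d v' y # p))"
      "tgt (last (w1 @ Arrow x d v y # p)) = tgt (last (w1 @ Arrow x d v' y # p))" for v v'
      by (cases w1; simp) (cases p; simp)
    have "\<phi> (out \<Phi> (- int j) (c i j) (w1 @ Arrow x d v y # p) # r) =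
       \<phi> (out \<Phi> (- int j) (c i j) (w1 @ Arrow x d v1 y # p) # r) +
       sU \<kappa> (\<phi> (out \<Phi> (- int j) (c i j) (w1 @ Arrow x d v2 y # p) # r))" for r
      using 1(3)[of "[]" w1 p q i j] that
      by (simp add: out_def splits0_def hd[of v v1] hd[of v2 v1]
          additive.add[OF wadditive_head[OF wlinear_additive[OF 1(2)]]] wlinear_head[OF 1(2)])
    then show ?thesis
      by (simp add: pullback_add pullback_additive[OF sc] ksign_add additive_ksign[OF sc])
  qed
  define F where "F = (\<lambda>p q. \<Sum>i\<le>k. \<Sum>j\<le>e. ?T p q i j)"
  have FA: "F p (q @ Arrow x d v y # w2) =
      F p (q @ Arrow x d v1 y # w2) + sU \<kappa> (F p (q @ Arrow x d v2 y # w2))"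
    if "(p, q) \<in> splits w1" for p q
    unfolding F_def using A[OF that] by (simp add: sum.distrib additive_sum[OF sc])
  have FB: "F (w1 @ Arrow x d v y # p) q =
      F (w1 @ Arrow x d v1 y # p) q + sU \<kappa> (F (w1 @ Arrow x d v2 y # p) q)"
    if "(p, q) \<in> splits0 w2" for p q
    unfolding F_def using B[OF that] by (simp add: sum.distrib additive_sum[OF sc])
  have "(\<Sum>(p, q)\<in>splits w1. F p (q @ Arrow x d v y # w2)) =
      (\<Sum>(p, q)\<in>splits w1. F p (q @ Arrow x d v1 y # w2) + sU \<kappa> (F p (q @ Arrow x d v2 y # w2)))"
    by (intro sum.cong refl) (auto simp: FA)
  moreover have "(\<Sum>(p, q)\<in>splits0 w2. F (w1 @ Arrow x d v y # p) q) =
      (\<Sum>(p, q)\<in>splits0 w2. F (w1 @ Arrow x d v1 y # p) q + sU \<kappa> (F (w1 @ Arrow x d v2 y # p) q))"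
    by (intro sum.cong refl) (auto simp: FB)
  ultimately have "(\<Sum>(p, q)\<in>splits (w1 @ Arrow x d v y # w2). F p q) =
     (\<Sum>(p, q)\<in>splits (w1 @ Arrow x d v1 y # w2). F p q) +
     sU \<kappa> (\<Sum>(p, q)\<in>splits (w1 @ Arrow x d v2 y # w2). F p q)"
    by (simp only: sum_splits_insert)
       (simp add: case_prod_unfold sum.distrib additive.add[OF sc] additive_sum[OF sc])
  then show ?case
    by (simp only: F_def pullback_splits append_is_Nil_conv list.distinct simp_thms not_False_eq_True)
qed

lemma pullback_subspace:
  assumes vs: "vector_space sU" and U: "module.subspace sU U"
    and "\<And>r. outputs \<Phi> c k e w r \<Longrightarrow> \<phi> r \<in> U"
  shows "pullback \<Phi> c k e \<phi> w \<in> U"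
  using assms(3)
proof (induction w arbitrary: k e \<phi> rule: length_induct)
  case (1 w)
  interpret vector_space sU by fact
  note sub = subspace_0[OF U] subspace_sum[OF U] subspace_neg[OF U]
  show ?case
  proof (cases "w = []")
    case True
    then show ?thesis using 1(2)[of "[]"] by (auto simp: pullback_Nil outputs_Nil sub)
  next
    case False
    have "pullback \<Phi> c (k - i) (e - j) (\<lambda>r. \<phi> (out \<Phi> (- int j) (c i j) p # r)) q \<in> U"
      if "w = p @ q" "p \<noteq> []" "i \<le> k" "j \<le> e" for p q i j
      using that by (intro 1(1)[rule_format] 1(2)) (auto intro: outputs_Cons)
    then show ?thesis
      unfolding pullback_splits[OF False]
      by (auto simp: splits_def ksign_def intro!: sub)
  qed
qed

section \<open>Cochains as functions of words\<close>

text \<open>On the empty word \<open>last []\<close> is unspecified; the inputs of a cochain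
  correspond to nonempty words only.\<close>

definition wobjs :: "('o, 'v) arrow list \<Rightarrow> 'o list" where
  "wobjs w = map src w @ [tgt (last w)]"

definition winputs :: "('o, 'v) arrow list \<Rightarrow> (int \<times> 'v) list" where
  "winputs w = map (\<lambda>c. (deg c, vec c)) w"

definition wcochain :: "('o, 'v, 'w) cochain \<Rightarrow> ('o, 'v) arrow list \<Rightarrow> 'w" where
  "wcochain f w = f (wobjs w) (winputs w)"

definition composable :: "('o, 'v) arrow list \<Rightarrow> bool" where
  "composable w \<longleftrightarrow> successively (\<lambda>a b. tgt a = src b) w"

definition arrows :: "('k, 'o, 'v) gquiver \<Rightarrow> ('o, 'v) arrow set" where
  "arrows Q = {a. src a \<in> obj Q \<and> tgt a \<in> obj Q \<and> vec a \<in> hom Q (src a) (tgt a) (deg a + 1)}"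

definition words :: "('k, 'o, 'v) gquiver \<Rightarrow> ('o, 'v) arrow list set" where
  "words Q = {w. composable w \<and> set w \<subseteq> arrows Q}"

text \<open>Inverse to the pair \<open>wobjs\<close>, \<open>winputs\<close> on nonempty composable
  words (\<open>word_wobjs\<close>, \<open>wobjs_word\<close>).\<close>

definition word :: "'o list \<Rightarrow> (int \<times> 'v) list \<Rightarrow> ('o, 'v) arrow list" where
  "word xs vs = map (\<lambda>j. Arrow (xs ! j) (fst (vs ! j)) (snd (vs ! j)) (xs ! Suc j)) [0..<length vs]"

lemma composable_append:
  "composable (p @ q) \<longleftrightarrow> composable p \<and> composable q \<and> (p = [] \<or> q = [] \<or> tgt (last p) = src (hd q))"
  by (auto simp: composable_def successively_append_iff)

lemma composable_Cons:
  "composable (c # w) \<longleftrightarrow> composable w \<and> (w = [] \<or> tgt c = src (hd w))"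
  using composable_append[of "[c]" w] by (auto simp: composable_def)

lemma words_append:
  "p @ q \<in> words Q \<longleftrightarrow> p \<in> words Q \<and> q \<in> words Q \<and> (p = [] \<or> q = [] \<or> tgt (last p) = src (hd q))"
  by (auto simp: words_def composable_append)

lemma words_Cons:
  "c # w \<in> words Q \<longleftrightarrow> c \<in> arrows Q \<and> w \<in> words Q \<and> (w = [] \<or> tgt c = src (hd w))"
  by (auto simp: words_def composable_Cons)

lemma words_Nil [simp]: "[] \<in> words Q"
  by (simp add: words_def composable_def)

lemma words_ends:
  "w \<in> words Q \<Longrightarrow> w \<noteq> [] \<Longrightarrow> src (hd w) \<in> obj Q \<and> tgt (last w) \<in> obj Q"
  by (auto simp: words_def arrows_def subset_iff)

lemma words_subword: "w \<in> words Q \<Longrightarrow> w = p @ q @ r \<Longrightarrow> q \<in> words Q"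
  by (simp add: words_append)

lemma composable_nth:
  "composable w \<longleftrightarrow> (\<forall>j. Suc j < length w \<longrightarrow> tgt (w ! j) = src (w ! Suc j))"
  unfolding composable_def by (subst successively_conv_nth) auto

lemma length_winputs [simp]: "length (winputs w) = length w"
  and length_wobjs [simp]: "length (wobjs w) = Suc (length w)"
  by (auto simp: winputs_def wobjs_def)

lemma total_deg_winputs [simp]: "total_deg (winputs w) = wdeg w"
  by (simp add: total_deg_def winputs_def wdeg_def comp_def)

lemma wobjs_nth:
  assumes "composable w" "w \<noteq> []"
  shows "j < length w \<Longrightarrow> wobjs w ! j = src (w ! j)" "j < length w \<Longrightarrow> wobjs w ! Suc j = tgt (w ! j)"
proof -
  show "j < length w \<Longrightarrow> wobjs w ! j = src (w ! j)"
    by (simp add: wobjs_def nth_append)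
  show "wobjs w ! Suc j = tgt (w ! j)" if "j < length w"
  proof (cases "Suc j < length w")
    case True
    then show ?thesis using assms(1) by (simp add: wobjs_def nth_append composable_nth)
  next
    case False
    then have "Suc j = length w" using that by simp
    then show ?thesis using assms(2) by (simp add: wobjs_def nth_append last_conv_nth flip: \<open>Suc j = length w\<close>)
  qed
qed

lemma wobjs_ends: "w \<noteq> [] \<Longrightarrow> hd (wobjs w) = src (hd w)" "last (wobjs w) = tgt (last w)"
  by (auto simp: wobjs_def hd_append hd_map)

lemma word_wobjs: "composable w \<Longrightarrow> w \<noteq> [] \<Longrightarrow> word (wobjs w) (winputs w) = w"
  by (rule nth_equalityI) (auto simp: word_def wobjs_nth winputs_def)

lemma winputs_word [simp]: "winputs (word xs vs) = vs"
  by (rule nth_equalityI) (auto simp: word_def winputs_def)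

lemma length_word [simp]: "length (word xs vs) = length vs"
  by (simp add: word_def)

lemma wobjs_word:
  assumes "length xs = Suc (length vs)" "vs \<noteq> []"
  shows "wobjs (word xs vs) = xs"
proof (rule nth_equalityI)
  fix j assume "j < length (wobjs (word xs vs))"
  then show "wobjs (word xs vs) ! j = xs ! j"
    using assms by (cases "j < length vs")
      (auto simp: wobjs_def word_def nth_append last_conv_nth less_Suc_eq)
qed (use assms in simp)

lemma words_wobjs:
  assumes "w \<in> words Q" "w \<noteq> []"
  shows "wobjs w \<in> obj_tuples Q" "winputs w \<in> inputs Q (wobjs w)"
proof -
  have c: "composable w" using assms by (simp add: words_def)
  have "Suc 0 \<le> length w" using assms(2) by (cases w) auto
  then show "wobjs w \<in> obj_tuples Q"
    using assms by (auto simp: obj_tuples_def wobjs_def words_def arrows_def subset_iff)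
  have "w ! j \<in> arrows Q" if "j < length w" for j
    using assms(1) that by (auto simp: words_def)
  then show "winputs w \<in> inputs Q (wobjs w)"
    using assms(2) by (auto simp: inputs_def wobjs_nth[OF c] winputs_def arrows_def)
qed

lemma word_words:
  assumes "xs \<in> obj_tuples Q" "vs \<in> inputs Q xs"
  shows "word xs vs \<in> words Q" "word xs vs \<noteq> []" "wobjs (word xs vs) = xs"
proof -
  have l: "length xs = Suc (length vs)" "vs \<noteq> []"
    using assms by (auto simp: inputs_def obj_tuples_def)
  then show "word xs vs \<noteq> []" "wobjs (word xs vs) = xs"
    by (simp_all add: wobjs_word) (simp add: word_def)
  have "xs ! j \<in> obj Q" if "j \<le> length vs" for j
    using assms(1) l that by (auto simp: obj_tuples_def)
  then show "word xs vs \<in> words Q"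
    using assms(2) by (auto simp: words_def composable_nth word_def arrows_def inputs_def)
qed

lemma cochain_eq_iff:
  "cochain_eq A f g \<longleftrightarrow> (\<forall>w\<in>words A. w \<noteq> [] \<longrightarrow> wcochain f w = wcochain g w)"
proof
  assume "cochain_eq A f g"
  then show "\<forall>w\<in>words A. w \<noteq> [] \<longrightarrow> wcochain f w = wcochain g w"
    by (auto simp: cochain_eq_def wcochain_def words_wobjs)
next
  assume *: "\<forall>w\<in>words A. w \<noteq> [] \<longrightarrow> wcochain f w = wcochain g w"
  show "cochain_eq A f g"
    unfolding cochain_eq_def
  proof (intro ballI)
    fix xs vs assume "xs \<in> obj_tuples A" "vs \<in> inputs A xs"
    from word_words[OF this] * show "f xs vs = g xs vs"
      by (auto simp: wcochain_def dest!: bspec)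
  qed
qed

lemma wobjs_update: "wobjs (p @ Arrow x i u y # r) = wobjs (p @ Arrow x i v y # r)"
  by (cases r) (auto simp: wobjs_def)

lemma winputs_update:
  "winputs (p @ Arrow x i v y # r) = (winputs (p @ Arrow x i u y # r))[length p := (i, v)]"
  by (simp add: winputs_def list_update_append)

lemma cochainsD:
  assumes "f \<in> cochains A B \<Phi> d" "w \<in> words A" "w \<noteq> []"
  shows "wcochain f w \<in> hom B (\<Phi> (src (hd w))) (\<Phi> (tgt (last w))) (wdeg w + d + 1)"
  using assms(1) words_wobjs[OF assms(2,3)] assms(3)
  unfolding cochains_def wcochain_def by (fastforce simp: wobjs_ends)

lemma cochains_linear:
  assumes "f \<in> cochains A B \<Phi> d" and w: "p @ Arrow x i u y # r \<in> words A"
    and v: "v \<in> hom A x y (i + 1)" and A: "graded_quiver A"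
  shows "wcochain f (p @ Arrow x i (u + scl A \<kappa> v) y # r) =
    wcochain f (p @ Arrow x i u y # r) + scl B \<kappa> (wcochain f (p @ Arrow x i v y # r))"
proof -
  let ?w = "p @ Arrow x i u y # r"
  have c: "composable ?w" and a: "Arrow x i u y \<in> arrows A"
    using w by (auto simp: words_def)
  have u: "u \<in> hom A x y (i + 1)" and xy: "x \<in> obj A" "y \<in> obj A"
    using a by (auto simp: arrows_def)
  have V: "hom A (wobjs ?w ! length p) (wobjs ?w ! Suc (length p)) (i + 1) = hom A x y (i + 1)"
    using wobjs_nth[OF c, of "length p"] by simp
  have n: "fst (winputs ?w ! length p) = i"
    by (simp add: winputs_def nth_append)
  interpret vector_space "scl A" using A by (simp add: graded_quiver_def)
  have "subspace (hom A x y (i + 1))" using A xy by (simp add: graded_quiver_def)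
  then have sv: "scl A \<kappa> v \<in> hom A x y (i + 1)" using v by (rule subspace_scale)
  have *: "(\<forall>u\<in>hom A x y (i + 1). \<forall>w\<in>hom A x y (i + 1). f (wobjs ?w) ((winputs ?w)[length p := (i, u + w)]) =
        f (wobjs ?w) ((winputs ?w)[length p := (i, u)]) + f (wobjs ?w) ((winputs ?w)[length p := (i, w)])) \<and>
     (\<forall>c. \<forall>u\<in>hom A x y (i + 1). f (wobjs ?w) ((winputs ?w)[length p := (i, scl A c u)]) =
        scl B c (f (wobjs ?w) ((winputs ?w)[length p := (i, u)])))"
  proof -
    have "\<forall>j<length (winputs ?w).
       let i = fst (winputs ?w ! j); V = hom A (wobjs ?w ! j) (wobjs ?w ! Suc j) (i + 1)
       in (\<forall>u\<in>V. \<forall>v\<in>V. f (wobjs ?w) ((winputs ?w)[j := (i, u + v)]) =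
            f (wobjs ?w) ((winputs ?w)[j := (i, u)]) + f (wobjs ?w) ((winputs ?w)[j := (i, v)])) \<and>
          (\<forall>c. \<forall>u\<in>V. f (wobjs ?w) ((winputs ?w)[j := (i, scl A c u)]) =
            scl B c (f (wobjs ?w) ((winputs ?w)[j := (i, u)])))"
      using assms(1) words_wobjs[OF w] unfolding cochains_def by blast
    from this[rule_format, of "length p"] show ?thesis
      by (simp add: Let_def V n)
  qed
  have eq: "wcochain f (p @ Arrow x i v' y # r) = f (wobjs ?w) ((winputs ?w)[length p := (i, v')])" for v'
    unfolding wcochain_def winputs_update[of p x i v' y r u] wobjs_update[of p x i v' y r u] ..
  show ?thesis unfolding eq using * u v sv by auto
qed

text \<open>The combined identity suffices: \<kappa> = 1 gives additivity, hence the value 0 at the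
  zero vector, and then u = 0 gives homogeneity. The zero vector is available because the morphism
  spaces are subspaces.\<close>

lemma cochainsI:
  assumes A: "graded_quiver A" and B: "vector_space (scl B)"
    and val: "\<And>w. w \<in> words A \<Longrightarrow> w \<noteq> [] \<Longrightarrow>
      wcochain f w \<in> hom B (\<Phi> (src (hd w))) (\<Phi> (tgt (last w))) (wdeg w + d + 1)"
    and lin: "\<And>p x i u v y r \<kappa>. p @ Arrow x i u y # r \<in> words A \<Longrightarrow> v \<in> hom A x y (i + 1) \<Longrightarrow>
      wcochain f (p @ Arrow x i (u + scl A \<kappa> v) y # r) =
      wcochain f (p @ Arrow x i u y # r) + scl B \<kappa> (wcochain f (p @ Arrow x i v y # r))"
  shows "f \<in> cochains A B \<Phi> d"
  unfolding cochains_def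
proof (intro CollectI ballI conjI)
  interpret A: vector_space "scl A" using A by (simp add: graded_quiver_def)
  interpret B: vector_space "scl B" by fact
  fix xs vs assume xs: "xs \<in> obj_tuples A" and vs: "vs \<in> inputs A xs"
  define w where "w = word xs vs"
  note w = word_words[OF xs vs, folded w_def]
  have vs_eq: "winputs w = vs" by (simp add: w_def)
  show "f xs vs \<in> hom B (\<Phi> (hd xs)) (\<Phi> (last xs)) (total_deg vs + d + 1)"
    using val[OF w(1,2)] wobjs_ends[of w] w(2) w(3)
    by (simp add: wcochain_def vs_eq flip: total_deg_winputs)
  show "\<forall>j<length vs.
       let i = fst (vs ! j); V = hom A (xs ! j) (xs ! Suc j) (i + 1)
       in (\<forall>u\<in>V. \<forall>w\<in>V. f xs (vs[j := (i, u + w)]) = f xs (vs[j := (i, u)]) + f xs (vs[j := (i, w)])) \<and>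
          (\<forall>c. \<forall>u\<in>V. f xs (vs[j := (i, scl A c u)]) = scl B c (f xs (vs[j := (i, u)])))"
    unfolding Let_def
  proof (intro allI impI)
    fix j assume j: "j < length vs"
    define i where "i = fst (vs ! j)"
    define V where "V = hom A (xs ! j) (xs ! Suc j) (i + 1)"
    define p where "p = take j w"
    define r where "r = drop (Suc j) w"
    have lw: "length w = length vs" by (simp add: w_def)
    have wj: "w ! j = Arrow (xs ! j) i (snd (vs ! j)) (xs ! Suc j)"
      using j by (simp add: w_def word_def i_def)
    have w_eq: "w = p @ Arrow (xs ! j) i (snd (vs ! j)) (xs ! Suc j) # r"
      unfolding p_def r_def wj[symmetric] using j lw by (simp add: id_take_nth_drop[symmetric])
    have lp: "length p = j" using j lw by (simp add: p_def)
    have obj: "xs ! j \<in> obj A" "xs ! Suc j \<in> obj A"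
      using xs vs j by (auto simp: obj_tuples_def inputs_def)
    have eq: "f xs (vs[j := (i, v)]) = wcochain f (p @ Arrow (xs ! j) i v (xs ! Suc j) # r)" for v
    proof -
      have "wobjs (p @ Arrow (xs ! j) i v (xs ! Suc j) # r) = xs"
        using w(3) unfolding w_eq by (metis wobjs_update)
      moreover have "winputs (p @ Arrow (xs ! j) i v (xs ! Suc j) # r) = vs[j := (i, v)]"
        unfolding winputs_update[of p "xs ! j" i v "xs ! Suc j" r "snd (vs ! j)"] w_eq[symmetric] vs_eq lp ..
      ultimately show ?thesis by (simp add: wcochain_def)
    qed
    have ok: "p @ Arrow (xs ! j) i v (xs ! Suc j) # r \<in> words A" if "v \<in> V" for v
      using w(1) that obj unfolding w_eq by (simp add: words_append words_Cons arrows_def V_def)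
    have lin': "f xs (vs[j := (i, u + scl A \<kappa> v)]) = f xs (vs[j := (i, u)]) + scl B \<kappa> (f xs (vs[j := (i, v)]))"
      if "u \<in> V" "v \<in> V" for u v \<kappa>
      unfolding eq using lin[OF ok[OF that(1)]] that(2) by (simp add: V_def)
    have "A.subspace V" using A obj by (simp add: graded_quiver_def V_def)
    then have V0: "0 \<in> V" by (rule A.subspace_0)
    have add: "f xs (vs[j := (i, u + v)]) = f xs (vs[j := (i, u)]) + f xs (vs[j := (i, v)])"
      if "u \<in> V" "v \<in> V" for u v
      using lin'[OF that, of 1] by simp
    have f0: "f xs (vs[j := (i, 0)]) = 0"
      using add[OF V0 V0] by simp
    have "f xs (vs[j := (i, scl A c u)]) = scl B c (f xs (vs[j := (i, u)]))" if "u \<in> V" for c u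
      using lin'[OF V0 that, of c] f0 by simp
    with add show "(\<forall>u\<in>hom A (xs ! j) (xs ! Suc j) (fst (vs ! j) + 1). \<forall>w\<in>hom A (xs ! j) (xs ! Suc j) (fst (vs ! j) + 1).
          f xs (vs[j := (fst (vs ! j), u + w)]) = f xs (vs[j := (fst (vs ! j), u)]) + f xs (vs[j := (fst (vs ! j), w)])) \<and>
        (\<forall>c. \<forall>u\<in>hom A (xs ! j) (xs ! Suc j) (fst (vs ! j) + 1).
          f xs (vs[j := (fst (vs ! j), scl A c u)]) = scl B c (f xs (vs[j := (fst (vs ! j), u)])))"
      by (simp add: V_def i_def)
  qed
qed

text \<open>Linear projections onto the morphism spaces extend every cochain to a function that is
  multilinear on all words, so that multilinearity does not have to be relativised.\<close>

lemma cochain_extension: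
  fixes A :: "('k::field, 'o, 'v::ab_group_add) gquiver" and B :: "('k, 'p, 'w::ab_group_add) gquiver"
  assumes f: "f \<in> cochains A B \<Phi> d" and A: "graded_quiver A" and B: "vector_space (scl B)"
  obtains F where "wlinear (scl A) (scl B) F"
    and "\<And>w. w \<in> words A \<Longrightarrow> w \<noteq> [] \<Longrightarrow> F w = wcochain f w"
proof -
  interpret A: vector_space "scl A" using A by (simp add: graded_quiver_def)
  interpret AA: vector_space_pair "scl A" "scl A" ..
  interpret B: vector_space "scl B" by fact
  \<comment> \<open>A linear left inverse of the inclusion of a morphism space, that is, a
    projection of the ambient space onto it.\<close>
  have "\<exists>g. g ` UNIV \<subseteq> hom A x y i \<and> Vector_Spaces.linear (scl A) (scl A) g \<and> (\<forall>v\<in>hom A x y i. g (id v) = v)"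
    if "x \<in> obj A" "y \<in> obj A" for x y i
    using that A by (intro AA.linear_exists_left_inverse_on A.linear_id) (auto simp: graded_quiver_def)
  then obtain \<pi> where \<pi>: "\<And>x y i v. x \<in> obj A \<Longrightarrow> y \<in> obj A \<Longrightarrow> \<pi> x y i v \<in> hom A x y i"
    "\<And>x y i. x \<in> obj A \<Longrightarrow> y \<in> obj A \<Longrightarrow> Vector_Spaces.linear (scl A) (scl A) (\<pi> x y i)"
    "\<And>x y i v. x \<in> obj A \<Longrightarrow> y \<in> obj A \<Longrightarrow> v \<in> hom A x y i \<Longrightarrow> \<pi> x y i v = v"
    by (simp add: image_subset_iff) metis
  define proj where "proj = (\<lambda>a. Arrow (src a) (deg a) (\<pi> (src a) (tgt a) (deg a + 1) (vec a)) (tgt a))"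
  \<comment> \<open>This condition does not look at the vectors, so changing one of them stays in
    the same branch of \<open>F\<close>, and the default value 0 is multilinear as well.\<close>
  define ok where "ok = (\<lambda>w :: ('o, 'v) arrow list. composable w \<and> (\<forall>a\<in>set w. src a \<in> obj A \<and> tgt a \<in> obj A))"
  define F where "F = (\<lambda>w. if ok w \<and> w \<noteq> [] then wcochain f (map proj w) else 0)"
  have proj_words: "map proj w \<in> words A" if "ok w" for w
    using that by (auto simp: ok_def words_def composable_nth arrows_def proj_def \<pi>)
  have proj_id: "map proj w = w" if "w \<in> words A" for w
    using that by (intro map_idI) (auto simp: words_def arrows_def proj_def \<pi> arrow.expand subset_iff)
  have ok_update: "ok (p @ Arrow x i v y # r) \<longleftrightarrow> ok (p @ Arrow x i v' y # r)" for p x i v v' y r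
    by (auto simp: ok_def composable_append composable_Cons)
  have lin: "F (p @ Arrow x i (u + scl A k v) y # r) = F (p @ Arrow x i u y # r) + scl B k (F (p @ Arrow x i v y # r))"
    for p x i u v y r k
  proof (cases "ok (p @ Arrow x i u y # r)")
    case True
    then have "x \<in> obj A" "y \<in> obj A" by (auto simp: ok_def)
    note xy = this
    interpret \<pi>: Vector_Spaces.linear "scl A" "scl A" "\<pi> x y (i + 1)" by (rule \<pi>(2)[OF xy])
    have "\<pi> x y (i + 1) (u + scl A k v) = \<pi> x y (i + 1) u + scl A k (\<pi> x y (i + 1) v)"
      by (simp add: \<pi>.add \<pi>.scale)
    then have "wcochain f (map proj (p @ Arrow x i (u + scl A k v) y # r)) =
      wcochain f (map proj (p @ Arrow x i u y # r)) + scl B k (wcochain f (map proj (p @ Arrow x i v y # r)))"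
      using cochains_linear[OF f _ _ A, of "map proj p" x i "\<pi> x y (i + 1) u" y "map proj r" "\<pi> x y (i + 1) v" k]
        proj_words[OF True] \<pi>(1)[OF xy] by (simp add: proj_def)
    then show ?thesis using True ok_update[of p x i _ y r u] by (simp add: F_def)
  next
    case False
    then show ?thesis using ok_update[of p x i _ y r u] by (simp add: F_def)
  qed
  have add: "F (p @ Arrow x i (u + v) y # r) = F (p @ Arrow x i u y # r) + F (p @ Arrow x i v y # r)" for p x i u v y r
    using lin[of p x i u 1 v y r] by simp
  have "F (p @ Arrow x i (scl A k v) y # r) = scl B k (F (p @ Arrow x i v y # r))" for p x i k v y r
    using lin[of p x i 0 k v y r] add[of p x i 0 0 y r] by simp
  then have "wlinear (scl A) (scl B) F"
    unfolding wlinear_def wadditive_def by (auto simp: add intro!: additive.intro)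
  moreover have "F w = wcochain f w" if "w \<in> words A" "w \<noteq> []" for w
    using that proj_id[OF that(1)] by (auto simp: F_def ok_def words_def arrows_def)
  ultimately show thesis by (rule that)
qed

text \<open>Adjacent pieces share an object, so adjacent outputs share its image; the last
  hypothesis puts each output into its morphism space.\<close>

lemma outputs_words:
  assumes "outputs \<Phi> c k e w r" "w \<in> words A" "\<Phi> \<in> obj A \<rightarrow> obj B"
    and "\<And>p i j. p \<in> words A \<Longrightarrow> p \<noteq> [] \<Longrightarrow> i \<le> k \<Longrightarrow> j \<le> e \<Longrightarrow>
      c i j p \<in> hom B (\<Phi> (src (hd p))) (\<Phi> (tgt (last p))) (wdeg p - int j + 1)"
  shows "r \<in> words B"
  using assms
proof induction
  case (outputs_Cons p i k j e q r)
  then have w: "p \<in> words A" "q \<in> words A" "q \<noteq> [] \<Longrightarrow> tgt (last p) = src (hd q)"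
    by (auto simp: words_append)
  have "r \<in> words B" using outputs_Cons w by simp
  moreover have "out \<Phi> (- int j) (c i j) p \<in> arrows B"
    using outputs_Cons w words_ends[OF w(1)] by (auto simp: arrows_def)
  moreover have "r = [] \<or> \<Phi> (tgt (last p)) = src (hd r)"
    using outputs_ends[OF outputs_Cons.hyps(4)] w(3) by (cases "q = []") auto
  ultimately show ?case by (simp add: words_Cons)
qed simp

section \<open>Insertions and braces in terms of words\<close>

lemma winputs_subword: "take (length q) (drop (length p) (winputs (p @ q @ r))) = winputs q"
  by (simp add: winputs_def)

lemma wobjs_subword:
  assumes "composable (p @ q @ r)" "q \<noteq> []"
  shows "take (Suc (length q)) (drop (length p) (wobjs (p @ q @ r))) = wobjs q"
  using assms by (cases r) (auto simp: wobjs_def composable_append composable_Cons)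

lemma wcochain_insert:
  assumes "composable (p @ q @ r)" "q \<noteq> []"
  defines "xs \<equiv> wobjs (p @ q @ r)" and "vs \<equiv> winputs (p @ q @ r)"
  shows "f (take (Suc (length p)) xs @ drop (length p + length q) xs)
      (take (length p) vs @ [(total_deg (take (length q) (drop (length p) vs)) + 1,
          m (take (Suc (length q)) (drop (length p) xs)) (take (length q) (drop (length p) vs)))] @
        drop (length p + length q) vs) = wcochain f (p @ out id 1 (wcochain m) q # r)"
proof -
  have "take (Suc (length p)) xs @ drop (length p + length q) xs = wobjs (p @ out id 1 (wcochain m) q # r)"
    using assms(2) unfolding xs_def by (cases q; cases r) (auto simp: wobjs_def)
  moreover have "take (length p) vs @ [(total_deg (winputs q) + 1, m (wobjs q) (winputs q))] @
      drop (length p + length q) vs = winputs (p @ out id 1 (wcochain m) q # r)"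
    unfolding vs_def by (simp add: winputs_def out_def wcochain_def) (simp add: winputs_def[symmetric])
  ultimately show ?thesis
    unfolding xs_def vs_def winputs_subword wobjs_subword[OF assms(1,2)] by (simp add: wcochain_def)
qed

lemma take_take_drop: "take i w @ take l (drop i w) @ drop (i + l) w = w"
proof -
  have "drop (i + l) w = drop l (drop i w)" by (simp add: add.commute)
  then show ?thesis by (simp only: append_take_drop_id)
qed

lemma wcochain_gcomp:
  assumes "composable w"
  shows "wcochain (gcomp f 1 m) w = ins (wcochain m) (wcochain f) w"
  unfolding wcochain_def[of "gcomp f 1 m"] gcomp_def ins_def
proof (rule sum.reindex_bij_witness[of _ "\<lambda>(p, q, r). (length p, length q)"
      "\<lambda>(i, l). (take i w, take l (drop i w), drop (i + l) w)"], goal_cases)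
  case (2 z)
  then show ?case using take_take_drop by (auto simp: splits3_def)
next
  case (5 z)
  then obtain i l where z: "z = (i, l)" "1 \<le> l" "i + l \<le> length w" by auto
  define p where "p = take i w"
  define q where "q = take l (drop i w)"
  define r where "r = drop (i + l) w"
  have w: "w = p @ q @ r" by (simp only: p_def q_def r_def take_take_drop)
  have l: "length p = i" "length q = l" "q \<noteq> []" using z by (auto simp: p_def q_def)
  have "total_deg (take i (winputs w)) = wdeg p"
    using l by (simp add: w winputs_def total_deg_def wdeg_def comp_def)
  then show ?case
    using wcochain_insert[of p q r f m] assms l unfolding z prod.case p_def[symmetric] q_def[symmetric] r_def[symmetric]
    by (simp add: w)
qed (auto simp: splits3_def Suc_le_eq)

text \<open>Recursive form of \<open>brace\<close> for a fixed list of factors, halfway between the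
  index sums and \<open>pullback\<close>, which sums over all lists with given total indices. The
  sign moves all later factors past the first piece.\<close>

primrec tensor :: "('o \<Rightarrow> 'p) \<Rightarrow> (int \<times> (('o, 'v) arrow list \<Rightarrow> 'w)) list \<Rightarrow>
    (('p, 'w) arrow list \<Rightarrow> 'u::ab_group_add) \<Rightarrow> ('o, 'v) arrow list \<Rightarrow> 'u" where
  "tensor \<Phi> [] \<phi> w = (if w = [] then \<phi> [] else 0)"
| "tensor \<Phi> (F # fs) \<phi> w = (\<Sum>(p, q)\<in>splits w. ksign (sum_list (map fst fs) * wdeg p)
     (tensor \<Phi> fs (\<lambda>r. \<phi> (out \<Phi> (fst F) (snd F) p # r)) q))"

lemma finite_pieces [simp]: "finite (pieces n r)"
proof (rule finite_subset)
  show "pieces n r \<subseteq> {ns. set ns \<subseteq> {..n} \<and> length ns = r}"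
    using member_le_sum_list by (fastforce simp: pieces_def)
qed (simp add: finite_lists_length_eq)

lemma sum_pieces_Suc:
  "(\<Sum>ns\<in>pieces (length w) (Suc r). G ns) =
   (\<Sum>(p, q)\<in>splits w. \<Sum>ns\<in>pieces (length q) r. G (length p # ns))"
proof -
  have "(\<Sum>ns\<in>pieces (length w) (Suc r). G ns) =
    (\<Sum>(z, ns)\<in>(SIGMA z:splits w. pieces (length (snd z)) r). G (length (fst z) # ns))"
    by (rule sum.reindex_bij_witness[of _ "\<lambda>(z, ns). length (fst z) # ns"
          "\<lambda>ns. ((take (hd ns) w, drop (hd ns) w), tl ns)"])
       (auto simp: pieces_def splits_def length_Suc_conv)
  also have "\<dots> = (\<Sum>(p, q)\<in>splits w. \<Sum>ns\<in>pieces (length q) r. G (length p # ns))"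
    by (subst sum.Sigma [symmetric]) (auto simp: case_prod_unfold)
  finally show ?thesis .
qed

lemma piece_start_simps [simp]:
  "piece_start ns 0 = 0" "piece_start (n # ns) (Suc j) = n + piece_start ns j"
  by (auto simp: piece_start_def)

text \<open>Moving past one piece at a time, the j-th factor collects the degrees of all pieces in
  front of it, which is the degree of the prefix of length \<open>piece_start ns j\<close>.\<close>

lemma tensor_pieces:
  "tensor \<Phi> fs \<phi> w = (\<Sum>ns\<in>pieces (length w) (length fs).
     ksign (\<Sum>j<length fs. fst (fs ! j) * wdeg (take (piece_start ns j) w))
       (\<phi> (map (\<lambda>j. out \<Phi> (fst (fs ! j)) (snd (fs ! j)) (take (ns ! j) (drop (piece_start ns j) w)))
          [0..<length fs])))"
proof (induction fs arbitrary: \<phi> w)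
  case Nil
  have "pieces (length w) 0 = (if w = [] then {[]} else {})"
    by (auto simp: pieces_def)
  then show ?case by simp
next
  case (Cons F fs)
  have "tensor \<Phi> (F # fs) \<phi> w = (\<Sum>(p, q)\<in>splits w. \<Sum>ns\<in>pieces (length q) (length fs).
     ksign (\<Sum>j<Suc (length fs). fst ((F # fs) ! j) * wdeg (take (piece_start (length p # ns) j) w))
       (\<phi> (map (\<lambda>j. out \<Phi> (fst ((F # fs) ! j)) (snd ((F # fs) ! j))
            (take ((length p # ns) ! j) (drop (piece_start (length p # ns) j) w))) [0..<Suc (length fs)])))"
    unfolding tensor.simps Cons.IH ksign_sum ksign_ksign
  proof (intro sum.cong refl, clarify, intro sum.cong refl)
    fix p q ns assume "(p, q) \<in> splits w"
    then have w: "w = p @ q" by (auto simp: splits_def)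
    have "(\<Sum>j<Suc (length fs). fst ((F # fs) ! j) * wdeg (take (piece_start (length p # ns) j) w)) =
      sum_list (map fst fs) * wdeg p + (\<Sum>j<length fs. fst (fs ! j) * wdeg (take (piece_start ns j) q))"
      by (simp add: sum.lessThan_Suc_shift w sum_list_sum_nth atLeast0LessThan sum_distrib_left
          algebra_simps sum.distrib del: sum.lessThan_Suc)
    then show "ksign (sum_list (map fst fs) * wdeg p + (\<Sum>j<length fs. fst (fs ! j) * wdeg (take (piece_start ns j) q)))
        (\<phi> (out \<Phi> (fst F) (snd F) p # map (\<lambda>j. out \<Phi> (fst (fs ! j)) (snd (fs ! j))
           (take (ns ! j) (drop (piece_start ns j) q))) [0..<length fs])) =
      ksign (\<Sum>j<Suc (length fs). fst ((F # fs) ! j) * wdeg (take (piece_start (length p # ns) j) w))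
       (\<phi> (map (\<lambda>j. out \<Phi> (fst ((F # fs) ! j)) (snd ((F # fs) ! j))
            (take ((length p # ns) ! j) (drop (piece_start (length p # ns) j) w))) [0..<Suc (length fs)]))"
      by (simp add: map_upt_Suc w del: upt_Suc)
  qed
  then show ?case by (simp only: list.size(4) sum_pieces_Suc add_0_right add_Suc_right One_nat_def)
qed

lemma pieces_bounds:
  assumes "ns \<in> pieces n r"
  shows "j < r \<Longrightarrow> piece_start ns j + ns ! j \<le> n" "j < r \<Longrightarrow> 0 < ns ! j"
    "piece_start ns r = n" "j < r \<Longrightarrow> piece_start ns (Suc j) = piece_start ns j + ns ! j"
proof -
  have ns: "length ns = r" "0 \<notin> set ns" "sum_list ns = n" using assms by (auto simp: pieces_def)
  show s: "j < r \<Longrightarrow> piece_start ns (Suc j) = piece_start ns j + ns ! j"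
    using ns by (simp add: piece_start_def take_Suc_conv_app_nth)
  show "piece_start ns r = n" using ns by (simp add: piece_start_def)
  show "j < r \<Longrightarrow> 0 < ns ! j" using ns by (metis gr0I nth_mem)
  show "piece_start ns j + ns ! j \<le> n" if "j < r"
  proof -
    have "sum_list (take (Suc j) ns) + sum_list (drop (Suc j) ns) = n"
      unfolding sum_list_append[symmetric] using ns by simp
    then show ?thesis using s[OF that] by (simp add: piece_start_def)
  qed
qed

lemma wcochain_brace:
  assumes w: "composable w" "w \<noteq> []"
  shows "wcochain (brace \<Phi> h fs) w = tensor \<Phi> (map (\<lambda>(d, f). (d, wcochain f)) fs) (wcochain h) w"
  unfolding tensor_pieces wcochain_def[of "brace \<Phi> h fs"] brace_def length_map length_winputs
proof (rule sum.cong[OF refl])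
  fix ns assume ns: "ns \<in> pieces (length w) (length fs)"
  note b = pieces_bounds[OF ns]
  define n where "n = length fs"
  define P where "P = (\<lambda>j. take (ns ! j) (drop (piece_start ns j) w))"
  define R where "R = map (\<lambda>j. out \<Phi> (fst (fs ! j)) (wcochain (snd (fs ! j))) (P j)) [0..<n]"
  have n: "n \<noteq> 0" using ns w(2) by (auto simp: n_def pieces_def)
  have P: "w = take (piece_start ns j) w @ P j @ drop (piece_start ns j + ns ! j) w"
    "length (P j) = ns ! j" "P j \<noteq> []" "length (take (piece_start ns j) w) = piece_start ns j" if "j < n" for j
    using b(1,2)[of j] that take_take_drop[of "piece_start ns j" w "ns ! j"] by (auto simp: P_def n_def)
  have inp: "piece_in ns (winputs w) j = winputs (P j)" if "j < n" for j
    using winputs_subword[of "P j" "take (piece_start ns j) w" "drop (piece_start ns j + ns ! j) w"] P[OF that]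
    by (simp add: piece_in_def)
  have ob: "piece_obj ns (wobjs w) j = wobjs (P j)" if "j < n" for j
    using wobjs_subword[of "take (piece_start ns j) w" "P j" "drop (piece_start ns j + ns ! j) w"] P[OF that] w(1)
    by (simp add: piece_obj_def)
  have src: "src (hd (P j)) = wobjs w ! piece_start ns j" if "j < n" for j
  proof -
    have "piece_start ns j < length w" "0 < ns ! j" using b(1,2)[of j] that by (auto simp: n_def)
    then show ?thesis by (simp add: P_def hd_drop_conv_nth wobjs_nth[OF w])
  qed
  \<comment> \<open>The pieces exhaust \<open>w\<close>, so the last one ends where \<open>w\<close>
    ends; this supplies the final object of \<open>R\<close>.\<close>
  have tgt: "tgt (last (P (n - 1))) = wobjs w ! piece_start ns n"
  proof -
    have "piece_start ns (n - 1) + ns ! (n - 1) = length w"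
      using b(3) b(4)[of "n - 1"] n by (simp add: n_def)
    then have "last (P (n - 1)) = last w"
      using P(1,3)[of "n - 1"] n by (metis append_Nil2 diff_less drop_all last_appendR le_refl less_one not_gr_zero)
    then show ?thesis using b(3) by (simp add: n_def wobjs_def nth_append)
  qed
  have "map (\<lambda>j. \<Phi> (wobjs w ! piece_start ns j)) [0..<Suc n] = wobjs R"
    using n by (simp add: wobjs_def[of R]) (simp add: R_def src tgt[unfolded One_nat_def] last_map)
  moreover have "map (\<lambda>j. (total_deg (piece_in ns (winputs w) j) + fst (fs ! j),
        snd (fs ! j) (piece_obj ns (wobjs w) j) (piece_in ns (winputs w) j))) [0..<n] = winputs R"
    unfolding winputs_def[of R] by (simp add: R_def inp ob wcochain_def)
  moreover have "total_deg (take k (winputs w)) = wdeg (take k w)" for k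
    by (simp add: winputs_def total_deg_def wdeg_def take_map comp_def)
  moreover have R2: "map (\<lambda>j. out \<Phi> (fst (map (\<lambda>(d, f). (d, wcochain f)) fs ! j))
          (snd (map (\<lambda>(d, f). (d, wcochain f)) fs ! j)) (take (ns ! j) (drop (piece_start ns j) w))) [0..<length fs] = R"
    by (auto simp: R_def P_def n_def case_prod_unfold)
  ultimately show "ksign (\<Sum>j<length fs. fst (fs ! j) * total_deg (take (piece_start ns j) (winputs w)))
      (h (map (\<lambda>j. \<Phi> (wobjs w ! piece_start ns j)) [0..<Suc (length fs)])
        (map (\<lambda>j. (total_deg (piece_in ns (winputs w) j) + fst (fs ! j),
          snd (fs ! j) (piece_obj ns (wobjs w) j) (piece_in ns (winputs w) j))) [0..<length fs])) =
     ksign (\<Sum>j<length fs. fst (map (\<lambda>(d, f). (d, wcochain f)) fs ! j) * wdeg (take (piece_start ns j) w))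
       (wcochain h (map (\<lambda>j. out \<Phi> (fst (map (\<lambda>(d, f). (d, wcochain f)) fs ! j))
          (snd (map (\<lambda>(d, f). (d, wcochain f)) fs ! j)) (take (ns ! j) (drop (piece_start ns j) w))) [0..<length fs]))"
    unfolding R2 by (simp add: n_def wcochain_def[of h] case_prod_unfold del: upt_Suc)
qed

text \<open>Summing over the number of factors leaves a sum over all decompositions. Any bound n
  from \<open>length w\<close> on will do, as there are no more pieces than letters.\<close>

lemma sum_tensor_replicate:
  "length w \<le> n \<Longrightarrow> (\<Sum>r\<le>n. tensor \<Phi> (replicate r (0, c 0 0)) \<phi> w) = pullback \<Phi> c 0 0 \<phi> w"
proof (induction n arbitrary: w \<phi>)
  case 0
  then show ?case by (simp add: pullback_Nil)
next
  case (Suc n)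
  have "(\<Sum>r\<le>n. tensor \<Phi> (replicate (Suc r) (0, c 0 0)) \<phi> w) =
      (\<Sum>(p, q)\<in>splits w. \<Sum>r\<le>n. tensor \<Phi> (replicate r (0, c 0 0)) (\<lambda>r. \<phi> (out \<Phi> 0 (c 0 0) p # r)) q)"
    by (simp add: map_replicate_const sum_list_replicate case_prod_unfold) (rule sum.swap)
  also have "\<dots> = (\<Sum>(p, q)\<in>splits w. pullback \<Phi> c 0 0 (\<lambda>r. \<phi> (out \<Phi> 0 (c 0 0) p # r)) q)"
  proof (intro sum.cong refl, clarify)
    fix p q assume "(p, q) \<in> splits w"
    then have "length q \<le> n" using Suc.prems by (cases p) (auto simp: splits_def)
    then show "(\<Sum>r\<le>n. tensor \<Phi> (replicate r (0, c 0 0)) (\<lambda>r. \<phi> (out \<Phi> 0 (c 0 0) p # r)) q) =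
      pullback \<Phi> c 0 0 (\<lambda>r. \<phi> (out \<Phi> 0 (c 0 0) p # r)) q" by (rule Suc.IH)
  qed
  finally show ?case
    by (cases "w = []") (simp_all add: sum.atMost_Suc_shift pullback_Nil pullback_splits_0 del: sum.atMost_Suc)
qed

text \<open>The homotopy is the first factor, so that only copies of \<open>c 0 0\<close> follow, or
  a later one, which moves past the first piece.\<close>

lemma sum_tensor_replicate_update:
  "length w \<le> n \<Longrightarrow>
    (\<Sum>r\<le>n. \<Sum>j<r. tensor \<Phi> ((replicate r (0, c 0 0))[j := (- 1, c 0 1)]) \<phi> w) = pullback \<Phi> c 0 1 \<phi> w"
proof (induction n arbitrary: w \<phi>)
  case 0
  then show ?case by (simp add: pullback_Nil)
next
  case (Suc n)
  let ?a = "\<lambda>p r. \<phi> (out \<Phi> 0 (c 0 0) p # r)" and ?b = "\<lambda>p r. \<phi> (out \<Phi> (- 1) (c 0 1) p # r)"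
  let ?T = "\<lambda>\<phi> q r j. tensor \<Phi> ((replicate r (0, c 0 0))[j := (- 1, c 0 1)]) \<phi> q"
  have deg: "sum_list (map fst ((replicate r (0 :: int, c 0 0))[j := (- 1, c 0 1)])) = - 1" if "j < r" for r j
    using that by (simp add: upd_conv_take_nth_drop map_replicate_const sum_list_replicate)
  have "(\<Sum>j<Suc r. ?T \<phi> w (Suc r) j) = (\<Sum>(p, q)\<in>splits w.
      tensor \<Phi> (replicate r (0, c 0 0)) (?b p) q + (\<Sum>j<r. ksign (- wdeg p) (?T (?a p) q r j)))" for r
  proof -
    have "(\<Sum>j<r. ?T \<phi> w (Suc r) (Suc j)) = (\<Sum>j<r. \<Sum>(p, q)\<in>splits w. ksign (- wdeg p) (?T (?a p) q r j))"
      by (simp add: deg del: One_nat_def)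
    also have "\<dots> = (\<Sum>(p, q)\<in>splits w. \<Sum>j<r. ksign (- wdeg p) (?T (?a p) q r j))"
      unfolding case_prod_unfold by (rule sum.swap)
    finally show ?thesis
      by (simp add: sum.lessThan_Suc_shift sum.distrib case_prod_unfold map_replicate_const sum_list_replicate del: sum.lessThan_Suc)
  qed
  then have "(\<Sum>r\<le>n. \<Sum>j<Suc r. ?T \<phi> w (Suc r) j) = (\<Sum>(p, q)\<in>splits w. \<Sum>r\<le>n.
      tensor \<Phi> (replicate r (0, c 0 0)) (?b p) q + (\<Sum>j<r. ksign (- wdeg p) (?T (?a p) q r j)))"
    unfolding case_prod_unfold by (simp only:) (rule sum.swap)
  also have "\<dots> = (\<Sum>(p, q)\<in>splits w. (\<Sum>r\<le>n. tensor \<Phi> (replicate r (0, c 0 0)) (?b p) q) +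
      ksign (- wdeg p) (\<Sum>r\<le>n. \<Sum>j<r. ?T (?a p) q r j))"
    by (simp only: sum.distrib ksign_sum)
  also have "\<dots> = (\<Sum>(p, q)\<in>splits w. pullback \<Phi> c 0 0 (?b p) q + ksign (wdeg p) (pullback \<Phi> c 0 1 (?a p) q))"
  proof (intro sum.cong refl, clarify)
    fix p q assume "(p, q) \<in> splits w"
    then have "length q \<le> n" using Suc.prems by (cases p) (auto simp: splits_def)
    then show "(\<Sum>r\<le>n. tensor \<Phi> (replicate r (0, c 0 0)) (?b p) q) +
      ksign (- wdeg p) (\<Sum>r\<le>n. \<Sum>j<r. ?T (?a p) q r j) =
      pullback \<Phi> c 0 0 (?b p) q + ksign (wdeg p) (pullback \<Phi> c 0 1 (?a p) q)"
      using Suc.IH sum_tensor_replicate by (simp add: ksign_def)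
  qed
  also have "\<dots> = pullback \<Phi> c 0 1 \<phi> w"
    by (cases "w = []") (simp_all add: pullback_Nil pullback_splits_0 add.commute)
  finally show ?case by (simp add: sum.atMost_Suc_shift del: sum.atMost_Suc sum.lessThan_Suc)
qed

lemma wcochain_ccomp:
  assumes w: "composable w" "w \<noteq> []" and c: "c 0 0 = wcochain f"
  shows "wcochain (ccomp \<Phi> h f) w = pullback \<Phi> c 0 0 (wcochain h) w"
proof -
  have "wcochain (ccomp \<Phi> h f) w = (\<Sum>r = 1..length w. tensor \<Phi> (replicate r (0, c 0 0)) (wcochain h) w)"
    using wcochain_brace[OF w, of \<Phi> h] by (simp add: ccomp_def wcochain_def[of "ccomp \<Phi> h f"] wcochain_def[of "brace \<Phi> h _"] c)
  \<comment> \<open>The summand \<open>r = 0\<close> may be added: on a nonempty word it is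
    0.\<close>
  also have "\<dots> = (\<Sum>r\<le>length w. tensor \<Phi> (replicate r (0, c 0 0)) (wcochain h) w)"
    using w(2) by (intro sum.mono_neutral_left) (auto simp: not_le)
  also have "\<dots> = pullback \<Phi> c 0 0 (wcochain h) w"
    by (rule sum_tensor_replicate) simp
  finally show ?thesis .
qed

lemma wcochain_insert_sum:
  assumes w: "composable w" "w \<noteq> []" and c: "c 0 0 = wcochain a" "c 0 1 = wcochain b"
  shows "wcochain (insert_sum \<Phi> m a b) w = pullback \<Phi> c 0 1 (wcochain m) w"
proof -
  have "wcochain (insert_sum \<Phi> m a b) w =
      (\<Sum>r = 1..length w. \<Sum>j<r. tensor \<Phi> ((replicate r (0, c 0 0))[j := (- 1, c 0 1)]) (wcochain m) w)"
    using wcochain_brace[OF w, of \<Phi> m] c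
    by (simp add: insert_sum_def wcochain_def[of "insert_sum \<Phi> m a b"] wcochain_def[of "brace \<Phi> m _"] map_update)
  also have "\<dots> = (\<Sum>r\<le>length w. \<Sum>j<r. tensor \<Phi> ((replicate r (0, c 0 0))[j := (- 1, c 0 1)]) (wcochain m) w)"
    by (intro sum.mono_neutral_left) (auto simp: not_le)
  also have "\<dots> = pullback \<Phi> c 0 1 (wcochain m) w"
    by (rule sum_tensor_replicate_update) simp
  finally show ?thesis .
qed

section \<open>Polynomial cochains\<close>

text \<open>The index set in \<open>peval\<close> varies with the argument; a fixed range makes
  values at different arguments comparable.\<close>

lemma peval_word:
  assumes B: "vector_space (scl B)" and N: "\<And>k. k > N \<Longrightarrow> wcochain (a k) w = 0"
  shows "wcochain (peval B a t) w = (\<Sum>k\<le>N. scl B (t ^ k) (wcochain (a k) w))"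
proof -
  have "{k. wcochain (a k) w \<noteq> 0} \<subseteq> {..N}" using N by (auto simp flip: not_less)
  then have "(\<Sum>k | wcochain (a k) w \<noteq> 0. scl B (t ^ k) (wcochain (a k) w)) =
      (\<Sum>k\<le>N. scl B (t ^ k) (wcochain (a k) w))"
    by (intro sum.mono_neutral_left) (auto simp: additive.zero[OF additive_scale[OF B]])
  then show ?thesis by (simp add: wcochain_def peval_def)
qed

text \<open>For \<open>s = 1\<close>, \<open>taylor t 1 (Suc k)\<close> is (k + 1) t^k, the factor
  produced by \<open>pderivative\<close>. After the index shift the term at 0 has coefficient 0 and
  the term at N + 1 vanishes by the bound.\<close>

lemma peval_taylor:
  assumes B: "vector_space (scl B)" and N: "\<And>k. k > N \<Longrightarrow> wcochain (a k) w = 0" and s: "s \<le> 1"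
  shows "wcochain (peval B ((pderivative B ^^ s) a) t) w = (\<Sum>k\<le>N. scl B (taylor t s k) (wcochain (a k) w))"
proof (cases s)
  case 0
  then show ?thesis using peval_word[OF B N] by (simp add: taylor_def)
next
  case (Suc s')
  then have s1: "s = 1" using s by simp
  have d: "wcochain (pderivative B a k) w = scl B (of_nat (Suc k)) (wcochain (a (Suc k)) w)" for k
    by (simp add: wcochain_def pderivative_def)
  have "wcochain (peval B (pderivative B a) t) w =
      (\<Sum>k\<le>N. scl B (t ^ k) (wcochain (pderivative B a k) w))"
    using N by (intro peval_word B) (simp add: d additive.zero[OF additive_scale[OF B]])
  also have "\<dots> = (\<Sum>k\<le>N. scl B (taylor t 1 (Suc k)) (wcochain (a (Suc k)) w))"
    by (simp add: d scale_scale[OF B] taylor_def mult.commute)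
  also have "\<dots> = (\<Sum>k\<le>Suc N. scl B (taylor t 1 k) (wcochain (a k) w))"
    by (simp add: sum.atMost_Suc_shift taylor_zero scale_zero[OF B] del: sum.atMost_Suc)
  also have "\<dots> = (\<Sum>k\<le>N. scl B (taylor t 1 k) (wcochain (a k) w))"
    by (simp add: N additive.zero[OF additive_scale[OF B]])
  finally show ?thesis by (simp add: s1)
qed

text \<open>The degree in t is bounded only tuple by tuple. Subwords of a word along
  \<open>xs\<close> have their objects in \<open>xs\<close> and at most its length; there are
  finitely many such tuples, and the sum of their bounds serves all of them.\<close>

lemma poly_cochains_bound:
  assumes a: "a \<in> poly_cochains A B \<Phi> d"
  shows "\<exists>N. \<forall>w\<in>words A. w \<noteq> [] \<longrightarrow> set (wobjs w) \<subseteq> set xs \<longrightarrow> length (wobjs w) \<le> length xs \<longrightarrow>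
    (\<forall>k>N. wcochain (a k) w = 0)"
proof -
  define Y where "Y = {ys \<in> obj_tuples A. set ys \<subseteq> set xs \<and> length ys \<le> length xs}"
  have "finite Y"
    unfolding Y_def by (rule finite_subset[OF _ finite_lists_length_le[of "set xs" "length xs"]]) auto
  have "\<forall>ys\<in>obj_tuples A. \<exists>N. \<forall>k>N. \<forall>vs\<in>inputs A ys. a k ys vs = 0"
    using a by (simp add: poly_cochains_def)
  then obtain N where N: "\<And>ys k vs. ys \<in> obj_tuples A \<Longrightarrow> k > N ys \<Longrightarrow> vs \<in> inputs A ys \<Longrightarrow> a k ys vs = 0"
    by metis
  show ?thesis
  proof (rule exI[of _ "\<Sum>ys\<in>Y. N ys"], intro ballI impI allI)
    fix w k assume w: "w \<in> words A" "w \<noteq> []" "set (wobjs w) \<subseteq> set xs" "length (wobjs w) \<le> length xs"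
      and k: "(\<Sum>ys\<in>Y. N ys) < k"
    then have "wobjs w \<in> Y" using words_wobjs[OF w(1,2)] by (simp add: Y_def)
    then have "N (wobjs w) \<le> (\<Sum>ys\<in>Y. N ys)"
      using \<open>finite Y\<close> by (intro member_le_sum) auto
    then show "wcochain (a k) w = 0"
      using N words_wobjs[OF w(1,2)] k by (simp add: wcochain_def)
  qed
qed

lemma wobjs_subword_bounds:
  assumes "composable (p @ q @ r)" "q \<noteq> []"
  shows "set (wobjs q) \<subseteq> set (wobjs (p @ q @ r))" "length (wobjs q) \<le> length (wobjs (p @ q @ r))"
proof -
  show "set (wobjs q) \<subseteq> set (wobjs (p @ q @ r))"
    unfolding wobjs_subword[OF assms, symmetric] by (meson order_trans set_drop_subset set_take_subset)
qed simp

text \<open>Along one tuple the value is a finite combination of cochains. Inputs differing in one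
  vector have the same tuple, hence share a bound N, and linearity is inherited term by
  term.\<close>

lemma peval_cochains:
  assumes a: "a \<in> poly_cochains A B \<Phi> d" and A: "graded_quiver A" and B: "graded_quiver B"
    and \<Phi>: "\<Phi> \<in> obj A \<rightarrow> obj B"
  shows "peval B a t \<in> cochains A B \<Phi> d"
proof (rule cochainsI[OF A])
  interpret B: vector_space "scl B" using B by (simp add: graded_quiver_def)
  show vs: "vector_space (scl B)" by (fact B.vector_space_axioms)
  have ak: "a k \<in> cochains A B \<Phi> d" for k using a by (simp add: poly_cochains_def)
  have ev: "\<exists>N. \<forall>w\<in>words A. w \<noteq> [] \<longrightarrow> wobjs w = xs \<longrightarrow>
      wcochain (peval B a t) w = (\<Sum>k\<le>N. scl B (t ^ k) (wcochain (a k) w))" for xs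
  proof -
    obtain N where N: "\<And>w k. w \<in> words A \<Longrightarrow> w \<noteq> [] \<Longrightarrow> wobjs w = xs \<Longrightarrow> k > N \<Longrightarrow> wcochain (a k) w = 0"
      using poly_cochains_bound[OF a, of xs] by blast
    show ?thesis
      by (intro exI[of _ N] ballI impI peval_word vs N)
  qed
  show "wcochain (peval B a t) w \<in> hom B (\<Phi> (src (hd w))) (\<Phi> (tgt (last w))) (wdeg w + d + 1)"
    if w: "w \<in> words A" "w \<noteq> []" for w
  proof -
    have "B.subspace (hom B (\<Phi> (src (hd w))) (\<Phi> (tgt (last w))) (wdeg w + d + 1))"
      using B words_ends[OF w] \<Phi> by (auto simp: graded_quiver_def)
    then show ?thesis
      using ev[of "wobjs w"] w cochainsD[OF ak w] by (auto intro!: B.subspace_sum B.subspace_scale)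
  qed
  show "wcochain (peval B a t) (p @ Arrow x i (u + scl A \<kappa> v) y # r) =
      wcochain (peval B a t) (p @ Arrow x i u y # r) + scl B \<kappa> (wcochain (peval B a t) (p @ Arrow x i v y # r))"
    if w: "p @ Arrow x i u y # r \<in> words A" and v: "v \<in> hom A x y (i + 1)" for p x i u v y r \<kappa>
  proof -
    obtain N where N: "\<And>w. w \<in> words A \<Longrightarrow> w \<noteq> [] \<Longrightarrow> wobjs w = wobjs (p @ Arrow x i u y # r) \<Longrightarrow>
      wcochain (peval B a t) w = (\<Sum>k\<le>N. scl B (t ^ k) (wcochain (a k) w))"
      using ev[of "wobjs (p @ Arrow x i u y # r)"] by blast
    interpret A: vector_space "scl A" using A by (simp add: graded_quiver_def)
    have xy: "x \<in> obj A" "y \<in> obj A" "u \<in> hom A x y (i + 1)"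
      using w by (auto simp: words_append words_Cons arrows_def)
    then have "A.subspace (hom A x y (i + 1))" using A by (simp add: graded_quiver_def)
    then have "u + scl A \<kappa> v \<in> hom A x y (i + 1)"
      using xy v by (intro A.subspace_add A.subspace_scale)
    then have "p @ Arrow x i z y # r \<in> words A" if "z \<in> {u, v, u + scl A \<kappa> v}" for z
      using w v that by (auto simp: words_append words_Cons arrows_def)
    then have ev': "wcochain (peval B a t) (p @ Arrow x i z y # r) =
        (\<Sum>k\<le>N. scl B (t ^ k) (wcochain (a k) (p @ Arrow x i z y # r)))"
      if "z \<in> {u, v, u + scl A \<kappa> v}" for z
      using that by (intro N wobjs_update) auto
    show ?thesis
      by (simp add: ev' cochains_linear[OF ak w v A] B.scale_right_distrib sum.distrib
          B.scale_sum_right mult.commute)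
  qed
qed

section \<open>Composition with an $A_\infty$-morphism\<close>

lemma ins_words:
  assumes m: "m \<in> cochains Q Q id 1" and w: "p @ q @ r \<in> words Q" "q \<noteq> []"
  shows "p @ out id 1 (wcochain m) q # r \<in> words Q"
proof -
  have q: "q \<in> words Q" using w by (simp add: words_append)
  have "out id 1 (wcochain m) q \<in> arrows Q"
    using cochainsD[OF m q w(2)] words_ends[OF q w(2)] by (simp add: arrows_def)
  then show ?thesis
    using w by (cases r) (auto simp: words_append words_Cons)
qed

text \<open>\<open>H\<close> and \<open>M\<close> are multilinear extensions of h and
  \<open>mC\<close>, the two functions through whose slots sums have to be moved.\<close>

locale ainf_composition =
  fixes A :: "('k::field, 'a, 'u::ab_group_add) gquiver"
    and B :: "('k, 'b, 'v::ab_group_add) gquiver"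
    and C :: "('k, 'c, 'w::ab_group_add) gquiver"
    and mA :: "('a, 'u, 'u) cochain" and mB :: "('b, 'v, 'v) cochain" and mC :: "('c, 'w, 'w) cochain"
    and \<Phi> :: "'a \<Rightarrow> 'b" and \<Psi> :: "'b \<Rightarrow> 'c"
    and h :: "('b, 'v, 'w) cochain"
    and H :: "('b, 'v) arrow list \<Rightarrow> 'w" and M :: "('c, 'w) arrow list \<Rightarrow> 'w"
  assumes A: "ainf_category A mA" and B: "ainf_category B mB" and C: "ainf_category C mC"
    and \<Phi>: "\<Phi> \<in> obj A \<rightarrow> obj B" and h: "ainf_morphism B mB C mC \<Psi> h"
    and H: "wlinear (scl B) (scl C) H" "\<And>w. w \<in> words B \<Longrightarrow> w \<noteq> [] \<Longrightarrow> H w = wcochain h w"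
    and M: "wlinear (scl C) (scl C) M" "\<And>w. w \<in> words C \<Longrightarrow> w \<noteq> [] \<Longrightarrow> M w = wcochain mC w"
begin

lemma quivers: "graded_quiver A" "graded_quiver B" "graded_quiver C"
  and mA: "mA \<in> cochains A A id 1" and mB: "mB \<in> cochains B B id 1" and mC: "mC \<in> cochains C C id 1"
  and hc: "h \<in> cochains B C \<Psi> 0" and \<Psi>: "\<Psi> \<in> obj B \<rightarrow> obj C"
  using A B C h by (auto simp: ainf_category_def ainf_morphism_def)

lemma vsB: "vector_space (scl B)" and vsC: "vector_space (scl C)"
  using quivers by (auto simp: graded_quiver_def)

lemma outputs_B:
  assumes w: "w \<in> words A" and g: "\<And>i j. i \<le> k \<Longrightarrow> j \<le> e \<Longrightarrow> g i j \<in> cochains A B \<Phi> (- int j)"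
    and r: "outputs \<Phi> (\<lambda>i j. wcochain (g i j)) k e w r"
  shows "r \<in> words B"
  using outputs_words[OF r w \<Phi>] cochainsD[OF g] by simp

lemma pullback_h:
  assumes w: "w \<in> words A" "w \<noteq> []" and g: "\<And>i j. i \<le> k \<Longrightarrow> j \<le> e \<Longrightarrow> g i j \<in> cochains A B \<Phi> (- int j)"
  shows "pullback \<Phi> (\<lambda>i j. wcochain (g i j)) k e H w = pullback \<Phi> (\<lambda>i j. wcochain (g i j)) k e (wcochain h) w"
proof (rule pullback_cong)
  fix r assume r: "outputs \<Phi> (\<lambda>i j. wcochain (g i j)) k e w r"
  show "H r = wcochain h r"
    using outputs_B[OF w(1) g r] outputs_ends[OF r] w(2) by (intro H(2)) auto
qed

lemma pullback_value:
  assumes w: "w \<in> words A" "w \<noteq> []" and g: "\<And>i j. i \<le> k \<Longrightarrow> j \<le> e \<Longrightarrow> g i j \<in> cochains A B \<Phi> (- int j)"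
  shows "pullback \<Phi> (\<lambda>i j. wcochain (g i j)) k e (wcochain h) w \<in>
    hom C ((\<Psi> \<circ> \<Phi>) (src (hd w))) ((\<Psi> \<circ> \<Phi>) (tgt (last w))) (wdeg w - int e + 1)"
proof (rule pullback_subspace[OF vsC])
  show "module.subspace (scl C) (hom C ((\<Psi> \<circ> \<Phi>) (src (hd w))) ((\<Psi> \<circ> \<Phi>) (tgt (last w))) (wdeg w - int e + 1))"
    using words_ends[OF w] funcset_mem[OF \<Psi> funcset_mem[OF \<Phi>]] quivers(3) by (auto simp: graded_quiver_def)
  fix r assume r: "outputs \<Phi> (\<lambda>i j. wcochain (g i j)) k e w r"
  then have "r \<noteq> []" using w(2) by (auto dest: outputs_ends)
  with cochainsD[OF hc outputs_B[OF w(1) g r]] outputs_ends[OF r] w(2)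
  show "wcochain h r \<in> hom C ((\<Psi> \<circ> \<Phi>) (src (hd w))) ((\<Psi> \<circ> \<Phi>) (tgt (last w))) (wdeg w - int e + 1)"
    by simp
qed

lemma pullback_cochains:
  assumes F: "\<And>w. w \<in> words A \<Longrightarrow> w \<noteq> [] \<Longrightarrow> wcochain F w = pullback \<Phi> (\<lambda>i j. wcochain (g i j)) k e H w"
    and g: "\<And>i j. i \<le> k \<Longrightarrow> j \<le> e \<Longrightarrow> g i j \<in> cochains A B \<Phi> (- int j)"
  shows "F \<in> cochains A C (\<Psi> \<circ> \<Phi>) (- int e)"
proof (rule cochainsI[OF quivers(1) vsC])
  show "wcochain F w \<in> hom C ((\<Psi> \<circ> \<Phi>) (src (hd w))) ((\<Psi> \<circ> \<Phi>) (tgt (last w))) (wdeg w + - int e + 1)"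
    if w: "w \<in> words A" "w \<noteq> []" for w
    using pullback_value[OF w g] pullback_h[OF w g] F[OF w] by simp
  show "wcochain F (p @ Arrow x i (u + scl A \<kappa> v) y # r) =
      wcochain F (p @ Arrow x i u y # r) + scl C \<kappa> (wcochain F (p @ Arrow x i v y # r))"
    if w: "p @ Arrow x i u y # r \<in> words A" and v: "v \<in> hom A x y (i + 1)" for p x i u v y r \<kappa>
  proof -
    interpret A: vector_space "scl A" using quivers(1) by (simp add: graded_quiver_def)
    have xy: "x \<in> obj A" "y \<in> obj A" "u \<in> hom A x y (i + 1)"
      using w by (auto simp: words_append words_Cons arrows_def)
    then have "A.subspace (hom A x y (i + 1))" using quivers(1) by (simp add: graded_quiver_def)
    then have "u + scl A \<kappa> v \<in> hom A x y (i + 1)"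
      using xy v by (intro A.subspace_add A.subspace_scale)
    then have ok: "p @ Arrow x i z y # r \<in> words A" if "z \<in> {u, v, u + scl A \<kappa> v}" for z
      using w v that by (auto simp: words_append words_Cons arrows_def)
    have "pullback \<Phi> (\<lambda>i j. wcochain (g i j)) k e H (p @ Arrow x i (u + scl A \<kappa> v) y # r) =
      pullback \<Phi> (\<lambda>i j. wcochain (g i j)) k e H (p @ Arrow x i u y # r) +
      scl C \<kappa> (pullback \<Phi> (\<lambda>i j. wcochain (g i j)) k e H (p @ Arrow x i v y # r))"
    proof (rule pullback_linear[OF vsC H(1)])
      fix q q' s s' i' j assume s: "p = q' @ q" "r = s @ s'" and ij: "i' \<le> k" "j \<le> e"
      have "q @ Arrow x i u y # s \<in> words A"
        using w unfolding s by (auto simp: words_append words_Cons hd_append split: if_splits)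
      from cochains_linear[OF g[OF ij] this v quivers(1)]
      show "wcochain (g i' j) (q @ Arrow x i (u + scl A \<kappa> v) y # s) =
          wcochain (g i' j) (q @ Arrow x i u y # s) + scl B \<kappa> (wcochain (g i' j) (q @ Arrow x i v y # s))" .
    qed
    then show ?thesis by (simp add: F ok)
  qed
qed

text \<open>The morphism equation of h, read on words. Insertions of \<open>mB\<close> lead to
  genuine words, where \<open>H\<close> and h agree.\<close>

lemma ins_H:
  assumes r: "r \<in> words B" "r \<noteq> []"
  shows "ins (wcochain mB) H r = pullback \<Psi> (\<lambda>_ _. wcochain h) 0 0 (wcochain mC) r"
proof -
  have c: "composable r" using r by (simp add: words_def)
  have "ins (wcochain mB) H r = ins (wcochain mB) (wcochain h) r"
  proof (rule ins_cong)
    fix p q s assume s: "r = p @ q @ s" "q \<noteq> []"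
    have "p @ out id 1 (wcochain mB) q # s \<in> words B" using ins_words[OF mB] r s by simp
    then show "H (p @ out id 1 (wcochain mB) q # s) = wcochain h (p @ out id 1 (wcochain mB) q # s)"
      by (intro H(2)) auto
  qed
  also have "\<dots> = wcochain (gcomp h 1 mB) r" using c by (simp add: wcochain_gcomp)
  also have "\<dots> = wcochain (ccomp \<Psi> mC h) r"
    using h r by (simp add: ainf_morphism_def cochain_eq_iff)
  also have "\<dots> = pullback \<Psi> (\<lambda>_ _. wcochain h) 0 0 (wcochain mC) r"
    using c r by (intro wcochain_ccomp) auto
  finally show ?thesis .
qed

text \<open>Combines the equation for h with functoriality: \<open>mB\<close> inside h becomes
  \<open>mC\<close> outside, applied to the pullbacks of h. \<open>pullback_pullback\<close>
  requires a multilinear outer function, hence the detour through \<open>M\<close>.\<close>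

lemma pullback_ins_H:
  assumes w: "w \<in> words A" "w \<noteq> []" and g: "\<And>j. j \<le> e \<Longrightarrow> g 0 j \<in> cochains A B \<Phi> (- int j)"
  shows "pullback \<Phi> (\<lambda>i j. wcochain (g i j)) 0 e (ins (wcochain mB) H) w =
    pullback (\<Psi> \<circ> \<Phi>) (\<lambda>i j. pullback \<Phi> (\<lambda>i j. wcochain (g i j)) i j (wcochain h)) 0 e (wcochain mC) w"
proof -
  let ?c = "\<lambda>i j. wcochain (g i j)"
  have g': "g i j \<in> cochains A B \<Phi> (- int j)" if "i \<le> 0" "j \<le> e" for i j
    using g that by simp
  have "pullback \<Phi> ?c 0 e (ins (wcochain mB) H) w = pullback \<Phi> ?c 0 e (pullback \<Psi> (\<lambda>_ _. wcochain h) 0 0 M) w"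
  proof (rule pullback_cong)
    fix r assume r: "outputs \<Phi> ?c 0 e w r"
    have rB: "r \<in> words B" "r \<noteq> []" using outputs_B[OF w(1) g' r] outputs_ends[OF r] w(2) by auto
    have "pullback \<Psi> (\<lambda>_ _. wcochain h) 0 0 (wcochain mC) r = pullback \<Psi> (\<lambda>_ _. wcochain h) 0 0 M r"
    proof (rule pullback_cong)
      fix s assume s: "outputs \<Psi> (\<lambda>_ _. wcochain h) 0 0 r s"
      have "s \<in> words C" using outputs_words[OF s rB(1) \<Psi>] cochainsD[OF hc] by simp
      then show "wcochain mC s = M s" using outputs_ends[OF s] rB(2) by (intro M(2)[symmetric]) auto
    qed
    then show "ins (wcochain mB) H r = pullback \<Psi> (\<lambda>_ _. wcochain h) 0 0 M r"
      using ins_H[OF rB] by simp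
  qed
  also have "\<dots> = pullback (\<Psi> \<circ> \<Phi>) (\<lambda>i j. pullback \<Phi> ?c i j (wcochain h)) 0 e M w"
    by (rule pullback_pullback[OF wlinear_additive[OF M(1)]])
  also have "\<dots> = pullback (\<Psi> \<circ> \<Phi>) (\<lambda>i j. pullback \<Phi> ?c i j (wcochain h)) 0 e (wcochain mC) w"
  proof (rule pullback_cong)
    fix s assume s: "outputs (\<Psi> \<circ> \<Phi>) (\<lambda>i j. pullback \<Phi> ?c i j (wcochain h)) 0 e w s"
    have "\<Psi> \<circ> \<Phi> \<in> obj A \<rightarrow> obj C" using \<Phi> \<Psi> by auto
    moreover have "pullback \<Phi> ?c i j (wcochain h) p \<in>
        hom C ((\<Psi> \<circ> \<Phi>) (src (hd p))) ((\<Psi> \<circ> \<Phi>) (tgt (last p))) (wdeg p - int j + 1)"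
      if "p \<in> words A" "p \<noteq> []" "i \<le> 0" "j \<le> e" for p i j
      using that by (intro pullback_value g') auto
    ultimately have "s \<in> words C" using outputs_words[OF s w(1)] by blast
    then show "M s = wcochain mC s" using outputs_ends[OF s] w(2) by (intro M(2)) auto
  qed
  finally show ?thesis .
qed

lemma morphism_words:
  assumes "ainf_morphism A mA B mB \<Phi> f" "c 0 0 = wcochain f" "w \<in> words A" "w = p @ q @ r" "q \<noteq> []"
  shows "pullback \<Phi> c 0 0 (wcochain mB) q = ins (wcochain mA) (c 0 0) q"
proof -
  have q: "q \<in> words A" "composable q"
    using words_subword[OF assms(3,4)] by (auto simp: words_def)
  have "wcochain (gcomp f 1 mA) q = wcochain (ccomp \<Phi> mB f) q"
    using assms(1,5) q by (simp add: ainf_morphism_def cochain_eq_iff)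
  then show ?thesis
    using q assms by (simp add: wcochain_gcomp wcochain_ccomp[of q c f])
qed

lemma wcochain_ccomp_h:
  assumes w: "w \<in> words A" "w \<noteq> []" and f: "f \<in> cochains A B \<Phi> 0"
  shows "wcochain (ccomp \<Phi> h f) w = pullback \<Phi> (\<lambda>i j. wcochain f) 0 0 H w"
  using w f pullback_h[OF w, of 0 0 "\<lambda>_ _. f"] by (simp add: wcochain_ccomp words_def)

text \<open>The operation on the inputs moves through f by its morphism equation and becomes
  \<open>mB\<close>, then through h and becomes \<open>mC\<close>. This is needed for both ends and
  for every t of the composite path.\<close>

lemma ccomp_morphism:
  assumes f: "ainf_morphism A mA B mB \<Phi> f"
  shows "ainf_morphism A mA C mC (\<Psi> \<circ> \<Phi>) (ccomp \<Phi> h f)"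
  unfolding ainf_morphism_def cochain_eq_iff
proof (intro conjI ballI impI)
  have fc: "f \<in> cochains A B \<Phi> 0" using f by (simp add: ainf_morphism_def)
  show "\<Psi> \<circ> \<Phi> \<in> obj A \<rightarrow> obj C" using \<Phi> \<Psi> by auto
  show "ccomp \<Phi> h f \<in> cochains A C (\<Psi> \<circ> \<Phi>) 0"
    using pullback_cochains[of "ccomp \<Phi> h f" "\<lambda>_ _. f" 0 0] wcochain_ccomp_h fc by simp
  fix w assume w: "w \<in> words A" "w \<noteq> []"
  then have c: "composable w" by (simp add: words_def)
  let ?c = "\<lambda>i j :: nat. wcochain f"
  have "wcochain (gcomp (ccomp \<Phi> h f) 1 mA) w = ins (wcochain mA) (wcochain (ccomp \<Phi> h f)) w"
    using c by (rule wcochain_gcomp)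
  also have "\<dots> = ins (wcochain mA) (pullback \<Phi> ?c 0 0 H) w"
  proof (rule ins_cong)
    fix p q r assume "w = p @ q @ r" "q \<noteq> []"
    then have "p @ out id 1 (wcochain mA) q # r \<in> words A" using ins_words[OF mA] w by simp
    then show "wcochain (ccomp \<Phi> h f) (p @ out id 1 (wcochain mA) q # r) =
      pullback \<Phi> ?c 0 0 H (p @ out id 1 (wcochain mA) q # r)"
      using fc by (intro wcochain_ccomp_h) auto
  qed
  also have "\<dots> = pullback \<Phi> ?c 0 0 (ins (wcochain mB) H) w"
    using morphism_words[OF f _ w(1)] by (intro pullback_ins_commute[symmetric] wlinear_additive[OF H(1)]) auto
  also have "\<dots> = pullback (\<Psi> \<circ> \<Phi>) (\<lambda>i j. pullback \<Phi> ?c i j (wcochain h)) 0 0 (wcochain mC) w"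
    using fc by (intro pullback_ins_H[OF w]) auto
  also have "\<dots> = pullback (\<Psi> \<circ> \<Phi>) (\<lambda>i j. wcochain (ccomp \<Phi> h f)) 0 0 (wcochain mC) w"
  proof (rule pullback_family_cong)
    fix p q r and i j :: nat assume "w = p @ q @ r" "q \<noteq> []" "i \<le> 0" "j \<le> 0"
    then show "pullback \<Phi> ?c i j (wcochain h) q = wcochain (ccomp \<Phi> h f) q"
      using words_subword[OF w(1)] by (subst wcochain_ccomp[where c = ?c]) (auto simp: words_def)
  qed
  also have "\<dots> = wcochain (ccomp (\<Psi> \<circ> \<Phi>) mC (ccomp \<Phi> h f)) w"
    using c w by (simp add: wcochain_ccomp)
  finally show "wcochain (gcomp (ccomp \<Phi> h f) 1 mA) w = wcochain (ccomp (\<Psi> \<circ> \<Phi>) mC (ccomp \<Phi> h f)) w" .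
qed

end

lemma wcochain_word:
  "w \<in> words A \<Longrightarrow> w \<noteq> [] \<Longrightarrow> wcochain (\<lambda>xs vs. P (word xs vs)) w = P w"
  by (simp add: wcochain_def word_wobjs words_def)

text \<open>The value of the composite path at t agrees with h o a(t) only on genuine inputs. The
  morphism equation evaluates it only there, as insertions of \<open>mA\<close> stay among genuine
  words.\<close>

lemma ainf_morphism_cong:
  assumes f: "ainf_morphism A mA B mB \<Phi> f" and mA: "mA \<in> cochains A A id 1"
    and f': "f' \<in> cochains A B \<Phi> 0" "cochain_eq A f' f"
  shows "ainf_morphism A mA B mB \<Phi> f'"
  unfolding ainf_morphism_def cochain_eq_iff
proof (intro conjI ballI impI f'(1))
  show "\<Phi> \<in> obj A \<rightarrow> obj B" using f by (simp add: ainf_morphism_def)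
  fix w assume w: "w \<in> words A" "w \<noteq> []"
  then have c: "composable w" by (simp add: words_def)
  have eq: "wcochain f' q = wcochain f q" if "q \<in> words A" "q \<noteq> []" for q
    using f'(2) that by (simp add: cochain_eq_iff)
  have "wcochain (gcomp f' 1 mA) w = wcochain (gcomp f 1 mA) w"
    unfolding wcochain_gcomp[OF c] using ins_words[OF mA] w by (intro ins_cong eq) auto
  also have "\<dots> = wcochain (ccomp \<Phi> mB f) w"
    using f w by (simp add: ainf_morphism_def cochain_eq_iff)
  also have "\<dots> = wcochain (ccomp \<Phi> mB f') w"
    unfolding wcochain_ccomp[OF c w(2), where c = "\<lambda>_ _. wcochain f", OF refl]
      wcochain_ccomp[OF c w(2), where c = "\<lambda>_ _. wcochain f'", OF refl]
    using words_subword[OF w(1)] by (intro pullback_family_cong) (auto simp: eq)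
  finally show "wcochain (gcomp f' 1 mA) w = wcochain (ccomp \<Phi> mB f') w" .
qed

context ainf_composition
begin

lemma homotopic_composition:
  assumes hom: "ainf_homotopic A mA B mB \<Phi> f g"
  shows "ainf_homotopic A mA C mC (\<Psi> \<circ> \<Phi>) (ccomp \<Phi> h f) (ccomp \<Phi> h g)"
proof -
  from hom obtain a b where a: "a \<in> poly_cochains A B \<Phi> 0" and b: "b \<in> poly_cochains A B \<Phi> (- 1)"
    and f: "ainf_morphism A mA B mB \<Phi> f" "cochain_eq A (peval B a 0) f"
    and g: "ainf_morphism A mA B mB \<Phi> g" "cochain_eq A (peval B a 1) g"
    and mor: "\<And>t. ainf_morphism A mA B mB \<Phi> (peval B a t)"
    and heq: "\<And>t. cochain_eq A (peval B (pderivative B a) t)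
               (\<lambda>xs vs. insert_sum \<Phi> mB (peval B a t) (peval B b t) xs vs + gcomp (peval B b t) 1 mA xs vs)"
    unfolding ainf_homotopic_def by blast
  \<comment> \<open>Path and homotopy in one family, indexed by the number of homotopies, so that
    \<open>s j\<close> has degree -j for \<open>j \<le> 1\<close>.\<close>
  define s where "s = (\<lambda>j :: nat. if j = 0 then a else b)"
  have s: "s j \<in> poly_cochains A B \<Phi> (- int j)" if "j \<le> 1" for j
    using a b that by (cases j) (auto simp: s_def)
  have s_cochains: "s j k \<in> cochains A B \<Phi> (- int j)" if "j \<le> 1" for j k
    using s[OF that] by (simp add: poly_cochains_def)
  define fam where "fam = (\<lambda>k j. wcochain (s j k))"
  \<comment> \<open>\<open>F e k\<close> is the coefficient of t^k in h o a for \<open>e = 0\<close>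
    and in b' for \<open>e = 1\<close>.\<close>
  define F where "F = (\<lambda>e k xs vs. pullback \<Phi> fam k e H (word xs vs))"
  define c where "c = (\<lambda>t i j. wcochain (peval B ((pderivative B ^^ i) (s j)) t))"
  have \<Psi>\<Phi>: "\<Psi> \<circ> \<Phi> \<in> obj A \<rightarrow> obj C" using \<Phi> \<Psi> by auto
  have F: "wcochain (F e k) w = pullback \<Phi> fam k e H w" if "w \<in> words A" "w \<noteq> []" for e k w
    unfolding F_def by (rule wcochain_word[OF that])
  have bound: "\<exists>N. \<forall>w p q r k j. w \<in> words A \<longrightarrow> w = p @ q @ r \<longrightarrow> q \<noteq> [] \<longrightarrow> wobjs w = xs \<longrightarrow>
      N < k \<longrightarrow> j \<le> 1 \<longrightarrow> fam k j q = 0" for xs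
  proof -
    obtain Na where Na: "\<And>q k. q \<in> words A \<Longrightarrow> q \<noteq> [] \<Longrightarrow> set (wobjs q) \<subseteq> set xs \<Longrightarrow>
        length (wobjs q) \<le> length xs \<Longrightarrow> Na < k \<Longrightarrow> wcochain (a k) q = 0"
      using poly_cochains_bound[OF a, of xs] by blast
    obtain Nb where Nb: "\<And>q k. q \<in> words A \<Longrightarrow> q \<noteq> [] \<Longrightarrow> set (wobjs q) \<subseteq> set xs \<Longrightarrow>
        length (wobjs q) \<le> length xs \<Longrightarrow> Nb < k \<Longrightarrow> wcochain (b k) q = 0"
      using poly_cochains_bound[OF b, of xs] by blast
    show ?thesis
    proof (intro exI[of _ "max Na Nb"] allI impI)
      fix w p q r k j assume w: "w \<in> words A" "w = p @ q @ r" "q \<noteq> []" "wobjs w = xs" "max Na Nb < k"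
      have "composable (p @ q @ r)" using w by (simp add: words_def)
      note wobjs_subword_bounds[OF this w(3), folded w(2), unfolded w(4)]
      then have "wcochain (a k) q = 0" "wcochain (b k) q = 0"
        using w(3,5) words_subword[OF w(1,2)] by (auto intro!: Na Nb simp del: length_wobjs)
      then show "fam k j q = 0" by (simp add: fam_def s_def)
    qed
  qed
  have F_poly: "F e \<in> poly_cochains A C (\<Psi> \<circ> \<Phi>) (- int e)" if e: "e \<le> 1" for e
    unfolding poly_cochains_def
  proof (intro CollectI conjI allI ballI)
    show "F e k \<in> cochains A C (\<Psi> \<circ> \<Phi>) (- int e)" for k
      using F e s_cochains by (intro pullback_cochains[where g = "\<lambda>k j. s j k" and k = k]) (auto simp: fam_def)
    fix xs assume xs: "xs \<in> obj_tuples A"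
    obtain N where "\<forall>w p q r k j. w \<in> words A \<longrightarrow> w = p @ q @ r \<longrightarrow> q \<noteq> [] \<longrightarrow> wobjs w = xs \<longrightarrow>
      N < k \<longrightarrow> j \<le> 1 \<longrightarrow> fam k j q = 0" using bound[of xs] ..
    note N = this[rule_format]
    show "\<exists>N. \<forall>k>N. \<forall>vs\<in>inputs A xs. F e k xs vs = 0"
    proof (intro exI[of _ "N * length xs"] allI impI ballI)
      fix k vs assume k: "N * length xs < k" and vs: "vs \<in> inputs A xs"
      have "length vs \<le> length xs" using vs by (simp add: inputs_def)
      then have "N * length (word xs vs) \<le> N * length xs" by simp
      then have "N * length (word xs vs) < k" using k by linarith
      then show "F e k xs vs = 0"
        unfolding F_def
      proof (rule pullback_eq_0[OF wlinear_additive[OF H(1)], rotated])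
        fix p q r k j assume q: "word xs vs = p @ q @ r" "q \<noteq> []" "N < k" "j \<le> e"
        show "fam k j q = 0"
          by (rule N[OF word_words(1)[OF xs vs] q(1,2) word_words(3)[OF xs vs] q(3)]) (use q(4) e in simp)
      qed
    qed
  qed
  \<comment> \<open>For \<open>i = 0\<close> this identifies the values of the composite path and of
    b'; for \<open>i = 1\<close>, \<open>e = 0\<close> it is the Leibniz rule for h o a.\<close>
  have eval: "wcochain (peval C ((pderivative C ^^ i) (F e)) t) w = pullback \<Phi> (c t) i e H w"
    if w: "w \<in> words A" "w \<noteq> []" and ie: "i \<le> 1" "e \<le> 1" for i e t w
  proof -
    obtain N where "\<forall>v p q r k j. v \<in> words A \<longrightarrow> v = p @ q @ r \<longrightarrow> q \<noteq> [] \<longrightarrow> wobjs v = wobjs w \<longrightarrow>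
      N < k \<longrightarrow> j \<le> 1 \<longrightarrow> fam k j q = 0" using bound[of "wobjs w"] ..
    note N = this[rule_format, OF w(1) _ _ refl]
    have fam0: "pullback \<Phi> fam k e H w = 0" if "N * length w < k" for k
    proof (rule pullback_eq_0[OF wlinear_additive[OF H(1)] _ that])
      fix p q r k j assume q: "w = p @ q @ r" "q \<noteq> []" "N < k" "j \<le> e"
      show "fam k j q = 0" by (rule N[OF q(1-3)]) (use q(4) ie in simp)
    qed
    have "pullback \<Phi> (c t) i e H w = (\<Sum>k\<le>N * length w. scl C (taylor t i k) (pullback \<Phi> fam k e H w))"
    proof (rule pullback_taylor[OF vsC H(1)])
      fix p q r i' j assume q: "w = p @ q @ r" "q \<noteq> []" "i' \<le> i" "j \<le> e"
      then have "wcochain (s j k) q = 0" if "N < k" for k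
        using N[of p q r k j] that ie by (simp add: fam_def)
      then show "c t i' j q = (\<Sum>k\<le>N. scl B (taylor t i' k) (fam k j q))"
        unfolding c_def fam_def using q ie by (intro peval_taylor vsB) auto
    next
      fix p q r k j assume q: "w = p @ q @ r" "q \<noteq> []" "N < k" "j \<le> e"
      show "fam k j q = 0" by (rule N[OF q(1-3)]) (use q(4) ie in simp)
    qed simp
    also have "\<dots> = wcochain (peval C ((pderivative C ^^ i) (F e)) t) w"
      using fam0 F[OF w] ie(1) by (subst peval_taylor[OF vsC]) auto
    finally show ?thesis ..
  qed
  have c_00: "c t 0 0 = wcochain (peval B a t)" and c_01: "c t 0 1 = wcochain (peval B b t)"
    and c_10: "c t 1 0 = wcochain (peval B (pderivative B a) t)" for t
    by (auto simp: c_def s_def)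
  have c_cochains: "peval B ((pderivative B ^^ 0) (s j)) t \<in> cochains A B \<Phi> (- int j)" if "j \<le> 1" for j t
    using peval_cochains[OF s[OF that] quivers(1,2) \<Phi>] by simp
  \<comment> \<open>Stated for any cochain agreeing with a(t), so as to cover f and g at the ends as
    well as a(t) itself.\<close>
  have eval_ccomp: "cochain_eq A (peval C (F 0) t) (ccomp \<Phi> h f')"
    if f': "f' \<in> cochains A B \<Phi> 0" "cochain_eq A (peval B a t) f'" for t f'
    unfolding cochain_eq_iff
  proof (intro ballI impI)
    fix w assume w: "w \<in> words A" "w \<noteq> []"
    have "wcochain (peval C (F 0) t) w = pullback \<Phi> (c t) 0 0 H w"
      using eval[OF w, of 0 0 t] by simp
    also have "\<dots> = pullback \<Phi> (\<lambda>_ _. wcochain f') 0 0 H w"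
    proof (rule pullback_family_cong)
      fix p q r and i j :: nat assume "w = p @ q @ r" "q \<noteq> []" "i \<le> 0" "j \<le> 0"
      then show "c t i j q = wcochain f' q"
        using f'(2) words_subword[OF w(1)] by (simp add: c_00 cochain_eq_iff)
    qed
    also have "\<dots> = wcochain (ccomp \<Phi> h f') w"
      by (rule wcochain_ccomp_h[OF w f'(1), symmetric])
    finally show "wcochain (peval C (F 0) t) w = wcochain (ccomp \<Phi> h f') w" .
  qed
  have "ainf_morphism A mA C mC (\<Psi> \<circ> \<Phi>) (peval C (F 0) t)" for t
  proof (rule ainf_morphism_cong[OF ccomp_morphism[OF mor[of t]] mA])
    show "peval C (F 0) t \<in> cochains A C (\<Psi> \<circ> \<Phi>) 0"
      using peval_cochains[OF F_poly[of 0] quivers(1,3) \<Psi>\<Phi>] by simp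
    show "cochain_eq A (peval C (F 0) t) (ccomp \<Phi> h (peval B a t))"
      using mor[of t] by (intro eval_ccomp) (auto simp: ainf_morphism_def cochain_eq_def)
  qed
  moreover have "cochain_eq A (peval C (pderivative C (F 0)) t)
      (\<lambda>xs vs. insert_sum (\<Psi> \<circ> \<Phi>) mC (peval C (F 0) t) (peval C (F 1) t) xs vs +
        gcomp (peval C (F 1) t) 1 mA xs vs)" for t
    unfolding cochain_eq_iff
  proof (intro ballI impI)
    fix w assume w: "w \<in> words A" "w \<noteq> []"
    then have cw: "composable w" by (simp add: words_def)
    \<comment> \<open>The index (1, 0) marks exactly one factor a'(t) among copies of a(t), and no
      b.\<close>
    have "wcochain (peval C (pderivative C (F 0)) t) w = pullback \<Phi> (c t) 1 0 H w"
      using eval[OF w, of 1 0 t] by simp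
    also have "\<dots> = pullback \<Phi> (c t) 0 1 (ins (wcochain mB) H) w + ins (wcochain mA) (pullback \<Phi> (c t) 0 1 H) w"
    proof (rule pullback_ins_homotopy[OF wlinear_additive[OF H(1)]])
      fix p q r assume q: "w = p @ q @ r" "q \<noteq> []"
      have qA: "q \<in> words A" "composable q" using words_subword[OF w(1) q(1)] by (auto simp: words_def)
      show "pullback \<Phi> (c t) 0 0 (wcochain mB) q = ins (wcochain mA) (c t 0 0) q"
        by (rule morphism_words[where c = "c t", OF mor c_00 w(1) q])
      have "wcochain (peval B (pderivative B a) t) q =
          wcochain (insert_sum \<Phi> mB (peval B a t) (peval B b t)) q + wcochain (gcomp (peval B b t) 1 mA) q"
        using heq[of t] qA(1) q(2) by (simp add: cochain_eq_iff wcochain_def)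
      then show "c t 1 0 q = pullback \<Phi> (c t) 0 1 (wcochain mB) q + ins (wcochain mA) (c t 0 1) q"
        by (simp only: c_10 c_01 wcochain_gcomp[OF qA(2)] wcochain_insert_sum[where c = "c t", OF qA(2) q(2) c_00 c_01])
    qed
    also have "pullback \<Phi> (c t) 0 1 (ins (wcochain mB) H) w =
        pullback (\<Psi> \<circ> \<Phi>) (\<lambda>i j. pullback \<Phi> (c t) i j (wcochain h)) 0 1 (wcochain mC) w"
      unfolding c_def
      by (rule pullback_ins_H[OF w, where g = "\<lambda>i j. peval B ((pderivative B ^^ i) (s j)) t"])
         (rule c_cochains)
    \<comment> \<open>A group of factors entering h without b gives the composite path at t, and the
      group containing b gives b'(t).\<close>
    also have "\<dots> = pullback (\<Psi> \<circ> \<Phi>) (\<lambda>i j. wcochain (peval C (F j) t)) 0 1 (wcochain mC) w"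
    proof (rule pullback_family_cong)
      fix p q r and i j :: nat assume q: "w = p @ q @ r" "q \<noteq> []" and ij: "i \<le> 0" "j \<le> 1"
      have qA: "q \<in> words A" by (rule words_subword[OF w(1) q(1)])
      have "pullback \<Phi> (c t) 0 j (wcochain h) q = pullback \<Phi> (c t) 0 j H q"
        unfolding c_def using c_cochains ij
        by (intro pullback_h[OF qA q(2), where g = "\<lambda>i j. peval B ((pderivative B ^^ i) (s j)) t", symmetric]) auto
      then show "pullback \<Phi> (c t) i j (wcochain h) q = wcochain (peval C (F j) t) q"
        using eval[OF qA q(2), of 0 j t] ij by simp
    qed
    also have "\<dots> = wcochain (insert_sum (\<Psi> \<circ> \<Phi>) mC (peval C (F 0) t) (peval C (F 1) t)) w"
      by (rule wcochain_insert_sum[OF cw w(2), symmetric]) auto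
    also have "ins (wcochain mA) (pullback \<Phi> (c t) 0 1 H) w = wcochain (gcomp (peval C (F 1) t) 1 mA) w"
      unfolding wcochain_gcomp[OF cw]
    proof (rule ins_cong)
      fix p q r assume "w = p @ q @ r" "q \<noteq> []"
      then have "p @ out id 1 (wcochain mA) q # r \<in> words A" using ins_words[OF mA] w by simp
      from eval[OF this, of 0 1 t]
      show "pullback \<Phi> (c t) 0 1 H (p @ out id 1 (wcochain mA) q # r) =
          wcochain (peval C (F 1) t) (p @ out id 1 (wcochain mA) q # r)" by simp
    qed
    finally show "wcochain (peval C (pderivative C (F 0)) t) w =
        wcochain (\<lambda>xs vs. insert_sum (\<Psi> \<circ> \<Phi>) mC (peval C (F 0) t) (peval C (F 1) t) xs vs +
          gcomp (peval C (F 1) t) 1 mA xs vs) w"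
      by (simp only: wcochain_def)
  qed
  moreover have "F 0 \<in> poly_cochains A C (\<Psi> \<circ> \<Phi>) 0" "F 1 \<in> poly_cochains A C (\<Psi> \<circ> \<Phi>) (- 1)"
    using F_poly[of 0] F_poly[of 1] by simp_all
  moreover have "cochain_eq A (peval C (F 0) 0) (ccomp \<Phi> h f)" "cochain_eq A (peval C (F 0) 1) (ccomp \<Phi> h g)"
    using f g by (auto simp: ainf_morphism_def intro!: eval_ccomp)
  ultimately show ?thesis
    unfolding ainf_homotopic_def using ccomp_morphism[OF f(1)] ccomp_morphism[OF g(1)] by blast
qed

end

theorem proposition4p9:
  fixes A :: "('k::field, 'a, 'u::ab_group_add) gquiver"
    and B :: "('k, 'b, 'v::ab_group_add) gquiver"
    and C :: "('k, 'c, 'w::ab_group_add) gquiver"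
    and mA :: "('a, 'u, 'u) cochain" and mB :: "('b, 'v, 'v) cochain" and mC :: "('c, 'w, 'w) cochain"
    and \<Phi>0 :: "'a \<Rightarrow> 'b" and \<Psi>0 :: "'b \<Rightarrow> 'c"
    and f g :: "('a, 'u, 'v) cochain" and h :: "('b, 'v, 'w) cochain"
  assumes "CHAR('k) \<noteq> 2" and "CHAR('k) \<noteq> 3"
    and "ainf_category A mA" and "ainf_category B mB" and "ainf_category C mC"
    and "\<Phi>0 \<in> obj A \<rightarrow> obj B" and "\<Psi>0 \<in> obj B \<rightarrow> obj C"
    and "ainf_morphism A mA B mB \<Phi>0 f" and "ainf_morphism A mA B mB \<Phi>0 g"
    and "ainf_homotopic A mA B mB \<Phi>0 f g"
    and "ainf_morphism B mB C mC \<Psi>0 h"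
  shows "ainf_homotopic A mA C mC (\<Psi>0 \<circ> \<Phi>0) (ccomp \<Phi>0 h f) (ccomp \<Phi>0 h g)"
proof -
  have h: "h \<in> cochains B C \<Psi>0 0" and mC: "mC \<in> cochains C C id 1"
    and B: "graded_quiver B" and C: "graded_quiver C" "vector_space (scl C)"
    using assms(4,5,11) by (auto simp: ainf_morphism_def ainf_category_def graded_quiver_def)
  obtain H where H: "wlinear (scl B) (scl C) H" "\<And>w. w \<in> words B \<Longrightarrow> w \<noteq> [] \<Longrightarrow> H w = wcochain h w"
    using cochain_extension[OF h B C(2)] by blast
  obtain M where M: "wlinear (scl C) (scl C) M" "\<And>w. w \<in> words C \<Longrightarrow> w \<noteq> [] \<Longrightarrow> M w = wcochain mC w"
    using cochain_extension[OF mC C] by blast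
  interpret ainf_composition A B C mA mB mC \<Phi>0 \<Psi>0 h H M
    using assms(3-6,11) H M by unfold_locales
  show ?thesis by (rule homotopic_composition) fact
qed

end
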